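(* Let $\mathcal C$ be a symmetric monoidal category satisfying the standing assumptions in the context, and let $(V,|0\rangle,T,Y(z)=\sum_{n\in\mathbb Z}\cdot_n z^{-n-1})$ be a vertex algebra in $\mathcal C$. For any compact objects $X_1,X_2,X_3$ of $\mathcal C$, any morphisms $\alpha\in\mathrm{Hom}_{\mathcal C}(X_1,V)$, $\beta\in\mathrm{Hom}_{\mathcal C}(X_2,V)$, $\gamma\in\mathrm{Hom}_{\mathcal C}(X_3,V)$, and any integers $m,k,l$, the following identity holds in $\mathrm{Hom}_{\mathcal C}(X_1\otimes X_2\otimes X_3,V)$: $$\sum_{n\ge 0}\binom{m}{n}\cdot_{m+k-n}\circ(\cdot_{n+l}\otimes\mathrm{id}_V)\circ(\alpha\otimes\beta\otimes\gamma)$$ $$=\sum_{j\ge 0}\binom{l}{j}(-1)^j\Big(\cdot_{m+l-j}\circ(\mathrm{id}_V\otimes\cdot_{k+j})-(-1)^l\cdot_{k+l-j}\circ(\mathrm{id}_V\otimes\cdot_{m+j})\circ(\sigma\otimes\mathrm{id}_V)\Big)\circ(\alpha\otimes\beta\otimes\gamma).$$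
   Context: Standing assumptions on $\mathcal C$: $(\mathcal C,\otimes,\mathbf 1)$ is a symmetric monoidal category with unit isomorphisms $l_X:\mathbf 1\otimes X\to X$, $r_X:X\otimes\mathbf 1\to X$ and symmetric braiding $\sigma$ (associators are suppressed) such that (i) $\mathcal C\cong\mathrm{Ind}(\mathcal C_0)$ for a symmetric monoidal category $\mathcal C_0$, and $(\mathrm{colim}\,X_a)\otimes(\mathrm{colim}\,Y_b)=\mathrm{colim}(X_a\otimes Y_b)$; (ii) $\mathcal C_0$ is additive, Karoubian (every idempotent splits) and rigid symmetric monoidal; (iii) $\mathbb Q\subset\mathrm{End}_{\mathcal C}(\mathbf 1)$. An object $X$ is compact if $\mathrm{Hom}_{\mathcal C}(X,-)$ preserves filtered colimits. A vertex algebra in $\mathcal C$ is an object $V$ with morphisms $|0\rangle\in\mathrm{Hom}_{\mathcal C}(\mathbf 1,V)$, $T\in\mathrm{Hom}_{\mathcal C}(V,V)$, and $\cdot_n\in\mathrm{Hom}_{\mathcal C}(V\otimes V,V)$ for $n\in\mathbb Z$, with $Y(z)=\sum_n\cdot_n z^{-n-1}$, such that for all compact $X,X'$ and $\alpha:X\to V$, $\beta:X'\to V$ there is $K$ with $\cdot_n\circ(\alpha\otimes\beta)=0$ for all $n\ge K$, and satisfying: (Vacuum) $Y(z)\circ(|0\rangle\otimes\mathrm{id}_V)=l_V$; $Y(z)\circ(\mathrm{id}_V\otimes|0\rangle)\in\mathrm{Hom}_{\mathcal C}(V\otimes\mathbf 1,V)[[z]]$ with value $r_V$ at $z=0$. (Translation)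 $T\circ|0\rangle=0$ and $T\circ Y(z)-Y(z)\circ(\mathrm{id}_V\otimes T)=\partial_zY(z)$. (Locality) for all compact $X,X'$ and $\alpha:X\to V$, $\beta:X'\to V$ there is an integer $K$ with $(z-w)^K\big(Y(w)\circ(\mathrm{id}_V\otimes Y(z))\circ(\alpha\otimes\beta\otimes\mathrm{id}_V)-Y(z)\circ(\mathrm{id}_V\otimes Y(w))\circ(\sigma\otimes\mathrm{id}_V)\circ(\alpha\otimes\beta\otimes\mathrm{id}_V)\big)=0$. *)

theory Defs
  imports Complex_Main "HOL-Library.Equipollence" "HOL-Algebra.Ring"
begin

section \<open>Categories\<close>

record ('o, 'a) cat =
  Obj :: "'o set"
  Arr :: "'a set"
  Dom :: "'a \<Rightarrow> 'o"
  Cod :: "'a \<Rightarrow> 'o"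
  Ident :: "'o \<Rightarrow> 'a"
  Comp :: "'a \<Rightarrow> 'a \<Rightarrow> 'a" (infixr "\<bullet>\<index>" 65)

definition Hom :: "('o, 'a, 'x) cat_scheme \<Rightarrow> 'o \<Rightarrow> 'o \<Rightarrow> 'a set" where
  "Hom C X Y = {f \<in> Arr C. Dom C f = X \<and> Cod C f = Y}"

locale category =
  fixes C :: "('o, 'a, 'x) cat_scheme" (structure)
  assumes Dom_Obj: "f \<in> Arr C \<Longrightarrow> Dom C f \<in> Obj C"
    and Cod_Obj: "f \<in> Arr C \<Longrightarrow> Cod C f \<in> Obj C"
    and Ident_Hom: "X \<in> Obj C \<Longrightarrow> Ident C X \<in> Hom C X X"
    and Comp_Hom: "f \<in> Hom C X Y \<Longrightarrow> g \<in> Hom C Y Z \<Longrightarrow> g \<bullet> f \<in> Hom C X Z"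
    and Comp_Ident: "f \<in> Hom C X Y \<Longrightarrow> f \<bullet> Ident C X = f"
    and Ident_Comp: "f \<in> Hom C X Y \<Longrightarrow> Ident C Y \<bullet> f = f"
    and Comp_assoc: "f \<in> Hom C X Y \<Longrightarrow> g \<in> Hom C Y Z \<Longrightarrow> h \<in> Hom C Z W
      \<Longrightarrow> (h \<bullet> g) \<bullet> f = h \<bullet> (g \<bullet> f)"

definition inverse_arrows :: "('o, 'a, 'x) cat_scheme \<Rightarrow> 'o \<Rightarrow> 'o \<Rightarrow> 'a \<Rightarrow> 'a \<Rightarrow> bool" where
  "inverse_arrows C X Y f g \<longleftrightarrow>
     f \<in> Hom C X Y \<and> g \<in> Hom C Y X \<and> g \<bullet>\<^bsub>C\<^esub> f = Ident C X \<and> f \<bullet>\<^bsub>C\<^esub> g = Ident C Y"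

definition is_iso :: "('o, 'a, 'x) cat_scheme \<Rightarrow> 'o \<Rightarrow> 'o \<Rightarrow> 'a \<Rightarrow> bool" where
  "is_iso C X Y f \<longleftrightarrow> (\<exists>g. inverse_arrows C X Y f g)"

definition is_functor ::
  "('o, 'a, 'x) cat_scheme \<Rightarrow> ('p, 'b, 'y) cat_scheme \<Rightarrow> ('o \<Rightarrow> 'p) \<Rightarrow> ('a \<Rightarrow> 'b) \<Rightarrow> bool" where
  "is_functor C D FO FA \<longleftrightarrow>
     (\<forall>X\<in>Obj C. FO X \<in> Obj D) \<and>
     (\<forall>X\<in>Obj C. \<forall>Y\<in>Obj C. \<forall>f\<in>Hom C X Y. FA f \<in> Hom D (FO X) (FO Y)) \<and>
     (\<forall>X\<in>Obj C. FA (Ident C X) = Ident D (FO X)) \<and>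
     (\<forall>X\<in>Obj C. \<forall>Y\<in>Obj C. \<forall>Z\<in>Obj C. \<forall>f\<in>Hom C X Y. \<forall>g\<in>Hom C Y Z.
        FA (g \<bullet>\<^bsub>C\<^esub> f) = FA g \<bullet>\<^bsub>D\<^esub> FA f)"

definition is_equivalence ::
  "('o, 'a, 'x) cat_scheme \<Rightarrow> ('p, 'b, 'y) cat_scheme \<Rightarrow> ('o \<Rightarrow> 'p) \<Rightarrow> ('a \<Rightarrow> 'b) \<Rightarrow> bool" where
  "is_equivalence C D FO FA \<longleftrightarrow>
     is_functor C D FO FA \<and>
     (\<forall>X\<in>Obj C. \<forall>Y\<in>Obj C. bij_betw FA (Hom C X Y) (Hom D (FO X) (FO Y))) \<and>
     (\<forall>Z\<in>Obj D. \<exists>X\<in>Obj C. \<exists>f. is_iso D (FO X) Z f)"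


section \<open>Filtered diagrams, colimits and compact objects\<close>

text \<open>
  Smallness is measured by a type 'u: index categories have their objects and arrows in 'u, and
  fewer arrows than 'u has elements. If the cardinality of 'u is inaccessible, these are up to
  isomorphism the categories that are small for the corresponding Grothendieck universe. Nothing
  below depends on such an assumption on 'u.
\<close>

record ('i, 'o, 'a) diagram =
  Idx :: "('i, 'i) cat"
  DObj :: "'i \<Rightarrow> 'o"
  DArr :: "'i \<Rightarrow> 'a"

definition is_diagram :: "('o, 'a, 'x) cat_scheme \<Rightarrow> ('i, 'o, 'a) diagram \<Rightarrow> bool" where
  "is_diagram C D \<longleftrightarrow> category (Idx D) \<and> is_functor (Idx D) C (DObj D) (DArr D)"

definition filtered :: "('o, 'a, 'x) cat_scheme \<Rightarrow> bool" where
  "filtered J \<longleftrightarrow>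
     Obj J \<noteq> {} \<and>
     (\<forall>i\<in>Obj J. \<forall>j\<in>Obj J. \<exists>k\<in>Obj J. Hom J i k \<noteq> {} \<and> Hom J j k \<noteq> {}) \<and>
     (\<forall>i\<in>Obj J. \<forall>j\<in>Obj J. \<forall>u\<in>Hom J i j. \<forall>v\<in>Hom J i j.
        \<exists>k\<in>Obj J. \<exists>w\<in>Hom J j k. w \<bullet>\<^bsub>J\<^esub> u = w \<bullet>\<^bsub>J\<^esub> v)"

definition small_filtered_diagram ::
  "('o, 'a, 'x) cat_scheme \<Rightarrow> ('u, 'o, 'a) diagram \<Rightarrow> bool" where
  "small_filtered_diagram C D \<longleftrightarrow>
     is_diagram C D \<and> filtered (Idx D) \<and> Arr (Idx D) \<prec> (UNIV :: 'u set)"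

definition is_cocone ::
  "('o, 'a, 'x) cat_scheme \<Rightarrow> ('i, 'o, 'a) diagram \<Rightarrow> 'o \<Rightarrow> ('i \<Rightarrow> 'a) \<Rightarrow> bool" where
  "is_cocone C D L lam \<longleftrightarrow>
     L \<in> Obj C \<and>
     (\<forall>i\<in>Obj (Idx D). lam i \<in> Hom C (DObj D i) L) \<and>
     (\<forall>i\<in>Obj (Idx D). \<forall>j\<in>Obj (Idx D). \<forall>u\<in>Hom (Idx D) i j. lam j \<bullet>\<^bsub>C\<^esub> DArr D u = lam i)"

definition is_colimit ::
  "('o, 'a, 'x) cat_scheme \<Rightarrow> ('i, 'o, 'a) diagram \<Rightarrow> 'o \<Rightarrow> ('i \<Rightarrow> 'a) \<Rightarrow> bool" where
  "is_colimit C D L lam \<longleftrightarrow>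
     is_cocone C D L lam \<and>
     (\<forall>M kap. is_cocone C D M kap \<longrightarrow>
        (\<exists>!h. h \<in> Hom C L M \<and> (\<forall>i\<in>Obj (Idx D). h \<bullet>\<^bsub>C\<^esub> lam i = kap i)))"

text \<open>
  For a filtered diagram D, the set colim Hom(X, D j) as a quotient of the disjoint union of the
  sets Hom(X, D j).
\<close>

definition hom_elements ::
  "('o, 'a, 'x) cat_scheme \<Rightarrow> 'o \<Rightarrow> ('i, 'o, 'a) diagram \<Rightarrow> ('i \<times> 'a) set" where
  "hom_elements C X D = (SIGMA j : Obj (Idx D). Hom C X (DObj D j))"

definition hom_rel ::
  "('o, 'a, 'x) cat_scheme \<Rightarrow> 'o \<Rightarrow> ('i, 'o, 'a) diagram \<Rightarrow> (('i \<times> 'a) \<times> ('i \<times> 'a)) set" where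
  "hom_rel C X D =
     {((j, f), (j', f')). (j, f) \<in> hom_elements C X D \<and> (j', f') \<in> hom_elements C X D \<and>
        (\<exists>k\<in>Obj (Idx D). \<exists>u\<in>Hom (Idx D) j k. \<exists>v\<in>Hom (Idx D) j' k.
           DArr D u \<bullet>\<^bsub>C\<^esub> f = DArr D v \<bullet>\<^bsub>C\<^esub> f')}"

definition hom_colim ::
  "('o, 'a, 'x) cat_scheme \<Rightarrow> 'o \<Rightarrow> ('i, 'o, 'a) diagram \<Rightarrow> ('i \<times> 'a) set set" where
  "hom_colim C X D = hom_elements C X D // hom_rel C X D"

text \<open>
  Compactness: the canonical map from colim Hom(X, D j) to Hom(X, colim D) is a bijection for
  every small filtered diagram D that has a colimit.
\<close>

definition compact_object :: "'u itself \<Rightarrow> ('o, 'a, 'x) cat_scheme \<Rightarrow> 'o \<Rightarrow> bool" where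
  "compact_object U C X \<longleftrightarrow>
     X \<in> Obj C \<and>
     (\<forall>(D :: ('u, 'o, 'a) diagram) L lam.
        small_filtered_diagram C D \<longrightarrow> is_colimit C D L lam \<longrightarrow>
        bij_betw (\<lambda>c. the_elem ((\<lambda>(j, f). lam j \<bullet>\<^bsub>C\<^esub> f) ` c)) (hom_colim C X D) (Hom C X L))"


section \<open>Ind-objects\<close>

text \<open>
  Objects are the small filtered diagrams in C, and Hom(D, E) is the limit over i of the sets
  colim Hom(D i, E j). An element of this limit is a family of equivalence classes indexed by i;
  an arrow carries its domain and codomain along with such a family.
\<close>

definition ind_hom ::
  "('o, 'a, 'x) cat_scheme \<Rightarrow> ('u, 'o, 'a) diagram \<Rightarrow> ('u, 'o, 'a) diagram
     \<Rightarrow> ('u \<Rightarrow> ('u \<times> 'a) set) set" where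
  "ind_hom C D E =
     {\<phi> \<in> (\<Pi>\<^sub>E i\<in>Obj (Idx D). hom_colim C (DObj D i) E).
        \<forall>i\<in>Obj (Idx D). \<forall>i'\<in>Obj (Idx D). \<forall>u\<in>Hom (Idx D) i i'.
          \<forall>(j, f)\<in>\<phi> i'. (j, f \<bullet>\<^bsub>C\<^esub> DArr D u) \<in> \<phi> i}"

type_synonym ('u, 'o, 'a) ind_arr =
  "('u, 'o, 'a) diagram \<times> ('u \<Rightarrow> ('u \<times> 'a) set) \<times> ('u, 'o, 'a) diagram"

definition Ind ::
  "('o, 'a, 'x) cat_scheme \<Rightarrow> (('u, 'o, 'a) diagram, ('u, 'o, 'a) ind_arr) cat" where
  "Ind C = \<lparr>
     Obj = {D. small_filtered_diagram C D},
     Arr = {(D, \<phi>, E). small_filtered_diagram C D \<and> small_filtered_diagram C E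
              \<and> \<phi> \<in> ind_hom C D E},
     Dom = (\<lambda>(D, \<phi>, E). D),
     Cod = (\<lambda>(D, \<phi>, E). E),
     Ident = (\<lambda>D. (D, \<lambda>i\<in>Obj (Idx D). hom_rel C (DObj D i) D `` {(i, Ident C (DObj D i))}, D)),
     Comp = (\<lambda>(_, \<psi>, F) (D, \<phi>, _).
       (D, \<lambda>i\<in>Obj (Idx D). \<Union>(j, f)\<in>\<phi> i. \<Union>(k, g)\<in>\<psi> j. hom_rel C (DObj D i) F `` {(k, g \<bullet>\<^bsub>C\<^esub> f)}, F))
   \<rparr>"

text \<open>
  The embedding of C into Ind C by constant diagrams over a one-point category; which element of
  'u serves as the point is irrelevant.
\<close>

definition point_cat :: "('u, 'u) cat" where
  "point_cat = \<lparr> Obj = {undefined}, Arr = {undefined}, Dom = (\<lambda>_. undefined),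
     Cod = (\<lambda>_. undefined), Ident = (\<lambda>_. undefined), Comp = (\<lambda>_ _. undefined) \<rparr>"

definition const_obj :: "('o, 'a, 'x) cat_scheme \<Rightarrow> 'o \<Rightarrow> ('u, 'o, 'a) diagram" where
  "const_obj C X = \<lparr> Idx = point_cat, DObj = (\<lambda>_. X), DArr = (\<lambda>_. Ident C X) \<rparr>"

definition const_arr :: "('o, 'a, 'x) cat_scheme \<Rightarrow> 'a \<Rightarrow> ('u, 'o, 'a) ind_arr" where
  "const_arr C f =
     (const_obj C (Dom C f), \<lambda>i\<in>Obj point_cat. {(undefined, f)}, const_obj C (Cod C f))"


section \<open>Additive symmetric monoidal categories\<close>

record ('o, 'a) smcat = "('o, 'a) cat" +
  Ten :: "'o \<Rightarrow> 'o \<Rightarrow> 'o" (infixl "\<boxtimes>\<^sub>o\<index>" 70)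
  TenA :: "'a \<Rightarrow> 'a \<Rightarrow> 'a" (infixl "\<boxtimes>\<index>" 70)
  Unit :: "'o"
  Assoc :: "'o \<Rightarrow> 'o \<Rightarrow> 'o \<Rightarrow> 'a"
  LUnit :: "'o \<Rightarrow> 'a"
  RUnit :: "'o \<Rightarrow> 'a"
  Braid :: "'o \<Rightarrow> 'o \<Rightarrow> 'a"

locale symmetric_monoidal = category C
  for C :: "('o, 'a, 'x) smcat_scheme" (structure) +
  assumes Ten_Obj: "X \<in> Obj C \<Longrightarrow> Y \<in> Obj C \<Longrightarrow> X \<boxtimes>\<^sub>o Y \<in> Obj C"
    and TenA_Hom: "f \<in> Hom C X Y \<Longrightarrow> g \<in> Hom C Z W \<Longrightarrow> f \<boxtimes> g \<in> Hom C (X \<boxtimes>\<^sub>o Z) (Y \<boxtimes>\<^sub>o W)"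
    and TenA_Ident: "X \<in> Obj C \<Longrightarrow> Y \<in> Obj C \<Longrightarrow> Ident C X \<boxtimes> Ident C Y = Ident C (X \<boxtimes>\<^sub>o Y)"
    and TenA_Comp: "f \<in> Hom C X Y \<Longrightarrow> f' \<in> Hom C Y Z \<Longrightarrow> g \<in> Hom C X' Y' \<Longrightarrow> g' \<in> Hom C Y' Z'
      \<Longrightarrow> (f' \<bullet> f) \<boxtimes> (g' \<bullet> g) = (f' \<boxtimes> g') \<bullet> (f \<boxtimes> g)"
    and Unit_Obj: "Unit C \<in> Obj C"
    and Assoc_iso: "X \<in> Obj C \<Longrightarrow> Y \<in> Obj C \<Longrightarrow> Z \<in> Obj C
      \<Longrightarrow> is_iso C ((X \<boxtimes>\<^sub>o Y) \<boxtimes>\<^sub>o Z) (X \<boxtimes>\<^sub>o (Y \<boxtimes>\<^sub>o Z)) (Assoc C X Y Z)"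
    and Assoc_natural: "f \<in> Hom C X X' \<Longrightarrow> g \<in> Hom C Y Y' \<Longrightarrow> h \<in> Hom C Z Z'
      \<Longrightarrow> Assoc C X' Y' Z' \<bullet> ((f \<boxtimes> g) \<boxtimes> h) = (f \<boxtimes> (g \<boxtimes> h)) \<bullet> Assoc C X Y Z"
    and LUnit_iso: "X \<in> Obj C \<Longrightarrow> is_iso C (Unit C \<boxtimes>\<^sub>o X) X (LUnit C X)"
    and LUnit_natural: "f \<in> Hom C X Y
      \<Longrightarrow> LUnit C Y \<bullet> (Ident C (Unit C) \<boxtimes> f) = f \<bullet> LUnit C X"
    and RUnit_iso: "X \<in> Obj C \<Longrightarrow> is_iso C (X \<boxtimes>\<^sub>o Unit C) X (RUnit C X)"
    and RUnit_natural: "f \<in> Hom C X Y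
      \<Longrightarrow> RUnit C Y \<bullet> (f \<boxtimes> Ident C (Unit C)) = f \<bullet> RUnit C X"
    and Braid_Hom: "X \<in> Obj C \<Longrightarrow> Y \<in> Obj C \<Longrightarrow> Braid C X Y \<in> Hom C (X \<boxtimes>\<^sub>o Y) (Y \<boxtimes>\<^sub>o X)"
    and Braid_natural: "f \<in> Hom C X X' \<Longrightarrow> g \<in> Hom C Y Y'
      \<Longrightarrow> Braid C X' Y' \<bullet> (f \<boxtimes> g) = (g \<boxtimes> f) \<bullet> Braid C X Y"
    and Braid_symmetric: "X \<in> Obj C \<Longrightarrow> Y \<in> Obj C
      \<Longrightarrow> Braid C Y X \<bullet> Braid C X Y = Ident C (X \<boxtimes>\<^sub>o Y)"
    and pentagon: "W \<in> Obj C \<Longrightarrow> X \<in> Obj C \<Longrightarrow> Y \<in> Obj C \<Longrightarrow> Z \<in> Obj C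
      \<Longrightarrow> (Ident C W \<boxtimes> Assoc C X Y Z) \<bullet> Assoc C W (X \<boxtimes>\<^sub>o Y) Z \<bullet> (Assoc C W X Y \<boxtimes> Ident C Z)
        = Assoc C W X (Y \<boxtimes>\<^sub>o Z) \<bullet> Assoc C (W \<boxtimes>\<^sub>o X) Y Z"
    and triangle: "X \<in> Obj C \<Longrightarrow> Y \<in> Obj C
      \<Longrightarrow> (Ident C X \<boxtimes> LUnit C Y) \<bullet> Assoc C X (Unit C) Y = RUnit C X \<boxtimes> Ident C Y"
    and hexagon: "X \<in> Obj C \<Longrightarrow> Y \<in> Obj C \<Longrightarrow> Z \<in> Obj C
      \<Longrightarrow> Assoc C Y Z X \<bullet> Braid C X (Y \<boxtimes>\<^sub>o Z) \<bullet> Assoc C X Y Z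
        = (Ident C Y \<boxtimes> Braid C X Z) \<bullet> Assoc C Y X Z \<bullet> (Braid C X Y \<boxtimes> Ident C Z)"

record ('o, 'a) additive_smcat = "('o, 'a) smcat" +
  HZero :: "'o \<Rightarrow> 'o \<Rightarrow> 'a"
  HAdd :: "'a \<Rightarrow> 'a \<Rightarrow> 'a"

text \<open>
  The group of arrows from X to Y, in the shape of a ring record. The multiplicative part is
  meaningful only for X = Y, where this is the endomorphism ring.
\<close>

definition HomG :: "('o, 'a, 'x) additive_smcat_scheme \<Rightarrow> 'o \<Rightarrow> 'o \<Rightarrow> 'a ring" where
  "HomG C X Y = \<lparr> carrier = Hom C X Y, monoid.mult = Comp C, one = Ident C X,
     zero = HZero C X Y, add = HAdd C \<rparr>"

text \<open>
  Biadditivity of the tensor product is automatic for an additive rigid category and for its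
  category of ind-objects; it is part of the usual notion of an additive symmetric monoidal
  category and is recorded here.
\<close>

locale preadditive_symmetric_monoidal = symmetric_monoidal C
  for C :: "('o, 'a, 'x) additive_smcat_scheme" (structure) +
  assumes HomG_group: "X \<in> Obj C \<Longrightarrow> Y \<in> Obj C \<Longrightarrow> abelian_group (HomG C X Y)"
    and Comp_HAdd_left: "f \<in> Hom C X Y \<Longrightarrow> g \<in> Hom C Y Z \<Longrightarrow> g' \<in> Hom C Y Z
      \<Longrightarrow> HAdd C g g' \<bullet> f = HAdd C (g \<bullet> f) (g' \<bullet> f)"
    and Comp_HAdd_right: "f \<in> Hom C X Y \<Longrightarrow> f' \<in> Hom C X Y \<Longrightarrow> g \<in> Hom C Y Z
      \<Longrightarrow> g \<bullet> HAdd C f f' = HAdd C (g \<bullet> f) (g \<bullet> f')"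
    and TenA_HAdd_left: "f \<in> Hom C X Y \<Longrightarrow> f' \<in> Hom C X Y \<Longrightarrow> g \<in> Hom C Z W
      \<Longrightarrow> HAdd C f f' \<boxtimes> g = HAdd C (f \<boxtimes> g) (f' \<boxtimes> g)"
    and TenA_HAdd_right: "f \<in> Hom C X Y \<Longrightarrow> g \<in> Hom C Z W \<Longrightarrow> g' \<in> Hom C Z W
      \<Longrightarrow> f \<boxtimes> HAdd C g g' = HAdd C (f \<boxtimes> g) (f \<boxtimes> g')"

definition is_biproduct ::
  "('o, 'a, 'x) additive_smcat_scheme \<Rightarrow> 'o \<Rightarrow> 'o \<Rightarrow> 'o \<Rightarrow> bool" where
  "is_biproduct C X Y P \<longleftrightarrow>
     P \<in> Obj C \<and>
     (\<exists>i\<in>Hom C X P. \<exists>j\<in>Hom C Y P. \<exists>p\<in>Hom C P X. \<exists>q\<in>Hom C P Y.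
        p \<bullet>\<^bsub>C\<^esub> i = Ident C X \<and> q \<bullet>\<^bsub>C\<^esub> j = Ident C Y \<and>
        p \<bullet>\<^bsub>C\<^esub> j = HZero C Y X \<and> q \<bullet>\<^bsub>C\<^esub> i = HZero C X Y \<and>
        HAdd C (i \<bullet>\<^bsub>C\<^esub> p) (j \<bullet>\<^bsub>C\<^esub> q) = Ident C P)"

definition additive :: "('o, 'a, 'x) additive_smcat_scheme \<Rightarrow> bool" where
  "additive C \<longleftrightarrow>
     (\<exists>Z\<in>Obj C. Ident C Z = HZero C Z Z) \<and>
     (\<forall>X\<in>Obj C. \<forall>Y\<in>Obj C. \<exists>P. is_biproduct C X Y P)"

definition karoubian :: "('o, 'a, 'x) cat_scheme \<Rightarrow> bool" where
  "karoubian C \<longleftrightarrow>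
     (\<forall>X\<in>Obj C. \<forall>e\<in>Hom C X X. e \<bullet>\<^bsub>C\<^esub> e = e \<longrightarrow>
        (\<exists>Y\<in>Obj C. \<exists>r\<in>Hom C X Y. \<exists>s\<in>Hom C Y X.
           r \<bullet>\<^bsub>C\<^esub> s = Ident C Y \<and> s \<bullet>\<^bsub>C\<^esub> r = e))"

definition is_dual ::
  "('o, 'a, 'x) smcat_scheme \<Rightarrow> 'o \<Rightarrow> 'o \<Rightarrow> bool" where
  "is_dual C X X' \<longleftrightarrow>
     X' \<in> Obj C \<and>
     (\<exists>ev\<in>Hom C (X' \<boxtimes>\<^sub>o\<^bsub>C\<^esub> X) (Unit C). \<exists>coev\<in>Hom C (Unit C) (X \<boxtimes>\<^sub>o\<^bsub>C\<^esub> X'). \<exists>b.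
        inverse_arrows C ((X' \<boxtimes>\<^sub>o\<^bsub>C\<^esub> X) \<boxtimes>\<^sub>o\<^bsub>C\<^esub> X') (X' \<boxtimes>\<^sub>o\<^bsub>C\<^esub> (X \<boxtimes>\<^sub>o\<^bsub>C\<^esub> X')) (Assoc C X' X X') b \<and>
        RUnit C X \<bullet>\<^bsub>C\<^esub> (Ident C X \<boxtimes>\<^bsub>C\<^esub> ev) \<bullet>\<^bsub>C\<^esub> Assoc C X X' X \<bullet>\<^bsub>C\<^esub> (coev \<boxtimes>\<^bsub>C\<^esub> Ident C X)
          = LUnit C X \<and>
        LUnit C X' \<bullet>\<^bsub>C\<^esub> (ev \<boxtimes>\<^bsub>C\<^esub> Ident C X') \<bullet>\<^bsub>C\<^esub> b \<bullet>\<^bsub>C\<^esub> (Ident C X' \<boxtimes>\<^bsub>C\<^esub> coev)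
          = RUnit C X')"

text \<open>In a symmetric monoidal category left duals are also right duals.\<close>

definition rigid :: "('o, 'a, 'x) smcat_scheme \<Rightarrow> bool" where
  "rigid C \<longleftrightarrow> (\<forall>X\<in>Obj C. \<exists>X'. is_dual C X X')"

definition symmetric_monoidal_functor ::
  "('o, 'a, 'x) smcat_scheme \<Rightarrow> ('p, 'b, 'y) smcat_scheme \<Rightarrow> ('o \<Rightarrow> 'p) \<Rightarrow> ('a \<Rightarrow> 'b) \<Rightarrow> bool" where
  "symmetric_monoidal_functor C D FO FA \<longleftrightarrow>
     is_functor C D FO FA \<and>
     (\<exists>\<epsilon> \<mu>.
        is_iso D (Unit D) (FO (Unit C)) \<epsilon> \<and>
        (\<forall>X\<in>Obj C. \<forall>Y\<in>Obj C. is_iso D (FO X \<boxtimes>\<^sub>o\<^bsub>D\<^esub> FO Y) (FO (X \<boxtimes>\<^sub>o\<^bsub>C\<^esub> Y)) (\<mu> X Y)) \<and>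
        (\<forall>X\<in>Obj C. \<forall>X'\<in>Obj C. \<forall>Y\<in>Obj C. \<forall>Y'\<in>Obj C. \<forall>f\<in>Hom C X X'. \<forall>g\<in>Hom C Y Y'.
           \<mu> X' Y' \<bullet>\<^bsub>D\<^esub> (FA f \<boxtimes>\<^bsub>D\<^esub> FA g) = FA (f \<boxtimes>\<^bsub>C\<^esub> g) \<bullet>\<^bsub>D\<^esub> \<mu> X Y) \<and>
        (\<forall>X\<in>Obj C. \<forall>Y\<in>Obj C. \<forall>Z\<in>Obj C.
           FA (Assoc C X Y Z) \<bullet>\<^bsub>D\<^esub> \<mu> (X \<boxtimes>\<^sub>o\<^bsub>C\<^esub> Y) Z \<bullet>\<^bsub>D\<^esub> (\<mu> X Y \<boxtimes>\<^bsub>D\<^esub> Ident D (FO Z))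
           = \<mu> X (Y \<boxtimes>\<^sub>o\<^bsub>C\<^esub> Z) \<bullet>\<^bsub>D\<^esub> (Ident D (FO X) \<boxtimes>\<^bsub>D\<^esub> \<mu> Y Z) \<bullet>\<^bsub>D\<^esub> Assoc D (FO X) (FO Y) (FO Z)) \<and>
        (\<forall>X\<in>Obj C. FA (LUnit C X) \<bullet>\<^bsub>D\<^esub> \<mu> (Unit C) X \<bullet>\<^bsub>D\<^esub> (\<epsilon> \<boxtimes>\<^bsub>D\<^esub> Ident D (FO X)) = LUnit D (FO X)) \<and>
        (\<forall>X\<in>Obj C. FA (RUnit C X) \<bullet>\<^bsub>D\<^esub> \<mu> X (Unit C) \<bullet>\<^bsub>D\<^esub> (Ident D (FO X) \<boxtimes>\<^bsub>D\<^esub> \<epsilon>) = RUnit D (FO X)) \<and>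
        (\<forall>X\<in>Obj C. \<forall>Y\<in>Obj C. FA (Braid C X Y) \<bullet>\<^bsub>D\<^esub> \<mu> X Y = \<mu> Y X \<bullet>\<^bsub>D\<^esub> Braid D (FO X) (FO Y)))"


section \<open>The standing assumptions\<close>

definition product_cat :: "('i, 'i) cat \<Rightarrow> ('j, 'j) cat \<Rightarrow> ('i \<times> 'j, 'i \<times> 'j) cat" where
  "product_cat I J = \<lparr>
     Obj = Obj I \<times> Obj J,
     Arr = Arr I \<times> Arr J,
     Dom = map_prod (Dom I) (Dom J),
     Cod = map_prod (Cod I) (Cod J),
     Ident = map_prod (Ident I) (Ident J),
     Comp = (\<lambda>(u', v') (u, v). (u' \<bullet>\<^bsub>I\<^esub> u, v' \<bullet>\<^bsub>J\<^esub> v)) \<rparr>"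

definition tensor_diagram ::
  "('o, 'a, 'x) smcat_scheme \<Rightarrow> ('i, 'o, 'a) diagram \<Rightarrow> ('j, 'o, 'a) diagram
     \<Rightarrow> ('i \<times> 'j, 'o, 'a) diagram" where
  "tensor_diagram C D E = \<lparr>
     Idx = product_cat (Idx D) (Idx E),
     DObj = (\<lambda>(i, j). DObj D i \<boxtimes>\<^sub>o\<^bsub>C\<^esub> DObj E j),
     DArr = (\<lambda>(u, v). DArr D u \<boxtimes>\<^bsub>C\<^esub> DArr E v) \<rparr>"

definition tensor_preserves_filtered_colimits ::
  "'u itself \<Rightarrow> ('o, 'a, 'x) smcat_scheme \<Rightarrow> bool" where
  "tensor_preserves_filtered_colimits U C \<longleftrightarrow>
     (\<forall>(D :: ('u, 'o, 'a) diagram) (E :: ('u, 'o, 'a) diagram) L lam M kap.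
        small_filtered_diagram C D \<longrightarrow> small_filtered_diagram C E \<longrightarrow>
        is_colimit C D L lam \<longrightarrow> is_colimit C E M kap \<longrightarrow>
        is_colimit C (tensor_diagram C D E) (L \<boxtimes>\<^sub>o\<^bsub>C\<^esub> M) (\<lambda>(i, j). lam i \<boxtimes>\<^bsub>C\<^esub> kap j))"

definition rat_ring :: "rat ring" where
  "rat_ring = \<lparr> carrier = UNIV, monoid.mult = (*), one = 1, zero = 0, add = (+) \<rparr>"

text \<open>
  The equivalence of C with Ind C0 is one of symmetric monoidal categories: it restricts to a
  symmetric monoidal functor on C0, and the tensor product of C is the extension of that of C0
  along filtered colimits.
\<close>

locale ind_rigid_category = preadditive_symmetric_monoidal C + C0: preadditive_symmetric_monoidal C0
  for U :: "'u itself"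
    and C :: "('o, 'a, 'x) additive_smcat_scheme" (structure)
    and C0 :: "('p, 'b, 'y) additive_smcat_scheme" +
  assumes Ind_equivalence:
    "\<exists>(EO :: ('u, 'p, 'b) diagram \<Rightarrow> 'o) (EA :: ('u, 'p, 'b) ind_arr \<Rightarrow> 'a).
       is_equivalence (Ind C0) C EO EA \<and>
       symmetric_monoidal_functor C0 C (EO \<circ> const_obj C0) (EA \<circ> const_arr C0)"
    and tensor_colimits: "tensor_preserves_filtered_colimits U C"
    and additive_C0: "additive C0"
    and karoubian_C0: "karoubian C0"
    and rigid_C0: "rigid C0"
    and rational: "\<exists>q \<in> ring_hom rat_ring (HomG C (Unit C) (Unit C)). inj q"


section \<open>Vertex algebras\<close>

text \<open>
  A formal distribution in z with coefficients in an abelian group G sends p to the coefficient of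
  z^p; one in z and w sends p and q to the coefficient of z^p w^q.
\<close>

definition fd_deriv :: "('a, 'm) ring_scheme \<Rightarrow> (int \<Rightarrow> 'a) \<Rightarrow> int \<Rightarrow> 'a" where
  "fd_deriv G F = (\<lambda>p. add_pow G (p + 1) (F (p + 1)))"

definition mult_z_minus_w :: "('a, 'm) ring_scheme \<Rightarrow> (int \<Rightarrow> int \<Rightarrow> 'a) \<Rightarrow> int \<Rightarrow> int \<Rightarrow> 'a" where
  "mult_z_minus_w G F = (\<lambda>p q. F (p - 1) q \<ominus>\<^bsub>G\<^esub> F p (q - 1))"

record ('o, 'a) va_data =
  VObj :: "'o"
  Vac :: "'a"
  Trans :: "'a"
  Mode :: "int \<Rightarrow> 'a"

definition Y_coeff :: "('o, 'a, 'v) va_data_scheme \<Rightarrow> int \<Rightarrow> 'a" where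
  "Y_coeff A p = Mode A (- p - 1)"

text \<open>
  In the locality axiom (z - w)^K is a polynomial, so K is a natural number.
\<close>

locale vertex_algebra =
  fixes U :: "'u itself"
    and C :: "('o, 'a, 'x) additive_smcat_scheme" (structure)
    and A :: "('o, 'a, 'v) va_data_scheme"
    and V :: 'o and idV :: 'a and vac :: 'a and T :: 'a and Y :: "int \<Rightarrow> 'a"
  defines "V \<equiv> VObj A" and "idV \<equiv> Ident C (VObj A)"
    and "vac \<equiv> Vac A" and "T \<equiv> Trans A" and "Y \<equiv> Y_coeff A"
  assumes V_Obj: "V \<in> Obj C"
    and Vac_Hom: "vac \<in> Hom C (Unit C) V"
    and Trans_Hom: "T \<in> Hom C V V"
    and Mode_Hom: "Mode A n \<in> Hom C (V \<boxtimes>\<^sub>o V) V"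
    and truncation:
      "compact_object U C X \<Longrightarrow> compact_object U C X' \<Longrightarrow>
       \<alpha> \<in> Hom C X V \<Longrightarrow> \<beta> \<in> Hom C X' V \<Longrightarrow>
       \<exists>K. \<forall>n\<ge>K. Mode A n \<bullet> (\<alpha> \<boxtimes> \<beta>) = HZero C (X \<boxtimes>\<^sub>o X') V"
    and vacuum_left:
      "Y p \<bullet> (vac \<boxtimes> idV) = (if p = 0 then LUnit C V else HZero C (Unit C \<boxtimes>\<^sub>o V) V)"
    and vacuum_right: "p < 0 \<Longrightarrow> Y p \<bullet> (idV \<boxtimes> vac) = HZero C (V \<boxtimes>\<^sub>o Unit C) V"
    and vacuum_right_0: "Y 0 \<bullet> (idV \<boxtimes> vac) = RUnit C V"
    and translation_vacuum: "T \<bullet> vac = HZero C (Unit C) V"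
    and translation:
      "(\<lambda>p. (T \<bullet> Y p) \<ominus>\<^bsub>HomG C (V \<boxtimes>\<^sub>o V) V\<^esub> (Y p \<bullet> (idV \<boxtimes> T)))
       = fd_deriv (HomG C (V \<boxtimes>\<^sub>o V) V) Y"
    and locality:
      "compact_object U C X \<Longrightarrow> compact_object U C X' \<Longrightarrow>
       \<alpha> \<in> Hom C X V \<Longrightarrow> \<beta> \<in> Hom C X' V \<Longrightarrow>
       \<exists>K::nat.
         (mult_z_minus_w (HomG C ((X \<boxtimes>\<^sub>o X') \<boxtimes>\<^sub>o V) V) ^^ K)
           (\<lambda>p q.
              (Y q \<bullet> (idV \<boxtimes> Y p) \<bullet> Assoc C V V V \<bullet> ((\<alpha> \<boxtimes> \<beta>) \<boxtimes> idV))
              \<ominus>\<^bsub>HomG C ((X \<boxtimes>\<^sub>o X') \<boxtimes>\<^sub>o V) V\<^esub>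
              (Y p \<bullet> (idV \<boxtimes> Y q) \<bullet> Assoc C V V V \<bullet> (Braid C V V \<boxtimes> idV) \<bullet> ((\<alpha> \<boxtimes> \<beta>) \<boxtimes> idV)))
         = (\<lambda>p q. HZero C ((X \<boxtimes>\<^sub>o X') \<boxtimes>\<^sub>o V) V)"


section \<open>The two sides of the identity\<close>

text \<open>
  The binomial coefficient with integer upper entry (possibly negative). This is what gchoose
  unfolds to at type int, but Complex_Main constrains gchoose to fields, where it would come with a
  coercion to the reals.
\<close>

definition int_choose :: "int \<Rightarrow> nat \<Rightarrow> int" where
  "int_choose m n = (\<Prod>i=0..<n. m - int i) div fact n"

text \<open>
  The n-th and j-th summands, as arrows from S to V; here abc is the tensor product of the three
  test arrows, from S to the left-bracketed triple tensor power of V. Associators are written out.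
\<close>

definition borcherds_left ::
  "('o, 'a, 'x) additive_smcat_scheme \<Rightarrow> ('o, 'a, 'v) va_data_scheme \<Rightarrow> 'o \<Rightarrow> 'a
     \<Rightarrow> int \<Rightarrow> int \<Rightarrow> int \<Rightarrow> nat \<Rightarrow> 'a" where
  "borcherds_left C A S abc m k l n =
     (let V = VObj A in
      add_pow (HomG C S V) (int_choose m n)
        (Mode A (m + k - int n) \<bullet>\<^bsub>C\<^esub> (Mode A (int n + l) \<boxtimes>\<^bsub>C\<^esub> Ident C V) \<bullet>\<^bsub>C\<^esub> abc))"

definition borcherds_right ::
  "('o, 'a, 'x) additive_smcat_scheme \<Rightarrow> ('o, 'a, 'v) va_data_scheme \<Rightarrow> 'o \<Rightarrow> 'a
     \<Rightarrow> int \<Rightarrow> int \<Rightarrow> int \<Rightarrow> nat \<Rightarrow> 'a" where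
  "borcherds_right C A S abc m k l j =
     (let V = VObj A; idV = Ident C V; G = HomG C ((V \<boxtimes>\<^sub>o\<^bsub>C\<^esub> V) \<boxtimes>\<^sub>o\<^bsub>C\<^esub> V) V in
      add_pow (HomG C S V) (int_choose l j * (- 1) ^ j)
        (((Mode A (m + l - int j) \<bullet>\<^bsub>C\<^esub> (idV \<boxtimes>\<^bsub>C\<^esub> Mode A (k + int j)) \<bullet>\<^bsub>C\<^esub> Assoc C V V V)
          \<ominus>\<^bsub>G\<^esub>
          add_pow G (if even l then 1 else - 1 :: int)
            (Mode A (k + l - int j) \<bullet>\<^bsub>C\<^esub> (idV \<boxtimes>\<^bsub>C\<^esub> Mode A (m + int j)) \<bullet>\<^bsub>C\<^esub> Assoc C V V V
              \<bullet>\<^bsub>C\<^esub> (Braid C V V \<boxtimes>\<^bsub>C\<^esub> Ident C V)))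
         \<bullet>\<^bsub>C\<^esub> abc))"

text \<open>
  A sum over all natural numbers is the sum over the support. Since finsum over an infinite set is
  zero by convention, finiteness of the support has to be stated alongside.
\<close>

definition support :: "('a, 'm) ring_scheme \<Rightarrow> (nat \<Rightarrow> 'a) \<Rightarrow> nat set" where
  "support G f = {n. f n \<noteq> \<zero>\<^bsub>G\<^esub>}"

end

theory Submission
  imports Defs "HOL-Library.Poly_Mapping" "HOL-Library.Product_Plus"
begin

text \<open>
  The heart of the matter is the case \<open>m = 0\<close>: the field of the \<open>l\<close>-th product \<open>u\<close> of \<open>\<alpha>\<close> and \<open>\<beta>\<close> is
  the residue in \<open>x\<close> of \<open>(x - y)\<^sup>l\<close> times the two orders of the fields of \<open>\<alpha>\<close> at \<open>x\<close> and \<open>\<beta>\<close> at \<open>y\<close>, each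
  expanded in its own region. Both fields agree on the vacuum, where they solve the equation
  \<open>\<partial> f = T f\<close> with the same initial value (the Hom groups are rational vector spaces), and by Dong's
  lemma both are local with respect to the field of \<open>\<gamma>\<close>. Goddard's uniqueness argument makes them
  agree on \<open>\<gamma>\<close>. The general case follows by a recursion in \<open>(m, k, l)\<close>.

  Locality of \<open>u\<close> and \<open>\<gamma>\<close> is only available if \<open>X1 \<otimes> X2\<close> is compact. A compact object is a retract of
  an object \<open>P\<close> of \<open>C0\<close>, and \<open>P\<close> has a dual, so tensoring with \<open>P\<close> has a right adjoint that
  preserves filtered colimits; hence \<open>Y \<otimes> P\<close> is compact for compact \<open>Y\<close>, and so are its retracts.
\<close>

section \<open>Calculus of arrows in symmetric monoidal categories\<close>

text \<open>No infinite series and no limits are used. A word in the fields is an additive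
  functional on Laurent polynomials in x, y, z, an expansion of (x - y)^l is cut after
  \<open>J\<close> terms, and identities between expansions are claimed for all large
  \<open>J\<close>; truncation makes the neglected tails invisible.

  There are no vectors: \<alpha>, \<beta>, \<gamma> are arrows, and words that apply them in
  different orders have different sources. All words are therefore pulled back to the one source
  \<open>((X3 \<boxtimes>\<^sub>o X1) \<boxtimes>\<^sub>o X2) \<boxtimes>\<^sub>o Unit C\<close>,
  whose last factor carries the vacuum; it begins with \<open>X3\<close> because \<gamma> has to
  travel from the outermost to the innermost position. Exponents are mode numbers, so multiplying by
  a variable raises a mode. A nonnegative exponent of the innermost field annihilates the vacuum and
  exponent -1 gives back its arrow. This is why z-exponents from -1 on are the ones to control, and
  why the identity is read off at z-exponent -1, after cancelling a split epimorphism onto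
  \<open>(X1 \<boxtimes>\<^sub>o X2) \<boxtimes>\<^sub>o X3\<close>.\<close>

lemma HomI: "f \<in> Arr C \<Longrightarrow> Dom C f = X \<Longrightarrow> Cod C f = Y \<Longrightarrow> f \<in> Hom C X Y"
  by (simp add: Hom_def)

lemma HomD:
  assumes "f \<in> Hom C X Y"
  shows "f \<in> Arr C" "Dom C f = X" "Cod C f = Y"
  using assms by (simp_all add: Hom_def)

context category
begin

lemma Hom_Obj: "f \<in> Hom C X Y \<Longrightarrow> X \<in> Obj C" "f \<in> Hom C X Y \<Longrightarrow> Y \<in> Obj C"
  using Dom_Obj Cod_Obj by (auto simp: Hom_def)

lemma Comp_arr:
  assumes "f \<in> Arr C" "g \<in> Arr C" "Cod C f = Dom C g"
  shows "g \<bullet> f \<in> Arr C" "Dom C (g \<bullet> f) = Dom C f" "Cod C (g \<bullet> f) = Cod C g"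
  using Comp_Hom[of f "Dom C f" "Cod C f" g "Cod C g"] assms by (auto simp: Hom_def)

lemma Ident_arr:
  assumes "X \<in> Obj C"
  shows "Ident C X \<in> Arr C" "Dom C (Ident C X) = X" "Cod C (Ident C X) = X"
  using Ident_Hom[OF assms] by (auto simp: Hom_def)

lemma Comp_assoc_arr:
  assumes "f \<in> Arr C" "g \<in> Arr C" "h \<in> Arr C" "Cod C f = Dom C g" "Cod C g = Dom C h"
  shows "(h \<bullet> g) \<bullet> f = h \<bullet> g \<bullet> f"
  using Comp_assoc[of f "Dom C f" "Cod C f" g "Cod C g" h "Cod C h"] assms by (auto simp: Hom_def)

lemma Comp_Ident_arr: "f \<in> Arr C \<Longrightarrow> Dom C f = X \<Longrightarrow> f \<bullet> Ident C X = f"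
  using Comp_Ident[of f X "Cod C f"] by (auto simp: Hom_def)

lemma Ident_Comp_arr: "f \<in> Arr C \<Longrightarrow> Cod C f = X \<Longrightarrow> Ident C X \<bullet> f = f"
  using Ident_Comp[of f "Dom C f" X] by (auto simp: Hom_def)

text \<open>The arrow \<open>e'\<close> is a section of \<open>e\<close>, so \<open>e\<close> is a
  split epimorphism.\<close>

lemma right_cancel:
  assumes "f \<in> Arr C" "g \<in> Arr C" "e \<in> Arr C" "e' \<in> Arr C"
    and "Dom C f = Cod C e" "Dom C g = Cod C e" "Cod C e' = Dom C e"
    and "e \<bullet> e' = Ident C (Cod C e)" "f \<bullet> e = g \<bullet> e"
  shows "f = g"
proof -
  have "f = f \<bullet> e \<bullet> e'" using assms by (metis Comp_Ident_arr)
  also have "\<dots> = (f \<bullet> e) \<bullet> e'" using assms by (metis Comp_assoc_arr)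
  also have "\<dots> = g \<bullet> e \<bullet> e'" using assms by (metis Comp_assoc_arr)
  also have "\<dots> = g" using assms by (metis Comp_Ident_arr)
  finally show ?thesis .
qed

end

context symmetric_monoidal
begin

lemma TenA_arr:
  assumes "f \<in> Arr C" "g \<in> Arr C"
  shows "f \<boxtimes> g \<in> Arr C" "Dom C (f \<boxtimes> g) = Dom C f \<boxtimes>\<^sub>o Dom C g"
    "Cod C (f \<boxtimes> g) = Cod C f \<boxtimes>\<^sub>o Cod C g"
  using TenA_Hom[of f "Dom C f" "Cod C f" g "Dom C g" "Cod C g"] assms by (auto simp: Hom_def)

lemma is_iso_Hom: "is_iso C X Y f \<Longrightarrow> f \<in> Hom C X Y"
  by (auto simp: is_iso_def inverse_arrows_def)

lemma Assoc_arr: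
  assumes "X \<in> Obj C" "Y \<in> Obj C" "Z \<in> Obj C"
  shows "Assoc C X Y Z \<in> Arr C" "Dom C (Assoc C X Y Z) = (X \<boxtimes>\<^sub>o Y) \<boxtimes>\<^sub>o Z"
    "Cod C (Assoc C X Y Z) = X \<boxtimes>\<^sub>o (Y \<boxtimes>\<^sub>o Z)"
  using is_iso_Hom[OF Assoc_iso[OF assms]] by (auto simp: Hom_def)

lemma LUnit_arr:
  assumes "X \<in> Obj C"
  shows "LUnit C X \<in> Arr C" "Dom C (LUnit C X) = Unit C \<boxtimes>\<^sub>o X" "Cod C (LUnit C X) = X"
  using is_iso_Hom[OF LUnit_iso[OF assms]] by (auto simp: Hom_def)

lemma RUnit_arr:
  assumes "X \<in> Obj C"
  shows "RUnit C X \<in> Arr C" "Dom C (RUnit C X) = X \<boxtimes>\<^sub>o Unit C" "Cod C (RUnit C X) = X"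
  using is_iso_Hom[OF RUnit_iso[OF assms]] by (auto simp: Hom_def)

lemma Braid_arr:
  assumes "X \<in> Obj C" "Y \<in> Obj C"
  shows "Braid C X Y \<in> Arr C" "Dom C (Braid C X Y) = X \<boxtimes>\<^sub>o Y" "Cod C (Braid C X Y) = Y \<boxtimes>\<^sub>o X"
  using Braid_Hom[OF assms] by (auto simp: Hom_def)

lemmas arr = Comp_arr Ident_arr TenA_arr Assoc_arr LUnit_arr RUnit_arr Braid_arr Dom_Obj Cod_Obj
  Ten_Obj Unit_Obj

lemma interchange:
  assumes "f \<in> Arr C" "f' \<in> Arr C" "g \<in> Arr C" "g' \<in> Arr C"
    and "Cod C f = Dom C f'" "Cod C g = Dom C g'"
  shows "(f' \<boxtimes> g') \<bullet> (f \<boxtimes> g) = (f' \<bullet> f) \<boxtimes> (g' \<bullet> g)"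
  using TenA_Comp[of f "Dom C f" "Cod C f" f' "Cod C f'" g "Dom C g" "Cod C g" g' "Cod C g'"] assms
  by (auto simp: Hom_def)

lemma interchange_assoc:
  assumes "f \<in> Arr C" "f' \<in> Arr C" "g \<in> Arr C" "g' \<in> Arr C" "h \<in> Arr C"
    and "Cod C f = Dom C f'" "Cod C g = Dom C g'" "Cod C h = Dom C f \<boxtimes>\<^sub>o Dom C g"
  shows "(f' \<boxtimes> g') \<bullet> (f \<boxtimes> g) \<bullet> h = ((f' \<bullet> f) \<boxtimes> (g' \<bullet> g)) \<bullet> h"
proof -
  have "(f' \<boxtimes> g') \<bullet> (f \<boxtimes> g) \<bullet> h = ((f' \<boxtimes> g') \<bullet> (f \<boxtimes> g)) \<bullet> h"
    using assms by (simp add: Comp_assoc_arr arr)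
  then show ?thesis using assms by (simp add: interchange)
qed

lemma Assoc_nat:
  assumes "f \<in> Arr C" "g \<in> Arr C" "h \<in> Arr C" "X = Cod C f" "Y = Cod C g" "Z = Cod C h"
  shows "Assoc C X Y Z \<bullet> ((f \<boxtimes> g) \<boxtimes> h) = (f \<boxtimes> (g \<boxtimes> h)) \<bullet> Assoc C (Dom C f) (Dom C g) (Dom C h)"
  using Assoc_natural[of f "Dom C f" X g "Dom C g" Y h "Dom C h" Z] assms by (auto simp: Hom_def)

lemma Assoc_nat_assoc:
  assumes "f \<in> Arr C" "g \<in> Arr C" "h \<in> Arr C" "X = Cod C f" "Y = Cod C g" "Z = Cod C h"
    "k \<in> Arr C" "Cod C k = (Dom C f \<boxtimes>\<^sub>o Dom C g) \<boxtimes>\<^sub>o Dom C h"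
  shows "Assoc C X Y Z \<bullet> ((f \<boxtimes> g) \<boxtimes> h) \<bullet> k
     = (f \<boxtimes> (g \<boxtimes> h)) \<bullet> Assoc C (Dom C f) (Dom C g) (Dom C h) \<bullet> k"
proof -
  have "Assoc C X Y Z \<bullet> ((f \<boxtimes> g) \<boxtimes> h) \<bullet> k = (Assoc C X Y Z \<bullet> ((f \<boxtimes> g) \<boxtimes> h)) \<bullet> k"
    using assms by (simp add: Comp_assoc_arr arr)
  also have "\<dots> = (f \<boxtimes> (g \<boxtimes> h)) \<bullet> Assoc C (Dom C f) (Dom C g) (Dom C h) \<bullet> k"
    using assms by (simp only: Assoc_nat) (simp add: Comp_assoc_arr arr)
  finally show ?thesis .
qed

lemma Braid_nat:
  assumes "f \<in> Arr C" "g \<in> Arr C" "X = Cod C f" "Y = Cod C g"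
  shows "Braid C X Y \<bullet> (f \<boxtimes> g) = (g \<boxtimes> f) \<bullet> Braid C (Dom C f) (Dom C g)"
  using Braid_natural[of f "Dom C f" X g "Dom C g" Y] assms by (auto simp: Hom_def)

lemma RUnit_nat:
  assumes "f \<in> Arr C" "X = Cod C f"
  shows "RUnit C X \<bullet> (f \<boxtimes> Ident C (Unit C)) = f \<bullet> RUnit C (Dom C f)"
  using RUnit_natural[of f "Dom C f" X] assms by (auto simp: Hom_def)

lemma iso_inverse:
  assumes "is_iso C X Y f"
  obtains g where "g \<in> Arr C" "Dom C g = Y" "Cod C g = X" "g \<bullet> f = Ident C X" "f \<bullet> g = Ident C Y"
  using assms by (auto simp: is_iso_def inverse_arrows_def Hom_def)

text \<open>The right unit constraint is a natural isomorphism from tensoring with the unit to the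
  identity, so tensoring with the unit loses nothing. Coherence identities may be tested after
  it.\<close>

lemma tensor_unit_faithful:
  assumes "f \<in> Hom C X Y" "g \<in> Hom C X Y" "f \<boxtimes> Ident C (Unit C) = g \<boxtimes> Ident C (Unit C)"
  shows "f = g"
proof -
  have X: "X \<in> Obj C" using assms Hom_Obj by blast
  obtain r where r: "r \<in> Arr C" "Dom C r = X" "Cod C r = X \<boxtimes>\<^sub>o Unit C"
    "RUnit C X \<bullet> r = Ident C X"
    using RUnit_iso[OF X] by (rule iso_inverse)
  have "f \<bullet> RUnit C X = g \<bullet> RUnit C X"
    using RUnit_natural[OF assms(1)] RUnit_natural[OF assms(2)] assms(3) by simp
  then show ?thesis
    using right_cancel[of f g "RUnit C X" r] r X assms by (simp add: Hom_def arr)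
qed

text \<open>One of Kelly's derived unit laws. After tensoring with the unit, the triangle axiom for
  \<open>Y\<close> and for \<open>X \<boxtimes>\<^sub>o Y\<close> expresses both sides through
  \<open>LUnit C (Unit C)\<close>, the pentagon identifies them, and the associator in front is
  cancelled by its inverse \<open>b\<close>.\<close>

lemma RUnit_tensor:
  assumes "X \<in> Obj C" "Y \<in> Obj C"
  shows "(Ident C X \<boxtimes> RUnit C Y) \<bullet> Assoc C X Y (Unit C) = RUnit C (X \<boxtimes>\<^sub>o Y)"
proof (rule tensor_unit_faithful)
  let ?I = "Unit C" and ?i = "Ident C (Unit C)" and ?a = "Assoc C"
  let ?f = "(Ident C X \<boxtimes> RUnit C Y) \<bullet> ?a X Y ?I"
  note [simp] = arr assms Comp_assoc_arr Comp_Ident_arr Ident_Comp_arr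
  show "?f \<in> Hom C ((X \<boxtimes>\<^sub>o Y) \<boxtimes>\<^sub>o ?I) (X \<boxtimes>\<^sub>o Y)" "RUnit C (X \<boxtimes>\<^sub>o Y) \<in> Hom C ((X \<boxtimes>\<^sub>o Y) \<boxtimes>\<^sub>o ?I) (X \<boxtimes>\<^sub>o Y)"
    by (auto intro!: HomI)
  obtain b where b: "b \<in> Arr C" "Dom C b = X \<boxtimes>\<^sub>o (Y \<boxtimes>\<^sub>o ?I)" "Cod C b = (X \<boxtimes>\<^sub>o Y) \<boxtimes>\<^sub>o ?I"
    "b \<bullet> ?a X Y ?I = Ident C ((X \<boxtimes>\<^sub>o Y) \<boxtimes>\<^sub>o ?I)"
    using Assoc_iso[of X Y ?I] by (rule iso_inverse) auto
  have "?a X Y ?I \<bullet> (?f \<boxtimes> ?i) = ?a X Y ?I \<bullet> ((Ident C X \<boxtimes> RUnit C Y) \<boxtimes> ?i) \<bullet> (?a X Y ?I \<boxtimes> ?i)"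
    by (simp add: interchange)
  also have "\<dots> = (Ident C X \<boxtimes> (RUnit C Y \<boxtimes> ?i)) \<bullet> ?a X (Y \<boxtimes>\<^sub>o ?I) ?I \<bullet> (?a X Y ?I \<boxtimes> ?i)"
    by (simp add: Assoc_nat_assoc)
  also have "\<dots> = (Ident C X \<boxtimes> ((Ident C Y \<boxtimes> LUnit C ?I) \<bullet> ?a Y ?I ?I)) \<bullet> ?a X (Y \<boxtimes>\<^sub>o ?I) ?I \<bullet> (?a X Y ?I \<boxtimes> ?i)"
    by (simp add: triangle)
  also have "\<dots> = (Ident C X \<boxtimes> (Ident C Y \<boxtimes> LUnit C ?I)) \<bullet> (Ident C X \<boxtimes> ?a Y ?I ?I) \<bullet> ?a X (Y \<boxtimes>\<^sub>o ?I) ?I \<bullet> (?a X Y ?I \<boxtimes> ?i)"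
    by (simp add: interchange_assoc)
  also have "\<dots> = (Ident C X \<boxtimes> (Ident C Y \<boxtimes> LUnit C ?I)) \<bullet> ?a X Y (?I \<boxtimes>\<^sub>o ?I) \<bullet> ?a (X \<boxtimes>\<^sub>o Y) ?I ?I"
    by (simp add: pentagon)
  also have "\<dots> = ?a X Y ?I \<bullet> ((Ident C X \<boxtimes> Ident C Y) \<boxtimes> LUnit C ?I) \<bullet> ?a (X \<boxtimes>\<^sub>o Y) ?I ?I"
    by (simp add: Assoc_nat_assoc)
  also have "\<dots> = ?a X Y ?I \<bullet> (RUnit C (X \<boxtimes>\<^sub>o Y) \<boxtimes> ?i)"
    by (simp add: TenA_Ident triangle)
  finally have *: "?a X Y ?I \<bullet> (?f \<boxtimes> ?i) = ?a X Y ?I \<bullet> (RUnit C (X \<boxtimes>\<^sub>o Y) \<boxtimes> ?i)" .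
  have "?f \<boxtimes> ?i = b \<bullet> ?a X Y ?I \<bullet> (?f \<boxtimes> ?i)"
    using b by (simp flip: Comp_assoc_arr)
  also have "\<dots> = RUnit C (X \<boxtimes>\<^sub>o Y) \<boxtimes> ?i"
    unfolding * using b by (simp flip: Comp_assoc_arr)
  finally show "?f \<boxtimes> ?i = RUnit C (X \<boxtimes>\<^sub>o Y) \<boxtimes> ?i" .
qed

end

section \<open>Compact objects\<close>

lemma diagram_Hom:
  assumes "is_diagram C D" "u \<in> Hom (Idx D) i j"
  shows "i \<in> Obj (Idx D)" "j \<in> Obj (Idx D)" "DArr D u \<in> Hom C (DObj D i) (DObj D j)"
proof -
  interpret I: category "Idx D" using assms by (simp add: is_diagram_def)
  show "i \<in> Obj (Idx D)" "j \<in> Obj (Idx D)" using I.Hom_Obj[OF assms(2)] by auto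
  then show "DArr D u \<in> Hom C (DObj D i) (DObj D j)"
    using assms unfolding is_diagram_def is_functor_def by blast
qed

lemma diagram_Comp:
  assumes "is_diagram C D" "u \<in> Hom (Idx D) i j" "v \<in> Hom (Idx D) j k"
  shows "v \<bullet>\<^bsub>Idx D\<^esub> u \<in> Hom (Idx D) i k" "DArr D (v \<bullet>\<^bsub>Idx D\<^esub> u) = DArr D v \<bullet>\<^bsub>C\<^esub> DArr D u"
proof -
  interpret I: category "Idx D" using assms by (simp add: is_diagram_def)
  show "v \<bullet>\<^bsub>Idx D\<^esub> u \<in> Hom (Idx D) i k" using assms(2,3) by (rule I.Comp_Hom)
  show "DArr D (v \<bullet>\<^bsub>Idx D\<^esub> u) = DArr D v \<bullet>\<^bsub>C\<^esub> DArr D u"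
    using assms I.Hom_Obj[OF assms(2)] I.Hom_Obj[OF assms(3)]
    unfolding is_diagram_def is_functor_def by blast
qed

lemma diagram_Ident:
  assumes "is_diagram C D" "i \<in> Obj (Idx D)"
  shows "Ident (Idx D) i \<in> Hom (Idx D) i i" "DArr D (Ident (Idx D) i) = Ident C (DObj D i)"
    "DObj D i \<in> Obj C"
  using assms category.Ident_Hom[of "Idx D" i] by (auto simp: is_diagram_def is_functor_def)

lemma filtered_join:
  assumes "filtered J" "i \<in> Obj J" "j \<in> Obj J"
  obtains k u v where "k \<in> Obj J" "u \<in> Hom J i k" "v \<in> Hom J j k"
  using assms unfolding filtered_def by blast

lemma filtered_coeq:
  assumes "filtered J" "i \<in> Obj J" "j \<in> Obj J" "u \<in> Hom J i j" "v \<in> Hom J i j"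
  obtains k w where "k \<in> Obj J" "w \<in> Hom J j k" "w \<bullet>\<^bsub>J\<^esub> u = w \<bullet>\<^bsub>J\<^esub> v"
  using assms unfolding filtered_def by blast

lemma hom_relD:
  assumes "((j, f), (j', f')) \<in> hom_rel C X D"
  obtains k u v where "j \<in> Obj (Idx D)" "f \<in> Hom C X (DObj D j)"
    "j' \<in> Obj (Idx D)" "f' \<in> Hom C X (DObj D j')"
    "k \<in> Obj (Idx D)" "u \<in> Hom (Idx D) j k" "v \<in> Hom (Idx D) j' k"
    "DArr D u \<bullet>\<^bsub>C\<^esub> f = DArr D v \<bullet>\<^bsub>C\<^esub> f'"
  using assms unfolding hom_rel_def hom_elements_def by auto

lemma hom_relI:
  assumes "is_diagram C D" "f \<in> Hom C X (DObj D j)" "f' \<in> Hom C X (DObj D j')"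
    "u \<in> Hom (Idx D) j k" "v \<in> Hom (Idx D) j' k" "DArr D u \<bullet>\<^bsub>C\<^esub> f = DArr D v \<bullet>\<^bsub>C\<^esub> f'"
  shows "((j, f), (j', f')) \<in> hom_rel C X D"
  using assms diagram_Hom[OF assms(1,4)] diagram_Hom[OF assms(1,5)]
  unfolding hom_rel_def hom_elements_def by auto

context category
begin

text \<open>Transitivity is where filteredness enters: the two witnesses meet at a common index
  \<open>k1\<close>, and the two routes to it from the middle index \<open>j'\<close> are made equal
  by one further arrow \<open>w\<close>.\<close>

lemma hom_rel_equiv:
  assumes D: "is_diagram C D" and fil: "filtered (Idx D)"
  shows "equiv (hom_elements C X D) (hom_rel C X D)"
proof (rule equivI)
  show "hom_rel C X D \<subseteq> hom_elements C X D \<times> hom_elements C X D"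
    by (auto simp: hom_rel_def)
  show "refl_on (hom_elements C X D) (hom_rel C X D)"
  proof (rule refl_onI)
    fix p assume "p \<in> hom_elements C X D"
    then obtain j f where p: "p = (j, f)" "j \<in> Obj (Idx D)" "f \<in> Hom C X (DObj D j)"
      by (auto simp: hom_elements_def)
    show "(p, p) \<in> hom_rel C X D" unfolding p(1)
      using diagram_Ident[OF D p(2)] by (intro hom_relI[OF D p(3) p(3)]) auto
  qed
  show "sym (hom_rel C X D)"
  proof (rule symI)
    fix p p' assume "(p, p') \<in> hom_rel C X D"
    moreover obtain j f j' f' where p: "p = (j, f)" "p' = (j', f')"
      by (metis prod.exhaust)
    ultimately have "((j, f), (j', f')) \<in> hom_rel C X D" by simp
    then show "(p', p) \<in> hom_rel C X D" unfolding p
      by (rule hom_relD) (rule hom_relI[OF D], assumption+, simp)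
  qed
  show "trans (hom_rel C X D)"
  proof (rule transI)
    fix p p' p'' assume "(p, p') \<in> hom_rel C X D" "(p', p'') \<in> hom_rel C X D"
    moreover obtain j f j' f' j'' f'' where p: "p = (j, f)" "p' = (j', f')" "p'' = (j'', f'')"
      by (metis prod.exhaust)
    ultimately have r: "((j, f), (j', f')) \<in> hom_rel C X D" "((j', f'), (j'', f'')) \<in> hom_rel C X D"
      by auto
    from r(1) obtain k u v where 1: "j \<in> Obj (Idx D)" "f \<in> Hom C X (DObj D j)"
      "j' \<in> Obj (Idx D)" "f' \<in> Hom C X (DObj D j')"
      "k \<in> Obj (Idx D)" "u \<in> Hom (Idx D) j k" "v \<in> Hom (Idx D) j' k" "DArr D u \<bullet> f = DArr D v \<bullet> f'"
      by (rule hom_relD)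
    from r(2) obtain k' u' v' where "j' \<in> Obj (Idx D)" "f' \<in> Hom C X (DObj D j')"
      and 2: "j'' \<in> Obj (Idx D)" "f'' \<in> Hom C X (DObj D j'')"
      "k' \<in> Obj (Idx D)" "u' \<in> Hom (Idx D) j' k'" "v' \<in> Hom (Idx D) j'' k'"
      "DArr D u' \<bullet> f' = DArr D v' \<bullet> f''"
      by (rule hom_relD)
    obtain k1 a b where 3: "k1 \<in> Obj (Idx D)" "a \<in> Hom (Idx D) k k1" "b \<in> Hom (Idx D) k' k1"
      using filtered_join[OF fil 1(5) 2(3)] .
    note av = diagram_Comp[OF D 1(7) 3(2)] and bu = diagram_Comp[OF D 2(4) 3(3)]
      and au = diagram_Comp[OF D 1(6) 3(2)] and bv = diagram_Comp[OF D 2(5) 3(3)]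
    obtain m w where w: "m \<in> Obj (Idx D)" "w \<in> Hom (Idx D) k1 m"
      "w \<bullet>\<^bsub>Idx D\<^esub> a \<bullet>\<^bsub>Idx D\<^esub> v = w \<bullet>\<^bsub>Idx D\<^esub> b \<bullet>\<^bsub>Idx D\<^esub> u'"
      by (rule filtered_coeq[OF fil 1(3) 3(1) av(1) bu(1)])
    note c = diagram_Comp[OF D _ w(2)]
    note dh = diagram_Hom(3)[OF D 1(6)] diagram_Hom(3)[OF D 1(7)] diagram_Hom(3)[OF D 2(4)]
      diagram_Hom(3)[OF D 2(5)] diagram_Hom(3)[OF D 3(2)] diagram_Hom(3)[OF D 3(3)]
      diagram_Hom(3)[OF D w(2)] 1(2,4) 2(2)
    note [simp] = HomD[OF dh(1)] HomD[OF dh(2)] HomD[OF dh(3)] HomD[OF dh(4)] HomD[OF dh(5)]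
      HomD[OF dh(6)] HomD[OF dh(7)] HomD[OF dh(8)] HomD[OF dh(9)] HomD[OF dh(10)]
    have wv: "DArr D w \<bullet> DArr D a \<bullet> DArr D v = DArr D w \<bullet> DArr D b \<bullet> DArr D u'"
      using c(2)[OF av(1)] c(2)[OF bu(1)] w(3) av(2) bu(2) by simp
    have "DArr D (w \<bullet>\<^bsub>Idx D\<^esub> a \<bullet>\<^bsub>Idx D\<^esub> u) \<bullet> f = DArr D w \<bullet> DArr D a \<bullet> DArr D u \<bullet> f"
      using c(2)[OF au(1)] au(2) by (simp add: Comp_assoc_arr Comp_arr)
    also have "\<dots> = (DArr D w \<bullet> DArr D a \<bullet> DArr D v) \<bullet> f'"
      unfolding 1(8) by (simp add: Comp_assoc_arr Comp_arr)
    also have "\<dots> = DArr D w \<bullet> DArr D b \<bullet> DArr D u' \<bullet> f'"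
      unfolding wv by (simp add: Comp_assoc_arr Comp_arr)
    also have "\<dots> = DArr D (w \<bullet>\<^bsub>Idx D\<^esub> b \<bullet>\<^bsub>Idx D\<^esub> v') \<bullet> f''"
      unfolding 2(6) using c(2)[OF bv(1)] bv(2) by (simp add: Comp_assoc_arr Comp_arr)
    finally show "(p, p'') \<in> hom_rel C X D" unfolding p
      using c(1)[OF au(1)] c(1)[OF bv(1)] by (intro hom_relI[OF D 1(2) 2(2)]) auto
  qed
qed

lemma cocone_hom_rel:
  assumes D: "is_diagram C D" and coc: "is_cocone C D L lam"
    and r: "((j, f), (j', f')) \<in> hom_rel C X D"
  shows "lam j \<bullet> f = lam j' \<bullet> f'"
proof -
  obtain k u v where 1: "j \<in> Obj (Idx D)" "f \<in> Hom C X (DObj D j)"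
      "j' \<in> Obj (Idx D)" "f' \<in> Hom C X (DObj D j')"
      "k \<in> Obj (Idx D)" "u \<in> Hom (Idx D) j k" "v \<in> Hom (Idx D) j' k" "DArr D u \<bullet> f = DArr D v \<bullet> f'"
    using r by (rule hom_relD)
  have l: "lam j = lam k \<bullet> DArr D u" "lam j' = lam k \<bullet> DArr D v" "lam k \<in> Hom C (DObj D k) L"
    using coc 1 by (auto simp: is_cocone_def)
  have "lam j \<bullet> f = lam k \<bullet> DArr D u \<bullet> f"
    using Comp_assoc[OF 1(2) diagram_Hom(3)[OF D 1(6)] l(3)] l(1) by simp
  also have "\<dots> = lam j' \<bullet> f'"
    using Comp_assoc[OF 1(4) diagram_Hom(3)[OF D 1(7)] l(3)] l(2) 1(8) by simp
  finally show ?thesis .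
qed

text \<open>Surjectivity and injectivity of the canonical map, spelled out on representatives, so
  that compactness can be used without equivalence classes.\<close>

definition compact_at :: "'o \<Rightarrow> ('i, 'o, 'a) diagram \<Rightarrow> 'o \<Rightarrow> ('i \<Rightarrow> 'a) \<Rightarrow> bool" where
  "compact_at X D L lam \<longleftrightarrow>
    (\<forall>f\<in>Hom C X L. \<exists>j\<in>Obj (Idx D). \<exists>g\<in>Hom C X (DObj D j). lam j \<bullet> g = f) \<and>
    (\<forall>j\<in>Obj (Idx D). \<forall>j'\<in>Obj (Idx D). \<forall>f\<in>Hom C X (DObj D j). \<forall>f'\<in>Hom C X (DObj D j').
       lam j \<bullet> f = lam j' \<bullet> f' \<longrightarrow> ((j, f), (j', f')) \<in> hom_rel C X D)"

lemma bij_iff_compact_at: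
  assumes D: "is_diagram C D" and fil: "filtered (Idx D)" and coc: "is_cocone C D L lam"
  shows "bij_betw (\<lambda>c. the_elem ((\<lambda>(j, f). lam j \<bullet> f) ` c)) (hom_colim C X D) (Hom C X L)
    \<longleftrightarrow> compact_at X D L lam" (is "bij_betw ?F _ _ \<longleftrightarrow> _")
proof -
  let ?E = "hom_elements C X D" and ?R = "hom_rel C X D"
  note eqv = hom_rel_equiv[OF D fil, of X]
  \<comment> \<open>The value of \<open>the_elem\<close> is meaningful because a cocone is constant
    on each class, so the image of a class is a singleton.\<close>
  have val: "?F (?R `` {(j, f)}) = lam j \<bullet> f" if "(j, f) \<in> ?E" for j f
  proof -
    have self: "(j, f) \<in> ?R `` {(j, f)}" using equiv_class_self[OF eqv that] .
    have all: "(\<lambda>(j, f). lam j \<bullet> f) q = lam j \<bullet> f" if "q \<in> ?R `` {(j, f)}" for q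
      using cocone_hom_rel[OF D coc, of j f "fst q" "snd q" X] that by (simp add: case_prod_beta)
    have "(\<lambda>(j, f). lam j \<bullet> f) ` (?R `` {(j, f)}) = {lam j \<bullet> f}"
      by (rule trans[OF image_cong[OF refl all] image_constant[OF self]])
    then show ?thesis by simp
  qed
  have cls: "c \<in> hom_colim C X D \<longleftrightarrow> (\<exists>j f. (j, f) \<in> ?E \<and> c = ?R `` {(j, f)})" for c
    unfolding hom_colim_def quotient_def by auto
  have inE: "(j, f) \<in> ?E \<longleftrightarrow> j \<in> Obj (Idx D) \<and> f \<in> Hom C X (DObj D j)" for j f
    by (auto simp: hom_elements_def)
  have lamH: "lam j \<bullet> f \<in> Hom C X L" if "(j, f) \<in> ?E" for j f
    using that coc Comp_Hom unfolding inE is_cocone_def by blast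
  have inj: "inj_on ?F (hom_colim C X D) \<longleftrightarrow>
    (\<forall>j\<in>Obj (Idx D). \<forall>j'\<in>Obj (Idx D). \<forall>f\<in>Hom C X (DObj D j). \<forall>f'\<in>Hom C X (DObj D j').
       lam j \<bullet> f = lam j' \<bullet> f' \<longrightarrow> ((j, f), (j', f')) \<in> hom_rel C X D)" (is "_ \<longleftrightarrow> ?P")
  proof
    assume i: "inj_on ?F (hom_colim C X D)"
    show ?P
    proof (intro ballI impI)
      fix j j' f f' assume a: "j \<in> Obj (Idx D)" "j' \<in> Obj (Idx D)" "f \<in> Hom C X (DObj D j)"
        "f' \<in> Hom C X (DObj D j')" "lam j \<bullet> f = lam j' \<bullet> f'"
      then have e: "(j, f) \<in> ?E" "(j', f') \<in> ?E" by (auto simp: inE)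
      then have "?R `` {(j, f)} = ?R `` {(j', f')}"
        using i val[OF e(1)] val[OF e(2)] a(5) by (intro inj_onD[OF i]) (auto simp: cls)
      then show "((j, f), (j', f')) \<in> ?R"
        by (rule eq_equiv_class[OF _ eqv e(2)])
    qed
  next
    assume p: ?P
    show "inj_on ?F (hom_colim C X D)"
    proof (rule inj_onI)
      fix c c' assume c: "c \<in> hom_colim C X D" "c' \<in> hom_colim C X D" "?F c = ?F c'"
      then obtain j f j' f' where e: "(j, f) \<in> ?E" "c = ?R `` {(j, f)}"
        "(j', f') \<in> ?E" "c' = ?R `` {(j', f')}" unfolding cls by auto
      have "lam j \<bullet> f = lam j' \<bullet> f'" using c(3) val e by simp
      then have "((j, f), (j', f')) \<in> ?R" using p e by (auto simp: inE)
      then show "c = c'" using equiv_class_eq[OF eqv] e by simp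
    qed
  qed
  have "?F ` hom_colim C X D = Hom C X L \<longleftrightarrow>
    (\<forall>f\<in>Hom C X L. \<exists>j\<in>Obj (Idx D). \<exists>g\<in>Hom C X (DObj D j). lam j \<bullet> g = f)" (is "_ \<longleftrightarrow> ?Q")
  proof
    assume im: "?F ` hom_colim C X D = Hom C X L"
    show ?Q
    proof
      fix f assume "f \<in> Hom C X L"
      then have "f \<in> ?F ` hom_colim C X D" by (simp only: im)
      then obtain c where c: "f = ?F c" "c \<in> hom_colim C X D" by (rule imageE)
      then obtain j g where "(j, g) \<in> ?E" "c = ?R `` {(j, g)}" unfolding cls by auto
      then show "\<exists>j\<in>Obj (Idx D). \<exists>g\<in>Hom C X (DObj D j). lam j \<bullet> g = f"
        using val[of j g] c(1) inE by auto
    qed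
  next
    assume q: ?Q
    show "?F ` hom_colim C X D = Hom C X L"
    proof (intro equalityI subsetI)
      fix f assume "f \<in> ?F ` hom_colim C X D"
      then obtain c where c: "f = ?F c" "c \<in> hom_colim C X D" by (rule imageE)
      then obtain j g where "(j, g) \<in> ?E" "c = ?R `` {(j, g)}" unfolding cls by auto
      then show "f \<in> Hom C X L" using val[of j g] lamH[of j g] c(1) by simp
    next
      fix f assume "f \<in> Hom C X L"
      then obtain j g where "(j, g) \<in> ?E" "lam j \<bullet> g = f" using q inE by blast
      then have "f = ?F (?R `` {(j, g)})" and "?R `` {(j, g)} \<in> hom_colim C X D"
        using val[of j g] cls[of "?R `` {(j, g)}"] by auto
      then show "f \<in> ?F ` hom_colim C X D" by (rule image_eqI)
    qed
  qed
  then show ?thesis unfolding bij_betw_def compact_at_def inj by blast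
qed

lemma compact_object_iff:
  "compact_object (U :: 'u itself) C X \<longleftrightarrow> X \<in> Obj C \<and>
     (\<forall>(D :: ('u, 'o, 'a) diagram) L lam. small_filtered_diagram C D \<longrightarrow> is_colimit C D L lam \<longrightarrow>
        compact_at X D L lam)"
proof -
  have "bij_betw (\<lambda>c. the_elem ((\<lambda>(j, f). lam j \<bullet> f) ` c)) (hom_colim C X D) (Hom C X L)
      \<longleftrightarrow> compact_at X D L lam"
    if "small_filtered_diagram C D" "is_colimit C D L lam" for D :: "('u, 'o, 'a) diagram" and L lam
    using that by (intro bij_iff_compact_at) (auto simp: small_filtered_diagram_def is_colimit_def)
  then show ?thesis unfolding compact_object_def by simp
qed

text \<open>Test arrows out of \<open>Z\<close> are extended to \<open>W\<close> along
  \<open>r\<close>, treated there, and restricted back along \<open>s\<close>.\<close>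

lemma compact_retract:
  assumes W: "compact_object (U :: 'u itself) C W"
    and s: "s \<in> Hom C Z W" and r: "r \<in> Hom C W Z" and rs: "r \<bullet> s = Ident C Z"
  shows "compact_object U C Z"
  unfolding compact_object_iff
proof (intro conjI allI impI)
  show "Z \<in> Obj C" using s Hom_Obj by blast
  fix D :: "('u, 'o, 'a) diagram" and L lam
  assume sfd: "small_filtered_diagram C D" and col: "is_colimit C D L lam"
  have D: "is_diagram C D" using sfd by (simp add: small_filtered_diagram_def)
  have lam: "lam j \<in> Hom C (DObj D j) L" if "j \<in> Obj (Idx D)" for j
    using col that by (simp add: is_colimit_def is_cocone_def)
  have cW: "compact_at W D L lam" using W sfd col by (simp add: compact_object_iff)
  have frs: "(f \<bullet> r) \<bullet> s = f" if "f \<in> Hom C Z Y" for f Y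
    using Comp_assoc[OF s r that] rs Comp_Ident[OF that] by simp
  show "compact_at Z D L lam"
    unfolding compact_at_def
  proof (intro conjI ballI impI)
    fix f assume f: "f \<in> Hom C Z L"
    then obtain j g where g: "j \<in> Obj (Idx D)" "g \<in> Hom C W (DObj D j)" "lam j \<bullet> g = f \<bullet> r"
      using cW Comp_Hom[OF r f] unfolding compact_at_def by blast
    have "lam j \<bullet> g \<bullet> s = f"
      using Comp_assoc[OF s g(2) lam[OF g(1)]] g(3) frs[OF f] by simp
    then show "\<exists>j\<in>Obj (Idx D). \<exists>g\<in>Hom C Z (DObj D j). lam j \<bullet> g = f"
      using g Comp_Hom[OF s g(2)] by blast
  next
    fix j j' f f' assume a: "j \<in> Obj (Idx D)" "j' \<in> Obj (Idx D)"
      "f \<in> Hom C Z (DObj D j)" "f' \<in> Hom C Z (DObj D j')" "lam j \<bullet> f = lam j' \<bullet> f'"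
    have "lam j \<bullet> f \<bullet> r = lam j' \<bullet> f' \<bullet> r"
      using Comp_assoc[OF r a(3) lam[OF a(1)]] Comp_assoc[OF r a(4) lam[OF a(2)]] a(5) by simp
    then have "((j, f \<bullet> r), (j', f' \<bullet> r)) \<in> hom_rel C W D"
      using cW a Comp_Hom[OF r a(3)] Comp_Hom[OF r a(4)] unfolding compact_at_def by blast
    then obtain k u v where "k \<in> Obj (Idx D)" and k: "u \<in> Hom (Idx D) j k" "v \<in> Hom (Idx D) j' k"
      "DArr D u \<bullet> f \<bullet> r = DArr D v \<bullet> f' \<bullet> r" by (rule hom_relD)
    note du = diagram_Hom(3)[OF D k(1)] and dv = diagram_Hom(3)[OF D k(2)]
    have "DArr D u \<bullet> f = (DArr D u \<bullet> f \<bullet> r) \<bullet> s"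
      using frs[OF Comp_Hom[OF a(3) du]] Comp_assoc[OF r a(3) du] by simp
    also have "\<dots> = DArr D v \<bullet> f'"
      using frs[OF Comp_Hom[OF a(4) dv]] Comp_assoc[OF r a(4) dv] k(3) by simp
    finally show "((j, f), (j', f')) \<in> hom_rel C Z D"
      by (rule hom_relI[OF D a(3,4) k(1,2)])
  qed
qed

end

section \<open>Tensor products with dualizable objects\<close>

text \<open>Over a one-element type \<open>'u\<close> not even the point would be small. A small
  filtered diagram has an arrow and strictly fewer arrows than \<open>'u\<close> has elements, which
  excludes this.\<close>

lemma singleton_small:
  assumes "small_filtered_diagram C (D :: ('u, 'o, 'a) diagram)"
  shows "{x} \<prec> (UNIV :: 'u set)"
proof -
  have D: "is_diagram C D" "filtered (Idx D)" "Arr (Idx D) \<prec> (UNIV :: 'u set)"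
    using assms by (auto simp: small_filtered_diagram_def)
  then obtain i where "i \<in> Obj (Idx D)" by (auto simp: filtered_def)
  then obtain u where "u \<in> Arr (Idx D)" using diagram_Ident(1)[OF D(1)] by (auto simp: Hom_def)
  then have "{x} \<lesssim> Arr (Idx D)"
    unfolding lepoll_def by (intro exI[of _ "\<lambda>_. u"]) auto
  then show ?thesis using D(3) by (rule lesspoll_trans1)
qed

lemma point_cat_simps [simp]:
  "Obj point_cat = {undefined}" "Arr point_cat = {undefined}" "Hom point_cat undefined undefined = {undefined}"
  "Ident point_cat i = undefined" "Comp point_cat u v = undefined"
  by (auto simp: point_cat_def Hom_def)

lemma point_cat_category: "category point_cat"
  by unfold_locales (auto simp: point_cat_def Hom_def)

lemma const_obj_simps [simp]:
  "Idx (const_obj C X) = point_cat" "DObj (const_obj C X) i = X" "DArr (const_obj C X) u = Ident C X"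
  by (auto simp: const_obj_def)

context category
begin

lemma const_obj_small_filtered:
  assumes "small_filtered_diagram C' (D :: ('u, 'o2, 'a2) diagram)" "X \<in> Obj C"
  shows "small_filtered_diagram C (const_obj C X :: ('u, 'o, 'a) diagram)"
  using assms singleton_small[OF assms(1)] Ident_Hom[OF assms(2)] Comp_Ident[OF Ident_Hom[OF assms(2)]]
    point_cat_category
  by (auto simp: small_filtered_diagram_def is_diagram_def is_functor_def filtered_def)

lemma const_obj_colimit:
  assumes "X \<in> Obj C"
  shows "is_colimit C (const_obj C X) X (\<lambda>_. Ident C X)"
proof -
  have "\<exists>!h. h \<in> Hom C X M \<and> h \<bullet> Ident C X = k" if "k \<in> Hom C X M" for M k
    using that Comp_Ident by metis
  then show ?thesis
    using assms Ident_Hom[OF assms] Comp_Ident[OF Ident_Hom[OF assms]]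
    by (auto simp: is_colimit_def is_cocone_def)
qed

end

text \<open>
  Tensoring with the constant diagram over the point replaces the two-variable hypothesis on
  colimits by the statement that tensoring with a fixed object preserves them.
\<close>

lemma (in symmetric_monoidal) tensor_colimit:
  fixes D :: "('u, 'o, 'a) diagram"
  assumes tp: "tensor_preserves_filtered_colimits (U :: 'u itself) C"
    and sfd: "small_filtered_diagram C D" and col: "is_colimit C D L lam" and Z: "Z \<in> Obj C"
  defines "DZ \<equiv> \<lparr> Idx = Idx D, DObj = (\<lambda>i. DObj D i \<boxtimes>\<^sub>o Z), DArr = (\<lambda>u. DArr D u \<boxtimes> Ident C Z) \<rparr>"
  shows "small_filtered_diagram C DZ" "is_colimit C DZ (L \<boxtimes>\<^sub>o Z) (\<lambda>i. lam i \<boxtimes> Ident C Z)"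
proof -
  have D: "is_diagram C D" using sfd by (simp add: small_filtered_diagram_def)
  interpret I: category "Idx D" using D by (simp add: is_diagram_def)
  have Zid: "Ident C Z \<in> Hom C Z Z" "Ident C Z \<bullet> Ident C Z = Ident C Z"
    using Ident_Hom[OF Z] Comp_Ident[OF Ident_Hom[OF Z]] by auto
  have lam: "lam i \<in> Hom C (DObj D i) L" if "i \<in> Obj (Idx D)" for i
    using col that by (simp add: is_colimit_def is_cocone_def)
  have L: "L \<in> Obj C" using col by (simp add: is_colimit_def is_cocone_def)
  have "is_functor (Idx D) C (\<lambda>i. DObj D i \<boxtimes>\<^sub>o Z) (\<lambda>u. DArr D u \<boxtimes> Ident C Z)"
    unfolding is_functor_def
  proof (intro conjI ballI)
    fix X assume X: "X \<in> Obj (Idx D)"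
    show "DObj D X \<boxtimes>\<^sub>o Z \<in> Obj C" using diagram_Ident(3)[OF D X] Z by (rule Ten_Obj)
    show "DArr D (Ident (Idx D) X) \<boxtimes> Ident C Z = Ident C (DObj D X \<boxtimes>\<^sub>o Z)"
      using diagram_Ident[OF D X] Z by (simp add: TenA_Ident)
  next
    fix X Y f assume "f \<in> Hom (Idx D) X Y"
    then show "DArr D f \<boxtimes> Ident C Z \<in> Hom C (DObj D X \<boxtimes>\<^sub>o Z) (DObj D Y \<boxtimes>\<^sub>o Z)"
      using diagram_Hom(3)[OF D] Zid(1) by (intro TenA_Hom)
  next
    fix X Y W f g assume f: "f \<in> Hom (Idx D) X Y" and g: "g \<in> Hom (Idx D) Y W"
    show "DArr D (g \<bullet>\<^bsub>Idx D\<^esub> f) \<boxtimes> Ident C Z = (DArr D g \<boxtimes> Ident C Z) \<bullet> (DArr D f \<boxtimes> Ident C Z)"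
      using diagram_Comp(2)[OF D f g] Zid
        TenA_Comp[OF diagram_Hom(3)[OF D f] diagram_Hom(3)[OF D g] Zid(1) Zid(1)] by simp
  qed
  then show "small_filtered_diagram C DZ"
    using sfd by (auto simp: small_filtered_diagram_def is_diagram_def DZ_def)
  let ?P = "const_obj C Z :: ('u, 'o, 'a) diagram"
  let ?T = "tensor_diagram C D ?P"
  have T: "is_colimit C ?T (L \<boxtimes>\<^sub>o Z) (\<lambda>(i, j). lam i \<boxtimes> Ident C Z)"
    using tp[unfolded tensor_preserves_filtered_colimits_def, rule_format,
        OF sfd const_obj_small_filtered[OF sfd Z] col const_obj_colimit[OF Z]] .
  have TI: "Obj (Idx ?T) = Obj (Idx D) \<times> {undefined}" "DObj ?T (i, j) = DObj D i \<boxtimes>\<^sub>o Z"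
    "DArr ?T (u, v) = DArr D u \<boxtimes> Ident C Z" for i j u v
    by (auto simp: tensor_diagram_def product_cat_def)
  have TH: "Hom (Idx ?T) (i, undefined) (j, undefined) = (\<lambda>u. (u, undefined)) ` Hom (Idx D) i j" for i j
    by (auto simp: tensor_diagram_def product_cat_def Hom_def point_cat_def)
  have cc: "is_cocone C ?T M (\<lambda>(i, j). kap i) \<longleftrightarrow> is_cocone C DZ M kap" for M kap
    unfolding is_cocone_def TI(1) by (simp add: TI TH DZ_def)
  show "is_colimit C DZ (L \<boxtimes>\<^sub>o Z) (\<lambda>i. lam i \<boxtimes> Ident C Z)"
    unfolding is_colimit_def
  proof (intro conjI allI impI)
    show "is_cocone C DZ (L \<boxtimes>\<^sub>o Z) (\<lambda>i. lam i \<boxtimes> Ident C Z)"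
      using T unfolding is_colimit_def cc by blast
    fix M kap assume "is_cocone C DZ M kap"
    then have "is_cocone C ?T M (\<lambda>(i, j). kap i)" by (simp only: cc)
    then have "\<exists>!h. h \<in> Hom C (L \<boxtimes>\<^sub>o Z) M \<and>
        (\<forall>p\<in>Obj (Idx ?T). h \<bullet> (case p of (i, j) \<Rightarrow> lam i \<boxtimes> Ident C Z) = (case p of (i, j) \<Rightarrow> kap i))"
      using T unfolding is_colimit_def by blast
    then show "\<exists>!h. h \<in> Hom C (L \<boxtimes>\<^sub>o Z) M \<and> (\<forall>i\<in>Obj (Idx DZ). h \<bullet> (lam i \<boxtimes> Ident C Z) = kap i)"
      unfolding TI(1) by (simp add: DZ_def)
  qed
qed

text \<open>
  One of the two triangle identities suffices: it makes the passage from arrows out of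
  \<open>Y \<otimes> X\<close> to arrows into \<open>- \<otimes> X'\<close> a split injection, natural in the target, and a
  retract of a bijection is a bijection.
\<close>

locale left_dual = symmetric_monoidal C
  for C :: "('o, 'a, 'x) smcat_scheme" (structure) +
  fixes X X' :: 'o and ev coev :: 'a
  assumes X: "X \<in> Obj C" and X': "X' \<in> Obj C"
    and ev: "ev \<in> Hom C (X' \<boxtimes>\<^sub>o X) (Unit C)" and coev: "coev \<in> Hom C (Unit C) (X \<boxtimes>\<^sub>o X')"
    and zigzag: "RUnit C X \<bullet> (Ident C X \<boxtimes> ev) \<bullet> Assoc C X X' X \<bullet> (coev \<boxtimes> Ident C X) = LUnit C X"
begin

text \<open>Transposition along \<open>ev\<close>: an arrow from \<open>Y\<close> to
  \<open>W \<boxtimes>\<^sub>o X'\<close> becomes one from \<open>Y \<boxtimes>\<^sub>o X\<close> to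
  \<open>W\<close>.\<close>

definition flat :: "'o \<Rightarrow> 'a \<Rightarrow> 'a" where
  "flat W g = RUnit C W \<bullet> (Ident C W \<boxtimes> ev) \<bullet> Assoc C W X' X \<bullet> (g \<boxtimes> Ident C X)"

lemma flat_Hom:
  assumes "g \<in> Hom C Y (W \<boxtimes>\<^sub>o X')" "W \<in> Obj C"
  shows "flat W g \<in> Hom C (Y \<boxtimes>\<^sub>o X) W"
  using HomD[OF assms(1)] HomD[OF ev] X X' assms(2)
  by (intro HomI) (simp_all add: flat_def arr)

lemma flat_comp:
  assumes g: "g \<in> Hom C Y (W \<boxtimes>\<^sub>o X')" and h: "h \<in> Hom C W W'"
  shows "flat W' ((h \<boxtimes> Ident C X') \<bullet> g) = h \<bullet> flat W g"
proof -
  note [simp] = HomD[OF g] HomD[OF h] HomD[OF ev] X X' Hom_Obj[OF h] arr Comp_assoc_arr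
    Comp_Ident_arr Ident_Comp_arr
  have "flat W' ((h \<boxtimes> Ident C X') \<bullet> g)
      = RUnit C W' \<bullet> (Ident C W' \<boxtimes> ev) \<bullet> Assoc C W' X' X \<bullet> ((h \<boxtimes> Ident C X') \<boxtimes> Ident C X) \<bullet> (g \<boxtimes> Ident C X)"
    by (simp add: flat_def interchange)
  also have "\<dots> = RUnit C W' \<bullet> (Ident C W' \<boxtimes> ev) \<bullet> (h \<boxtimes> Ident C (X' \<boxtimes>\<^sub>o X)) \<bullet> Assoc C W X' X \<bullet> (g \<boxtimes> Ident C X)"
    by (simp add: Assoc_nat_assoc TenA_Ident)
  also have "\<dots> = RUnit C W' \<bullet> (h \<boxtimes> Ident C (Unit C)) \<bullet> (Ident C W \<boxtimes> ev) \<bullet> Assoc C W X' X \<bullet> (g \<boxtimes> Ident C X)"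
    by (simp add: interchange_assoc)
  also have "\<dots> = (RUnit C W' \<bullet> (h \<boxtimes> Ident C (Unit C))) \<bullet> (Ident C W \<boxtimes> ev) \<bullet> Assoc C W X' X \<bullet> (g \<boxtimes> Ident C X)"
    by simp
  also have "\<dots> = h \<bullet> flat W g"
    by (simp add: RUnit_nat flat_def)
  finally show ?thesis .
qed

text \<open>The unit of the adjunction is \<open>coev\<close> tensored with \<open>Y\<close> and
  reassociated. \<open>RUnit_tensor\<close> and the pentagon move everything except the unit
  constraint of \<open>Y\<close> to the right of the factor \<open>Y\<close>, where the zigzag
  identity applies; the triangle then turns \<open>LUnit C X\<close> into \<open>RUnit C Y\<close>,
  which cancels \<open>r\<close>.\<close>

lemma unit_ex:
  assumes Y: "Y \<in> Obj C"
  obtains eta where "eta \<in> Hom C Y ((Y \<boxtimes>\<^sub>o X) \<boxtimes>\<^sub>o X')" "flat (Y \<boxtimes>\<^sub>o X) eta = Ident C (Y \<boxtimes>\<^sub>o X)"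
proof -
  obtain b where b: "b \<in> Arr C" "Dom C b = Y \<boxtimes>\<^sub>o (X \<boxtimes>\<^sub>o X')" "Cod C b = (Y \<boxtimes>\<^sub>o X) \<boxtimes>\<^sub>o X'"
    "Assoc C Y X X' \<bullet> b = Ident C (Y \<boxtimes>\<^sub>o (X \<boxtimes>\<^sub>o X'))"
    using Assoc_iso[OF Y X X'] by (rule iso_inverse) auto
  obtain r where r: "r \<in> Arr C" "Dom C r = Y" "Cod C r = Y \<boxtimes>\<^sub>o Unit C"
    "RUnit C Y \<bullet> r = Ident C Y"
    using RUnit_iso[OF Y] by (rule iso_inverse) auto
  note [simp] = HomD[OF ev] HomD[OF coev] X X' Y b(1-3) r(1-3) arr Comp_assoc_arr Comp_Ident_arr Ident_Comp_arr
  let ?eta = "b \<bullet> (Ident C Y \<boxtimes> coev) \<bullet> r" and ?i = "Ident C"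
  let ?YX = "Y \<boxtimes>\<^sub>o X"
  have "?eta \<in> Hom C Y (?YX \<boxtimes>\<^sub>o X')" by (intro HomI) simp_all
  moreover have "flat ?YX ?eta = ?i ?YX"
  proof -
    have "flat ?YX ?eta = ((?i Y \<boxtimes> RUnit C X) \<bullet> Assoc C Y X (Unit C)) \<bullet> ((?i Y \<boxtimes> ?i X) \<boxtimes> ev) \<bullet>
       Assoc C ?YX X' X \<bullet> (?eta \<boxtimes> ?i X)"
      by (simp add: flat_def RUnit_tensor TenA_Ident del: Comp_assoc_arr)
    also have "\<dots> = (?i Y \<boxtimes> RUnit C X) \<bullet> (?i Y \<boxtimes> (?i X \<boxtimes> ev)) \<bullet> Assoc C Y X (X' \<boxtimes>\<^sub>o X) \<bullet>
       Assoc C ?YX X' X \<bullet> (?eta \<boxtimes> ?i X)"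
      by (simp add: Assoc_nat_assoc)
    also have "\<dots> = (?i Y \<boxtimes> RUnit C X) \<bullet> (?i Y \<boxtimes> (?i X \<boxtimes> ev)) \<bullet> (Assoc C Y X (X' \<boxtimes>\<^sub>o X) \<bullet>
       Assoc C ?YX X' X) \<bullet> (?eta \<boxtimes> ?i X)"
      by simp
    also have "\<dots> = (?i Y \<boxtimes> RUnit C X) \<bullet> (?i Y \<boxtimes> (?i X \<boxtimes> ev)) \<bullet> ((?i Y \<boxtimes> Assoc C X X' X)
       \<bullet> Assoc C Y (X \<boxtimes>\<^sub>o X') X \<bullet> (Assoc C Y X X' \<boxtimes> ?i X)) \<bullet> (?eta \<boxtimes> ?i X)"
      by (subst pentagon) (simp_all del: Comp_assoc_arr)
    also have "\<dots> = (?i Y \<boxtimes> RUnit C X) \<bullet> (?i Y \<boxtimes> (?i X \<boxtimes> ev)) \<bullet> (?i Y \<boxtimes> Assoc C X X' X)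
       \<bullet> Assoc C Y (X \<boxtimes>\<^sub>o X') X \<bullet> ((Assoc C Y X X' \<bullet> b \<bullet> (?i Y \<boxtimes> coev) \<bullet> r) \<boxtimes> ?i X)"
      by (simp add: interchange)
    also have "Assoc C Y X X' \<bullet> b \<bullet> (?i Y \<boxtimes> coev) \<bullet> r = (Assoc C Y X X' \<bullet> b) \<bullet> (?i Y \<boxtimes> coev) \<bullet> r"
      by simp
    also have "\<dots> = (?i Y \<boxtimes> coev) \<bullet> r"
      unfolding b(4) by simp
    also have "((?i Y \<boxtimes> coev) \<bullet> r) \<boxtimes> ?i X = ((?i Y \<boxtimes> coev) \<boxtimes> ?i X) \<bullet> (r \<boxtimes> ?i X)"
      by (simp add: interchange)
    also have "Assoc C Y (X \<boxtimes>\<^sub>o X') X \<bullet> \<dots> = (?i Y \<boxtimes> (coev \<boxtimes> ?i X)) \<bullet> Assoc C Y (Unit C) X \<bullet> (r \<boxtimes> ?i X)"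
      by (simp add: Assoc_nat_assoc)
    also have "(?i Y \<boxtimes> RUnit C X) \<bullet> (?i Y \<boxtimes> (?i X \<boxtimes> ev)) \<bullet> (?i Y \<boxtimes> Assoc C X X' X) \<bullet> \<dots>
      = (?i Y \<boxtimes> (RUnit C X \<bullet> (?i X \<boxtimes> ev) \<bullet> Assoc C X X' X \<bullet> (coev \<boxtimes> ?i X))) \<bullet> Assoc C Y (Unit C) X \<bullet> (r \<boxtimes> ?i X)"
      by (simp add: interchange_assoc)
    also have "\<dots> = ((?i Y \<boxtimes> LUnit C X) \<bullet> Assoc C Y (Unit C) X) \<bullet> (r \<boxtimes> ?i X)"
      unfolding zigzag by simp
    also have "\<dots> = (RUnit C Y \<boxtimes> ?i X) \<bullet> (r \<boxtimes> ?i X)"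
      by (simp add: triangle del: Comp_assoc_arr)
    also have "\<dots> = ?i ?YX"
      by (simp add: interchange r(4) TenA_Ident)
    finally show ?thesis .
  qed
  ultimately show thesis by (rule that)
qed

lemma compact_tensor:
  assumes tp: "tensor_preserves_filtered_colimits (U :: 'u itself) C" and cY: "compact_object U C Y"
  shows "compact_object U C (Y \<boxtimes>\<^sub>o X)"
  unfolding compact_object_iff
proof (intro conjI allI impI)
  have Y: "Y \<in> Obj C" using cY by (simp add: compact_object_iff)
  show "Y \<boxtimes>\<^sub>o X \<in> Obj C" using Y X by (rule Ten_Obj)
  obtain eta where eta: "eta \<in> Hom C Y ((Y \<boxtimes>\<^sub>o X) \<boxtimes>\<^sub>o X')" "flat (Y \<boxtimes>\<^sub>o X) eta = Ident C (Y \<boxtimes>\<^sub>o X)"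
    using unit_ex[OF Y] .
  \<comment> \<open>The opposite transposition. \<open>flat_sharp\<close> is the splitting that
    makes the compactness condition for \<open>Y \<boxtimes>\<^sub>o X\<close> a retract of the one
    for \<open>Y\<close>.\<close>
  define sharp where "sharp f = (f \<boxtimes> Ident C X') \<bullet> eta" for f
  have sharp_Hom: "sharp f \<in> Hom C Y (W \<boxtimes>\<^sub>o X')" if "f \<in> Hom C (Y \<boxtimes>\<^sub>o X) W" for f W
    unfolding sharp_def using eta(1) TenA_Hom[OF that Ident_Hom[OF X']] by (rule Comp_Hom)
  have flat_sharp: "flat W (sharp f) = f" if "f \<in> Hom C (Y \<boxtimes>\<^sub>o X) W" for f W
    unfolding sharp_def using flat_comp[OF eta(1) that] eta(2) Comp_Ident[OF that] by simp
  have sharp_comp: "sharp (h \<bullet> f) = (h \<boxtimes> Ident C X') \<bullet> sharp f"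
    if "f \<in> Hom C (Y \<boxtimes>\<^sub>o X) W" "h \<in> Hom C W W'" for f h W W'
    using HomD[OF that(1)] HomD[OF that(2)] HomD[OF eta(1)] X'
    by (simp add: sharp_def interchange_assoc arr Ident_Comp_arr)
  fix D :: "('u, 'o, 'a) diagram" and L lam
  assume sfd: "small_filtered_diagram C D" and col: "is_colimit C D L lam"
  have D: "is_diagram C D" using sfd by (simp add: small_filtered_diagram_def)
  have lam: "lam j \<in> Hom C (DObj D j) L" if "j \<in> Obj (Idx D)" for j
    using col that by (simp add: is_colimit_def is_cocone_def)
  let ?DZ = "\<lparr> Idx = Idx D, DObj = (\<lambda>i. DObj D i \<boxtimes>\<^sub>o X'), DArr = (\<lambda>u. DArr D u \<boxtimes> Ident C X') \<rparr>"
  have cDZ: "compact_at Y ?DZ (L \<boxtimes>\<^sub>o X') (\<lambda>i. lam i \<boxtimes> Ident C X')"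
    using cY tensor_colimit[OF tp sfd col X'] by (simp add: compact_object_iff)
  show "compact_at (Y \<boxtimes>\<^sub>o X) D L lam"
    unfolding compact_at_def
  proof (intro conjI ballI impI)
    fix f assume f: "f \<in> Hom C (Y \<boxtimes>\<^sub>o X) L"
    obtain j g where g: "j \<in> Obj (Idx D)" "g \<in> Hom C Y (DObj D j \<boxtimes>\<^sub>o X')"
      "(lam j \<boxtimes> Ident C X') \<bullet> g = sharp f"
      using cDZ sharp_Hom[OF f] unfolding compact_at_def by auto
    have "lam j \<bullet> flat (DObj D j) g = f"
      using flat_comp[OF g(2) lam[OF g(1)]] flat_sharp[OF f] g(3) by simp
    then show "\<exists>j\<in>Obj (Idx D). \<exists>g\<in>Hom C (Y \<boxtimes>\<^sub>o X) (DObj D j). lam j \<bullet> g = f"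
      using g(1) flat_Hom[OF g(2) diagram_Ident(3)[OF D g(1)]] by blast
  next
    fix j j' f f' assume a: "j \<in> Obj (Idx D)" "j' \<in> Obj (Idx D)"
      "f \<in> Hom C (Y \<boxtimes>\<^sub>o X) (DObj D j)" "f' \<in> Hom C (Y \<boxtimes>\<^sub>o X) (DObj D j')" "lam j \<bullet> f = lam j' \<bullet> f'"
    have "(lam j \<boxtimes> Ident C X') \<bullet> sharp f = (lam j' \<boxtimes> Ident C X') \<bullet> sharp f'"
      using sharp_comp[OF a(3) lam[OF a(1)]] sharp_comp[OF a(4) lam[OF a(2)]] a(5) by simp
    then have "((j, sharp f), (j', sharp f')) \<in> hom_rel C Y ?DZ"
      using cDZ a(1,2) sharp_Hom[OF a(3)] sharp_Hom[OF a(4)] unfolding compact_at_def by auto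
    then obtain k u v where "k \<in> Obj (Idx D)" and k: "u \<in> Hom (Idx D) j k" "v \<in> Hom (Idx D) j' k"
      "(DArr D u \<boxtimes> Ident C X') \<bullet> sharp f = (DArr D v \<boxtimes> Ident C X') \<bullet> sharp f'"
      by (rule hom_relD) simp
    note du = diagram_Hom(3)[OF D k(1)] and dv = diagram_Hom(3)[OF D k(2)]
    have "DArr D u \<bullet> f = DArr D v \<bullet> f'"
      using flat_comp[OF sharp_Hom[OF a(3)] du] flat_comp[OF sharp_Hom[OF a(4)] dv] k(3)
        flat_sharp[OF a(3)] flat_sharp[OF a(4)] by simp
    then show "((j, f), (j', f')) \<in> hom_rel C (Y \<boxtimes>\<^sub>o X) D"
      by (rule hom_relI[OF D a(3,4) k(1,2)])
  qed
qed

end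

section \<open>Compact objects of an ind-completion\<close>

lemma functor_Hom:
  assumes "category C" "is_functor C D FO FA" "f \<in> Hom C X Y"
  shows "FA f \<in> Hom D (FO X) (FO Y)"
  using assms category.Hom_Obj[OF assms(1,3)] unfolding is_functor_def by blast

lemma functor_Comp:
  assumes "category C" "is_functor C D FO FA" "f \<in> Hom C X Y" "g \<in> Hom C Y Z"
  shows "FA (g \<bullet>\<^bsub>C\<^esub> f) = FA g \<bullet>\<^bsub>D\<^esub> FA f"
  using assms category.Hom_Obj[OF assms(1,3)] category.Hom_Obj[OF assms(1,4)]
  unfolding is_functor_def by blast

text \<open>A strong monoidal functor preserves duals. Evaluation and coevaluation are conjugated by
  \<open>eps\<close> and \<open>mu\<close>; naturality and the associativity and unit constraints of
  the functor move these structure maps across, until the image of the zigzag identity of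
  \<open>C0\<close> remains.\<close>

lemma (in symmetric_monoidal) dual_transport:
  assumes sC0: "symmetric_monoidal C0"
    and F: "symmetric_monoidal_functor C0 C FO FA"
    and P: "P \<in> Obj C0" and dual: "is_dual C0 P P'"
  obtains ev coev where "left_dual C (FO P) (FO P') ev coev"
proof -
  interpret C0: symmetric_monoidal C0 by fact
  have Ffun: "is_functor C0 C FO FA" using F by (simp add: symmetric_monoidal_functor_def)
  have FOb: "FO X \<in> Obj C" if "X \<in> Obj C0" for X
    using Ffun that by (simp add: is_functor_def)
  have FH: "FA f \<in> Arr C" "Dom C (FA f) = FO (Dom C0 f)" "Cod C (FA f) = FO (Cod C0 f)"
    if "f \<in> Arr C0" for f
    using functor_Hom[OF C0.category_axioms Ffun, of f "Dom C0 f" "Cod C0 f"] that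
    by (simp_all add: Hom_def)
  have FC: "FA (g \<bullet>\<^bsub>C0\<^esub> f) = FA g \<bullet> FA f"
    if "f \<in> Arr C0" "g \<in> Arr C0" "Cod C0 f = Dom C0 g" for f g
    using functor_Comp[OF C0.category_axioms Ffun, of f "Dom C0 f" "Cod C0 f" g "Cod C0 g"] that
    by (simp add: Hom_def)
  have FI: "FA (Ident C0 X) = Ident C (FO X)" if "X \<in> Obj C0" for X
    using Ffun that by (simp add: is_functor_def)
  obtain eps mu where eps: "is_iso C (Unit C) (FO (Unit C0)) eps"
    and mu: "\<And>X Y. X \<in> Obj C0 \<Longrightarrow> Y \<in> Obj C0 \<Longrightarrow>
        is_iso C (FO X \<boxtimes>\<^sub>o FO Y) (FO (X \<boxtimes>\<^sub>o\<^bsub>C0\<^esub> Y)) (mu X Y)"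
    and mu_nat: "\<And>X X' Y Y' f g. X \<in> Obj C0 \<Longrightarrow> X' \<in> Obj C0 \<Longrightarrow> Y \<in> Obj C0 \<Longrightarrow> Y' \<in> Obj C0 \<Longrightarrow>
        f \<in> Hom C0 X X' \<Longrightarrow> g \<in> Hom C0 Y Y' \<Longrightarrow>
        mu X' Y' \<bullet> (FA f \<boxtimes> FA g) = FA (f \<boxtimes>\<^bsub>C0\<^esub> g) \<bullet> mu X Y"
    and mu_assoc: "\<And>X Y Z. X \<in> Obj C0 \<Longrightarrow> Y \<in> Obj C0 \<Longrightarrow> Z \<in> Obj C0 \<Longrightarrow>
        FA (Assoc C0 X Y Z) \<bullet> mu (X \<boxtimes>\<^sub>o\<^bsub>C0\<^esub> Y) Z \<bullet> (mu X Y \<boxtimes> Ident C (FO Z))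
           = mu X (Y \<boxtimes>\<^sub>o\<^bsub>C0\<^esub> Z) \<bullet> (Ident C (FO X) \<boxtimes> mu Y Z) \<bullet> Assoc C (FO X) (FO Y) (FO Z)"
    and mu_l: "\<And>X. X \<in> Obj C0 \<Longrightarrow> FA (LUnit C0 X) \<bullet> mu (Unit C0) X \<bullet> (eps \<boxtimes> Ident C (FO X)) = LUnit C (FO X)"
    and mu_r: "\<And>X. X \<in> Obj C0 \<Longrightarrow> FA (RUnit C0 X) \<bullet> mu X (Unit C0) \<bullet> (Ident C (FO X) \<boxtimes> eps) = RUnit C (FO X)"
    using F unfolding symmetric_monoidal_functor_def by (elim conjE exE) blast
  obtain ev coev where P': "P' \<in> Obj C0" and ev: "ev \<in> Hom C0 (P' \<boxtimes>\<^sub>o\<^bsub>C0\<^esub> P) (Unit C0)"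
    and coev: "coev \<in> Hom C0 (Unit C0) (P \<boxtimes>\<^sub>o\<^bsub>C0\<^esub> P')"
    and zz: "RUnit C0 P \<bullet>\<^bsub>C0\<^esub> (Ident C0 P \<boxtimes>\<^bsub>C0\<^esub> ev) \<bullet>\<^bsub>C0\<^esub> Assoc C0 P P' P \<bullet>\<^bsub>C0\<^esub> (coev \<boxtimes>\<^bsub>C0\<^esub> Ident C0 P)
      = LUnit C0 P"
    using dual unfolding is_dual_def by blast
  obtain eps' where e': "eps' \<in> Arr C" "Dom C eps' = FO (Unit C0)" "Cod C eps' = Unit C"
    "eps' \<bullet> eps = Ident C (Unit C)" "eps \<bullet> eps' = Ident C (FO (Unit C0))"
    using eps by (rule iso_inverse)
  obtain nu where nu: "nu \<in> Arr C" "Dom C nu = FO (P \<boxtimes>\<^sub>o\<^bsub>C0\<^esub> P')" "Cod C nu = FO P \<boxtimes>\<^sub>o FO P'"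
    "mu P P' \<bullet> nu = Ident C (FO (P \<boxtimes>\<^sub>o\<^bsub>C0\<^esub> P'))"
    using mu[OF P P'] by (rule iso_inverse)
  have muH: "mu X Y \<in> Arr C" "Dom C (mu X Y) = FO X \<boxtimes>\<^sub>o FO Y" "Cod C (mu X Y) = FO (X \<boxtimes>\<^sub>o\<^bsub>C0\<^esub> Y)"
    if "X \<in> Obj C0" "Y \<in> Obj C0" for X Y
    using is_iso_Hom[OF mu[OF that]] by (auto simp: Hom_def)
  have epsH: "eps \<in> Arr C" "Dom C eps = Unit C" "Cod C eps = FO (Unit C0)"
    using is_iso_Hom[OF eps] by (auto simp: Hom_def)
  note [simp] = arr C0.arr P P' e'(1-3) nu(1-3) muH epsH FOb FH HomD[OF ev] HomD[OF coev]
    Comp_assoc_arr Comp_Ident_arr Ident_Comp_arr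
  let ?ev = "eps' \<bullet> FA ev \<bullet> mu P' P"
  let ?coev = "nu \<bullet> FA coev \<bullet> eps"
  let ?i = "Ident C (FO P)"
  have nat1: "mu P (Unit C0) \<bullet> (?i \<boxtimes> FA ev) = FA (Ident C0 P \<boxtimes>\<^bsub>C0\<^esub> ev) \<bullet> mu P (P' \<boxtimes>\<^sub>o\<^bsub>C0\<^esub> P)"
    using mu_nat[OF _ _ _ _ C0.Ident_Hom[OF P] ev] FI[OF P] by simp
  have nat2: "mu (P \<boxtimes>\<^sub>o\<^bsub>C0\<^esub> P') P \<bullet> (FA coev \<boxtimes> ?i) = FA (coev \<boxtimes>\<^bsub>C0\<^esub> Ident C0 P) \<bullet> mu (Unit C0) P"
    using mu_nat[OF _ _ _ _ coev C0.Ident_Hom[OF P]] FI[OF P] by simp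
  have "RUnit C (FO P) \<bullet> (?i \<boxtimes> ?ev) \<bullet> Assoc C (FO P) (FO P') (FO P) \<bullet> (?coev \<boxtimes> ?i)
    = FA (RUnit C0 P) \<bullet> mu P (Unit C0) \<bullet> (?i \<boxtimes> (eps \<bullet> eps' \<bullet> FA ev \<bullet> mu P' P))
      \<bullet> Assoc C (FO P) (FO P') (FO P) \<bullet> (?coev \<boxtimes> ?i)"
    by (simp add: interchange_assoc flip: mu_r[OF P])
  also have "eps \<bullet> eps' \<bullet> FA ev \<bullet> mu P' P = (eps \<bullet> eps') \<bullet> FA ev \<bullet> mu P' P"
    by simp
  also have "\<dots> = FA ev \<bullet> mu P' P" unfolding e'(5) by simp
  also have "FA (RUnit C0 P) \<bullet> mu P (Unit C0) \<bullet> (?i \<boxtimes> (FA ev \<bullet> mu P' P))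
      \<bullet> Assoc C (FO P) (FO P') (FO P) \<bullet> (?coev \<boxtimes> ?i)
    = FA (RUnit C0 P) \<bullet> (mu P (Unit C0) \<bullet> (?i \<boxtimes> FA ev)) \<bullet> (?i \<boxtimes> mu P' P)
      \<bullet> Assoc C (FO P) (FO P') (FO P) \<bullet> (?coev \<boxtimes> ?i)"
    by (simp add: interchange_assoc)
  also have "\<dots> = FA (RUnit C0 P) \<bullet> FA (Ident C0 P \<boxtimes>\<^bsub>C0\<^esub> ev) \<bullet> (mu P (P' \<boxtimes>\<^sub>o\<^bsub>C0\<^esub> P) \<bullet> (?i \<boxtimes> mu P' P)
      \<bullet> Assoc C (FO P) (FO P') (FO P)) \<bullet> (?coev \<boxtimes> ?i)"
    unfolding nat1 by simp
  also have "\<dots> = FA (RUnit C0 P) \<bullet> FA (Ident C0 P \<boxtimes>\<^bsub>C0\<^esub> ev) \<bullet> FA (Assoc C0 P P' P) \<bullet> mu (P \<boxtimes>\<^sub>o\<^bsub>C0\<^esub> P') P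
      \<bullet> ((mu P P' \<bullet> nu \<bullet> FA coev \<bullet> eps) \<boxtimes> ?i)"
    unfolding mu_assoc[OF P P' P, symmetric] by (simp add: interchange)
  also have "mu P P' \<bullet> nu \<bullet> FA coev \<bullet> eps = (mu P P' \<bullet> nu) \<bullet> FA coev \<bullet> eps"
    by simp
  also have "\<dots> = FA coev \<bullet> eps" unfolding nu(4) by simp
  also have "mu (P \<boxtimes>\<^sub>o\<^bsub>C0\<^esub> P') P \<bullet> ((FA coev \<bullet> eps) \<boxtimes> ?i)
      = (mu (P \<boxtimes>\<^sub>o\<^bsub>C0\<^esub> P') P \<bullet> (FA coev \<boxtimes> ?i)) \<bullet> (eps \<boxtimes> ?i)"
    by (simp add: interchange)
  also have "\<dots> = FA (coev \<boxtimes>\<^bsub>C0\<^esub> Ident C0 P) \<bullet> mu (Unit C0) P \<bullet> (eps \<boxtimes> ?i)"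
    unfolding nat2 by simp
  also have "FA (RUnit C0 P) \<bullet> FA (Ident C0 P \<boxtimes>\<^bsub>C0\<^esub> ev) \<bullet> FA (Assoc C0 P P' P) \<bullet> \<dots>
      = FA (LUnit C0 P) \<bullet> mu (Unit C0) P \<bullet> (eps \<boxtimes> ?i)"
    by (simp add: FC flip: zz)
  also have "\<dots> = LUnit C (FO P)" using P by (rule mu_l)
  finally have zig: "RUnit C (FO P) \<bullet> (?i \<boxtimes> ?ev) \<bullet> Assoc C (FO P) (FO P') (FO P) \<bullet> (?coev \<boxtimes> ?i)
      = LUnit C (FO P)" .
  show thesis
    by (rule that[of ?ev ?coev], unfold_locales) (use zig in \<open>auto intro!: HomI\<close>)
qed

section \<open>Ind-objects as colimits of their terms\<close>

lemma Ind_simps: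
  "D \<in> Obj (Ind C) \<longleftrightarrow> small_filtered_diagram C D"
  "(D', \<phi>, E') \<in> Hom (Ind C) D E \<longleftrightarrow> D' = D \<and> E' = E \<and> small_filtered_diagram C D
     \<and> small_filtered_diagram C E \<and> \<phi> \<in> ind_hom C D E"
  "Comp (Ind C) (E', \<psi>, F) (D, \<phi>, E) = (D, \<lambda>i\<in>Obj (Idx D). \<Union>(j, f)\<in>\<phi> i. \<Union>(k, g)\<in>\<psi> j.
     hom_rel C (DObj D i) F `` {(k, g \<bullet>\<^bsub>C\<^esub> f)}, F)"
  by (auto simp: Ind_def Hom_def)

context category
begin

lemma hom_rel_precomp:
  assumes D: "is_diagram C D" and r: "((j, g), (j', g')) \<in> hom_rel C Y D" and f: "f \<in> Hom C X Y"
  shows "((j, g \<bullet> f), (j', g' \<bullet> f)) \<in> hom_rel C X D"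
proof -
  obtain k u v where k: "j \<in> Obj (Idx D)" "g \<in> Hom C Y (DObj D j)"
    "j' \<in> Obj (Idx D)" "g' \<in> Hom C Y (DObj D j')"
    "k \<in> Obj (Idx D)" "u \<in> Hom (Idx D) j k" "v \<in> Hom (Idx D) j' k"
    "DArr D u \<bullet> g = DArr D v \<bullet> g'" using r by (rule hom_relD)
  have "DArr D u \<bullet> g \<bullet> f = DArr D v \<bullet> g' \<bullet> f"
    using Comp_assoc[OF f k(2) diagram_Hom(3)[OF D k(6)]] Comp_assoc[OF f k(4) diagram_Hom(3)[OF D k(7)]]
      k(8) by simp
  then show ?thesis
    by (rule hom_relI[OF D Comp_Hom[OF f k(2)] Comp_Hom[OF f k(4)] k(6,7)])
qed

lemma hom_colim_class:
  assumes D: "is_diagram C D" and fil: "filtered (Idx D)" and c: "c \<in> hom_colim C X D"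
  shows "c \<noteq> {}" "(j, f) \<in> c \<Longrightarrow> j \<in> Obj (Idx D) \<and> f \<in> Hom C X (DObj D j)"
    "(j, f) \<in> c \<Longrightarrow> c = hom_rel C X D `` {(j, f)}"
    "(j, f) \<in> c \<Longrightarrow> ((j, f), (j', f')) \<in> hom_rel C X D \<Longrightarrow> (j', f') \<in> c"
    "(j, f) \<in> c \<Longrightarrow> (j', f') \<in> c \<Longrightarrow> ((j, f), (j', f')) \<in> hom_rel C X D"
proof -
  note eqv = hom_rel_equiv[OF D fil, of X]
  note c' = c[unfolded hom_colim_def]
  show "c \<noteq> {}" using in_quotient_imp_non_empty[OF eqv c'] .
  have sub: "c \<subseteq> hom_elements C X D" using in_quotient_imp_subset[OF eqv c'] .
  then show "(j, f) \<in> c \<Longrightarrow> j \<in> Obj (Idx D) \<and> f \<in> Hom C X (DObj D j)"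
    by (auto simp: hom_elements_def)
  show rel: "(j, f) \<in> c \<Longrightarrow> (j', f') \<in> c \<Longrightarrow> ((j, f), (j', f')) \<in> hom_rel C X D" for j' f'
    using in_quotient_imp_in_rel[OF eqv c'] by simp
  show clo: "(j, f) \<in> c \<Longrightarrow> ((j, f), (j', f')) \<in> hom_rel C X D \<Longrightarrow> (j', f') \<in> c" for j' f'
    using in_quotient_imp_closed[OF eqv c'] .
  show "(j, f) \<in> c \<Longrightarrow> c = hom_rel C X D `` {(j, f)}"
    using rel clo by auto
qed

lemma hom_rel_class:
  assumes D: "is_diagram C D" and fil: "filtered (Idx D)"
    and j: "j \<in> Obj (Idx D)" and f: "f \<in> Hom C X (DObj D j)"
  shows "hom_rel C X D `` {(j, f)} \<in> hom_colim C X D" "(j, f) \<in> hom_rel C X D `` {(j, f)}"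
  using quotientI[of "(j, f)" "hom_elements C X D" "hom_rel C X D"] j f
    equiv_class_self[OF hom_rel_equiv[OF D fil], of "(j, f)" X]
  by (auto simp: hom_colim_def hom_elements_def)

lemma hom_colim_const:
  assumes Y: "Y \<in> Obj C" and f: "f \<in> Hom C X Y"
  shows "{(undefined, f)} \<in> hom_colim C X (const_obj C Y)"
proof -
  have "hom_rel C X (const_obj C Y) `` {(undefined, f)} = {(undefined, f)}"
    using f Ident_Comp by (auto simp: hom_rel_def hom_elements_def)
  moreover have "(undefined, f) \<in> hom_elements C X (const_obj C Y)"
    using f by (simp add: hom_elements_def)
  ultimately show ?thesis
    unfolding hom_colim_def using quotientI by metis
qed

text \<open>Composition in \<open>Ind\<close> is written as a union of classes over all
  representatives; it collapses as soon as these classes coincide.\<close>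

lemma UN_class:
  assumes ne: "c \<noteq> {}" and all: "\<And>j f. (j, f) \<in> c \<Longrightarrow> F j f = d"
  shows "(\<Union>(j, f)\<in>c. F j f) = d"
  using assms by fastforce

text \<open>
  The canonical arrow from the \<open>i\<close>-th object of the diagram \<open>D\<close> to the ind-object \<open>D\<close>.
\<close>

definition iota :: "('u, 'o, 'a) diagram \<Rightarrow> 'u \<Rightarrow> ('u, 'o, 'a) ind_arr" where
  "iota D i = (const_obj C (DObj D i),
     \<lambda>_\<in>Obj point_cat. hom_rel C (DObj D i) D `` {(i, Ident C (DObj D i))}, D)"

context
  fixes D :: "('u, 'o, 'a) diagram"
  assumes sfd: "small_filtered_diagram C D"
begin

lemma small_diagram: "is_diagram C D" and small_filtered: "filtered (Idx D)"
  using sfd by (auto simp: small_filtered_diagram_def)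

lemma const_sfd: "X \<in> Obj C \<Longrightarrow> small_filtered_diagram C (const_obj C X :: ('u, 'o, 'a) diagram)"
  by (rule const_obj_small_filtered[OF sfd])

lemma Ident_class:
  assumes i: "i \<in> Obj (Idx D)"
  shows "hom_rel C (DObj D i) D `` {(i, Ident C (DObj D i))} \<in> hom_colim C (DObj D i) D"
    "(i, Ident C (DObj D i)) \<in> hom_rel C (DObj D i) D `` {(i, Ident C (DObj D i))}"
  using hom_rel_class[OF small_diagram small_filtered i Ident_Hom[OF diagram_Ident(3)[OF small_diagram i]]] .

lemma iota_Hom:
  assumes i: "i \<in> Obj (Idx D)"
  shows "iota D i \<in> Hom (Ind C) (const_obj C (DObj D i)) D"
proof -
  note c = Ident_class[OF i]
  have "(j, f \<bullet> Ident C (DObj D i)) \<in> hom_rel C (DObj D i) D `` {(i, Ident C (DObj D i))}"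
    if "(j, f) \<in> hom_rel C (DObj D i) D `` {(i, Ident C (DObj D i))}" for j f
    using that hom_colim_class(2)[OF small_diagram small_filtered c(1) that] Comp_Ident by metis
  then show ?thesis
    unfolding iota_def Ind_simps using const_sfd[OF diagram_Ident(3)[OF small_diagram i]] sfd c(1)
    by (auto simp: ind_hom_def)
qed

lemma const_arr_Hom:
  assumes f: "f \<in> Hom C X Y"
  shows "(const_arr C f :: ('u, 'o, 'a) ind_arr) \<in> Hom (Ind C) (const_obj C X) (const_obj C Y)"
  using hom_colim_const[OF Hom_Obj(2)[OF f] f] const_sfd[OF Hom_Obj(1)[OF f]] const_sfd[OF Hom_Obj(2)[OF f]]
    HomD[OF f] Comp_Ident[OF f]
  unfolding const_arr_def Ind_simps by (auto simp: ind_hom_def)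

lemma Comp_const_arr:
  assumes f: "f \<in> Hom C X Y" and k: "(const_obj C Y, \<phi>, E) \<in> Hom (Ind C) (const_obj C Y) E"
    and mem: "(j, g) \<in> \<phi> undefined"
  shows "(const_obj C Y, \<phi>, E) \<bullet>\<^bsub>Ind C\<^esub> (const_arr C f :: ('u, 'o, 'a) ind_arr)
    = (const_obj C X, \<lambda>_\<in>Obj point_cat. hom_rel C X E `` {(j, g \<bullet> f)}, E)"
proof -
  have E: "is_diagram C E" "filtered (Idx E)"
    using k by (auto simp: Ind_simps small_filtered_diagram_def)
  have c: "\<phi> undefined \<in> hom_colim C Y E" using k by (auto simp: Ind_simps ind_hom_def)
  have "(\<Union>(k, g)\<in>\<phi> undefined. hom_rel C X E `` {(k, g \<bullet> f)}) = hom_rel C X E `` {(j, g \<bullet> f)}"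
  proof (rule UN_class)
    show "\<phi> undefined \<noteq> {}" using mem by auto
    fix k' g' assume "(k', g') \<in> \<phi> undefined"
    then have "((k', g' \<bullet> f), (j, g \<bullet> f)) \<in> hom_rel C X E"
      using hom_rel_precomp[OF E(1) hom_colim_class(5)[OF E c _ mem] f] by blast
    then show "hom_rel C X E `` {(k', g' \<bullet> f)} = hom_rel C X E `` {(j, g \<bullet> f)}"
      by (rule equiv_class_eq[OF hom_rel_equiv[OF E]])
  qed
  then show ?thesis
    using HomD[OF f] unfolding const_arr_def Ind_simps by (auto simp: fun_eq_iff)
qed

text \<open>An arrow out of \<open>D\<close> is a family of classes, and \<open>iota D i\<close>
  picks its member at \<open>i\<close>. A representative of the identity class that lives at another
  index \<open>j\<close> is compared at an index \<open>m\<close> reached from both, where the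
  compatibility of the family applies.\<close>

lemma Comp_iota:
  assumes h: "(D, \<psi>, E) \<in> Hom (Ind C) D E" and i: "i \<in> Obj (Idx D)"
  shows "(D, \<psi>, E) \<bullet>\<^bsub>Ind C\<^esub> iota D i = (const_obj C (DObj D i), \<lambda>_\<in>Obj point_cat. \<psi> i, E)"
proof -
  have E: "is_diagram C E" "filtered (Idx E)"
    using h by (auto simp: Ind_simps small_filtered_diagram_def)
  have cls: "\<psi> j \<in> hom_colim C (DObj D j) E" if "j \<in> Obj (Idx D)" for j
    using h that by (auto simp: Ind_simps ind_hom_def)
  have comp: "(k, g \<bullet> DArr D u) \<in> \<psi> j" if "u \<in> Hom (Idx D) j j'" "(k, g) \<in> \<psi> j'" for j j' u k g
    using h that diagram_Hom(1,2)[OF small_diagram that(1)] by (fastforce simp: Ind_simps ind_hom_def)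
  let ?c = "hom_rel C (DObj D i) D `` {(i, Ident C (DObj D i))}"
  note c = Ident_class[OF i]
  have "(\<Union>(j, f)\<in>?c. \<Union>(k, g)\<in>\<psi> j. hom_rel C (DObj D i) E `` {(k, g \<bullet> f)}) = \<psi> i"
  proof (intro UN_class)
    show "?c \<noteq> {}" using c(2) by blast
    fix j f assume jf: "(j, f) \<in> ?c"
    then have j: "j \<in> Obj (Idx D)" and f: "f \<in> Hom C (DObj D i) (DObj D j)"
      using hom_colim_class(2)[OF small_diagram small_filtered c(1)] by blast+
    show "\<psi> j \<noteq> {}" using hom_colim_class(1)[OF E cls[OF j]] .
    fix k g assume kg: "(k, g) \<in> \<psi> j"
    have "((i, Ident C (DObj D i)), (j, f)) \<in> hom_rel C (DObj D i) D" using jf by blast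
    then obtain m u v where "m \<in> Obj (Idx D)" and u: "u \<in> Hom (Idx D) i m" and v: "v \<in> Hom (Idx D) j m"
      and uv: "DArr D u \<bullet> Ident C (DObj D i) = DArr D v \<bullet> f"
      by (rule hom_relD)
    note du = diagram_Hom(3)[OF small_diagram u] and dv = diagram_Hom(3)[OF small_diagram v]
    have uv': "DArr D v \<bullet> f = DArr D u" using uv Comp_Ident[OF du] by simp
    have m: "m \<in> Obj (Idx D)" by fact
    obtain k' g' where g': "(k', g') \<in> \<psi> m" using hom_colim_class(1)[OF E cls[OF m]] by fast
    have g'H: "g' \<in> Hom C (DObj D m) (DObj E k')" using hom_colim_class(2)[OF E cls[OF m] g'] by blast
    have "((k', (g' \<bullet> DArr D v) \<bullet> f), (k, g \<bullet> f)) \<in> hom_rel C (DObj D i) E"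
      by (rule hom_rel_precomp[OF E(1) hom_colim_class(5)[OF E cls[OF j] comp[OF v g'] kg] f])
    moreover have "(g' \<bullet> DArr D v) \<bullet> f = g' \<bullet> DArr D u"
      using Comp_assoc[OF f dv g'H] uv' by simp
    ultimately have "(k, g \<bullet> f) \<in> \<psi> i"
      using hom_colim_class(4)[OF E cls[OF i] comp[OF u g']] by simp
    then show "hom_rel C (DObj D i) E `` {(k, g \<bullet> f)} = \<psi> i"
      using hom_colim_class(3)[OF E cls[OF i]] by simp
  qed
  then show ?thesis
    unfolding iota_def Ind_simps by (auto simp: fun_eq_iff)
qed

lemma iota_natural:
  assumes u: "u \<in> Hom (Idx D) i j"
  shows "iota D j \<bullet>\<^bsub>Ind C\<^esub> const_arr C (DArr D u) = iota D i"
proof -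
  note ij = diagram_Hom(1,2)[OF small_diagram u] and du = diagram_Hom(3)[OF small_diagram u]
  have "iota D j \<bullet>\<^bsub>Ind C\<^esub> const_arr C (DArr D u)
    = (const_obj C (DObj D i), \<lambda>_\<in>Obj point_cat. hom_rel C (DObj D i) D `` {(j, Ident C (DObj D j) \<bullet> DArr D u)}, D)"
    unfolding iota_def
    by (rule Comp_const_arr[OF du iota_Hom[OF ij(2), unfolded iota_def]])
      (use Ident_class(2)[OF ij(2)] in simp)
  moreover have "((j, Ident C (DObj D j) \<bullet> DArr D u), (i, Ident C (DObj D i))) \<in> hom_rel C (DObj D i) D"
    using Ident_Comp[OF du] Comp_Ident[OF du] diagram_Ident[OF small_diagram ij(2)] du
    by (intro hom_relI[OF small_diagram _ Ident_Hom[OF diagram_Ident(3)[OF small_diagram ij(1)]] diagram_Ident(1)[OF small_diagram ij(2)] u]) simp_all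
  ultimately show ?thesis
    using equiv_class_eq[OF hom_rel_equiv[OF small_diagram small_filtered]] by (simp add: iota_def)
qed

text \<open>The universal property of \<open>D\<close> as the colimit of the constant ind-objects on
  its terms. A cocone is a compatible family of classes, which is literally an arrow out of
  \<open>D\<close>; by \<open>Comp_iota\<close> the arrow is determined by the cocone.\<close>

lemma Ind_cocone:
  assumes E: "small_filtered_diagram C E"
    and k: "\<And>i. i \<in> Obj (Idx D) \<Longrightarrow> k i \<in> Hom (Ind C) (const_obj C (DObj D i)) E"
    and knat: "\<And>i j u. u \<in> Hom (Idx D) i j \<Longrightarrow> k j \<bullet>\<^bsub>Ind C\<^esub> const_arr C (DArr D u) = k i"
  shows "\<exists>!h. h \<in> Hom (Ind C) D E \<and> (\<forall>i\<in>Obj (Idx D). h \<bullet>\<^bsub>Ind C\<^esub> iota D i = k i)"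
proof -
  have Ed: "is_diagram C E" "filtered (Idx E)" using E by (auto simp: small_filtered_diagram_def)
  define \<phi> where "\<phi> i = fst (snd (k i))" for i
  have k': "k i = (const_obj C (DObj D i), \<phi> i, E)" if "i \<in> Obj (Idx D)" for i
    using k[OF that] by (cases "k i") (simp add: Ind_simps \<phi>_def)
  have ph: "\<phi> i \<in> ind_hom C (const_obj C (DObj D i)) E" if "i \<in> Obj (Idx D)" for i
    using k[OF that] unfolding k'[OF that] Ind_simps by blast
  have cls: "\<phi> i undefined \<in> hom_colim C (DObj D i) E"
    and ext: "\<phi> i = (\<lambda>_\<in>Obj point_cat. \<phi> i undefined)" if "i \<in> Obj (Idx D)" for i
    using ph[OF that] by (auto simp: ind_hom_def fun_eq_iff PiE_def extensional_def)
  define \<psi> where "\<psi> = (\<lambda>i\<in>Obj (Idx D). \<phi> i undefined)"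
  have "(m, f \<bullet> DArr D u) \<in> \<phi> i undefined" if u: "u \<in> Hom (Idx D) i j" and mf: "(m, f) \<in> \<phi> j undefined" for i j u m f
  proof -
    note ij = diagram_Hom(1,2)[OF small_diagram u] and du = diagram_Hom(3)[OF small_diagram u]
    have "\<phi> i = (\<lambda>_\<in>Obj point_cat. hom_rel C (DObj D i) E `` {(m, f \<bullet> DArr D u)})"
      using knat[OF u] Comp_const_arr[OF du k[OF ij(2), unfolded k'[OF ij(2)]] mf]
      unfolding k'[OF ij(1)] k'[OF ij(2)] by simp
    then have "\<phi> i undefined = hom_rel C (DObj D i) E `` {(m, f \<bullet> DArr D u)}" by simp
    moreover have "f \<in> Hom C (DObj D j) (DObj E m)" "m \<in> Obj (Idx E)"
      using hom_colim_class(2)[OF Ed cls[OF ij(2)] mf] by auto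
    ultimately show ?thesis using hom_rel_class(2)[OF Ed _ Comp_Hom[OF du]] by blast
  qed
  then have psi: "(D, \<psi>, E) \<in> Hom (Ind C) D E"
    unfolding Ind_simps ind_hom_def using sfd E cls by (auto simp: \<psi>_def)
  show ?thesis
  proof (rule ex1I[of _ "(D, \<psi>, E)"])
    show "(D, \<psi>, E) \<in> Hom (Ind C) D E \<and> (\<forall>i\<in>Obj (Idx D). (D, \<psi>, E) \<bullet>\<^bsub>Ind C\<^esub> iota D i = k i)"
    proof (intro conjI ballI)
      fix i assume i: "i \<in> Obj (Idx D)"
      show "(D, \<psi>, E) \<bullet>\<^bsub>Ind C\<^esub> iota D i = k i"
        unfolding Comp_iota[OF psi i] k'[OF i] by (subst ext[OF i]) (simp add: \<psi>_def i)
    qed (rule psi)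
  next
    fix h assume h: "h \<in> Hom (Ind C) D E \<and> (\<forall>i\<in>Obj (Idx D). h \<bullet>\<^bsub>Ind C\<^esub> iota D i = k i)"
    then obtain \<chi> where hx: "h = (D, \<chi>, E)" by (cases h) (auto simp: Ind_simps)
    have hH: "(D, \<chi>, E) \<in> Hom (Ind C) D E" using h hx by simp
    have "\<chi> i = \<phi> i undefined" if i: "i \<in> Obj (Idx D)" for i
    proof -
      have "(\<lambda>_\<in>Obj point_cat. \<chi> i) = \<phi> i"
        using bspec[OF conjunct2[OF h] i] unfolding hx Comp_iota[OF hH i] k'[OF i] by simp
      then show ?thesis by (metis insertI1 point_cat_simps(1) restrict_apply')
    qed
    moreover have "\<chi> \<in> extensional (Obj (Idx D))"
      using hH by (auto simp: Ind_simps ind_hom_def PiE_def)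
    ultimately have "\<chi> = \<psi>" by (auto simp: \<psi>_def fun_eq_iff extensional_def)
    then show "h = (D, \<psi>, E)" using hx by simp
  qed
qed

end

end

lemma (in category) const_Hom_I:
  assumes "X \<in> Obj C" "small_filtered_diagram C (E :: ('u, 'o, 'a) diagram)" "c \<in> hom_colim C X E"
  shows "(const_obj C X, \<lambda>_\<in>Obj point_cat. c, E) \<in> Hom (Ind C) (const_obj C X) E"
proof -
  have E: "is_diagram C E" "filtered (Idx E)" using assms(2) by (auto simp: small_filtered_diagram_def)
  have "(j, f \<bullet> Ident C X) \<in> c" if "(j, f) \<in> c" for j f
    using hom_colim_class(2)[OF E assms(3) that] Comp_Ident that by metis
  then show ?thesis
    unfolding Ind_simps using const_sfd[OF assms(2) assms(1)] assms(2,3) by (auto simp: ind_hom_def)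
qed

context ind_rigid_category
begin

text \<open>
  \<open>X\<close> is the filtered colimit of the objects \<open>D i\<close> of \<open>C0\<close>; compactness of \<open>X\<close> lets its identity
  factor through one of them. Compactness of the constant ind-objects themselves is not used; its
  usual proof constructs filtered colimits of ind-objects, which may leave the given universe.
\<close>

lemma compact_retract_of_const:
  assumes cX: "compact_object U C X"
    and EOA: "is_equivalence (Ind C0) C EO (EA :: ('u, 'p, 'b) ind_arr \<Rightarrow> 'a)"
    and cfun: "is_functor C0 C (EO \<circ> const_obj C0) (EA \<circ> const_arr C0)"
  obtains P s r where "P \<in> Obj C0" "s \<in> Hom C X (EO (const_obj C0 P))"
    "r \<in> Hom C (EO (const_obj C0 P)) X" "r \<bullet> s = Ident C X"
proof -
  let ?I = "Ind C0 :: (('u, 'p, 'b) diagram, ('u, 'p, 'b) ind_arr) cat"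
  have Efun: "is_functor ?I C EO EA"
    and bij: "D \<in> Obj ?I \<Longrightarrow> E \<in> Obj ?I \<Longrightarrow> bij_betw EA (Hom ?I D E) (Hom C (EO D) (EO E))"
    and ess: "Z \<in> Obj C \<Longrightarrow> \<exists>D\<in>Obj ?I. \<exists>f. is_iso C (EO D) Z f" for D E Z
    using EOA by (auto simp: is_equivalence_def)
  have EAc: "EA (g \<bullet>\<^bsub>?I\<^esub> f) = EA g \<bullet> EA f"
    if "f \<in> Hom ?I D E" "g \<in> Hom ?I E F" "D \<in> Obj ?I" "E \<in> Obj ?I" "F \<in> Obj ?I" for f g D E F
    using Efun that unfolding is_functor_def by blast
  have EAH: "EA f \<in> Hom C (EO D) (EO E)"
    if "f \<in> Hom ?I D E" "D \<in> Obj ?I" "E \<in> Obj ?I" for f D E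
    using Efun that unfolding is_functor_def by blast
  have EAinj: "f = g" if "EA f = EA g" "f \<in> Hom ?I D E" "g \<in> Hom ?I D E" "D \<in> Obj ?I" "E \<in> Obj ?I"
    for f g D E
    using bij[OF that(4,5)] that(1-3) unfolding bij_betw_def by (blast dest: inj_onD)
  have EAsurj: "\<exists>f\<in>Hom ?I D E. EA f = g" if "g \<in> Hom C (EO D) (EO E)" "D \<in> Obj ?I" "E \<in> Obj ?I" for g D E
    using bij_betw_imp_surj_on[OF bij[OF that(2,3)]] that(1) by (metis imageE)
  have X: "X \<in> Obj C" using cX by (simp add: compact_object_iff)
  obtain D f where D0: "D \<in> Obj ?I" and "is_iso C (EO D) X f" using ess[OF X] by blast
  then obtain f' where f: "f \<in> Hom C (EO D) X" "f' \<in> Hom C X (EO D)" "f \<bullet> f' = Ident C X"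
    by (auto simp: is_iso_def inverse_arrows_def)
  have sfd: "small_filtered_diagram C0 D" using D0 by (simp add: Ind_simps)
  note Dd = C0.small_diagram[OF sfd]
  have Dc: "const_obj C0 (DObj D i) \<in> Obj ?I" if "i \<in> Obj (Idx D)" for i
    using C0.const_sfd[OF sfd diagram_Ident(3)[OF Dd that]] by (simp add: Ind_simps)
  define DD where "DD = \<lparr> Idx = Idx D, DObj = (\<lambda>i. EO (const_obj C0 (DObj D i))),
    DArr = (\<lambda>u. EA (const_arr C0 (DArr D u))) \<rparr>"
  have DDs: "Idx DD = Idx D" "DObj DD i = EO (const_obj C0 (DObj D i))"
    "DArr DD u = EA (const_arr C0 (DArr D u))" for i u by (simp_all add: DD_def)
  define lam where "lam i = EA (C0.iota D i)" for i
  have "is_functor (Idx D) C (DObj DD) (DArr DD)"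
    unfolding is_functor_def DDs
  proof (intro conjI ballI)
    fix i assume i: "i \<in> Obj (Idx D)"
    show "EO (const_obj C0 (DObj D i)) \<in> Obj C"
      using cfun diagram_Ident(3)[OF Dd i] by (simp add: is_functor_def)
    show "EA (const_arr C0 (DArr D (Ident (Idx D) i))) = Ident C (EO (const_obj C0 (DObj D i)))"
      using cfun diagram_Ident(2,3)[OF Dd i] by (simp add: is_functor_def)
  next
    fix i j u assume "u \<in> Hom (Idx D) i j"
    then show "EA (const_arr C0 (DArr D u)) \<in> Hom C (EO (const_obj C0 (DObj D i))) (EO (const_obj C0 (DObj D j)))"
      using functor_Hom[OF C0.category_axioms cfun diagram_Hom(3)[OF Dd]] by simp
  next
    fix i j k u v assume uv: "u \<in> Hom (Idx D) i j" "v \<in> Hom (Idx D) j k"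
    show "EA (const_arr C0 (DArr D (v \<bullet>\<^bsub>Idx D\<^esub> u))) = EA (const_arr C0 (DArr D v)) \<bullet> EA (const_arr C0 (DArr D u))"
      using functor_Comp[OF C0.category_axioms cfun diagram_Hom(3)[OF Dd uv(1)] diagram_Hom(3)[OF Dd uv(2)]]
        diagram_Comp(2)[OF Dd uv] by simp
  qed
  then have DDd: "is_diagram C DD" using Dd by (simp add: is_diagram_def DDs)
  then have DDsfd: "small_filtered_diagram C DD"
    using sfd by (simp add: small_filtered_diagram_def DDs)
  note iH = C0.iota_Hom[OF sfd]
  have lamH: "lam i \<in> Hom C (DObj DD i) (EO D)" if "i \<in> Obj (Idx D)" for i
    unfolding lam_def DDs by (rule EAH[OF iH[OF that] Dc[OF that] D0])
  \<comment> \<open>An equivalence carries the colimit of \<open>Ind_cocone\<close> to a colimit in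
    \<open>C\<close>.\<close>
  have col: "is_colimit C DD (EO D) lam"
    unfolding is_colimit_def
  proof (intro conjI allI impI)
    show "is_cocone C DD (EO D) lam"
      unfolding is_cocone_def
    proof (intro conjI ballI)
      show "EO D \<in> Obj C" using f(1) Hom_Obj by blast
      show "lam i \<in> Hom C (DObj DD i) (EO D)" if "i \<in> Obj (Idx DD)" for i
        using lamH that by (simp add: DDs)
      fix i j u assume u: "u \<in> Hom (Idx DD) i j"
      then have u: "u \<in> Hom (Idx D) i j" by (simp add: DDs)
      note ij = diagram_Hom(1,2)[OF Dd u]
      show "lam j \<bullet> DArr DD u = lam i"
        using EAc[OF C0.const_arr_Hom[OF sfd diagram_Hom(3)[OF Dd u]] iH[OF ij(2)] Dc[OF ij(1)] Dc[OF ij(2)] D0]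
          C0.iota_natural[OF sfd u] by (simp add: lam_def DDs)
    qed
    fix M kap assume coc: "is_cocone C DD M kap"
    then have M: "M \<in> Obj C" by (simp add: is_cocone_def)
    have kH: "kap i \<in> Hom C (EO (const_obj C0 (DObj D i))) M" if "i \<in> Obj (Idx D)" for i
      using coc that by (simp add: is_cocone_def DDs)
    \<comment> \<open>An arbitrary vertex \<open>M\<close> is replaced by an isomorphic object in
      the image of \<open>EO\<close>; fullness and faithfulness then turn the cocone into one in
      \<open>Ind C0\<close>.\<close>
    obtain E m where E0: "E \<in> Obj ?I" and "is_iso C (EO E) M m" using ess[OF M] by blast
    then obtain m' where m: "m \<in> Hom C (EO E) M" "m' \<in> Hom C M (EO E)" "m \<bullet> m' = Ident C M"
      "m' \<bullet> m = Ident C (EO E)"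
      by (auto simp: is_iso_def inverse_arrows_def)
    have E: "small_filtered_diagram C0 E" using E0 by (simp add: Ind_simps)
    have Ed: "is_diagram C0 E" "filtered (Idx E)" using E by (auto simp: small_filtered_diagram_def)
    have "\<forall>i\<in>Obj (Idx D). \<exists>k\<in>Hom ?I (const_obj C0 (DObj D i)) E. EA k = m' \<bullet> kap i"
      using EAsurj[OF Comp_Hom[OF kH m(2)] Dc E0] by blast
    then obtain k where k: "\<And>i. i \<in> Obj (Idx D) \<Longrightarrow> k i \<in> Hom ?I (const_obj C0 (DObj D i)) E"
      and kE: "\<And>i. i \<in> Obj (Idx D) \<Longrightarrow> EA (k i) = m' \<bullet> kap i"
      by metis
    have mm: "m \<bullet> m' \<bullet> h = h" if "h \<in> Hom C Z M" for h Z
      using Comp_assoc[OF that m(2,1)] m(3) Ident_Comp[OF that] by simp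
    have "k j \<bullet>\<^bsub>?I\<^esub> const_arr C0 (DArr D u) = k i" if u: "u \<in> Hom (Idx D) i j" for i j u
    proof (rule EAinj[OF _ _ k Dc E0])
      note ij = diagram_Hom(1,2)[OF Dd u] and du = diagram_Hom(3)[OF Dd u]
      show "i \<in> Obj (Idx D)" "i \<in> Obj (Idx D)" by fact+
      obtain \<phi> where kj: "k j = (const_obj C0 (DObj D j), \<phi>, E)"
        using k[OF ij(2)] by (cases "k j") (simp add: Ind_simps)
      have c: "\<phi> undefined \<in> hom_colim C0 (DObj D j) E"
        using k[OF ij(2)] unfolding kj by (auto simp: Ind_simps ind_hom_def)
      obtain l g where lg: "(l, g) \<in> \<phi> undefined" using C0.hom_colim_class(1)[OF Ed c] by fast
      have "l \<in> Obj (Idx E)" "g \<bullet>\<^bsub>C0\<^esub> DArr D u \<in> Hom C0 (DObj D i) (DObj E l)"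
        using C0.hom_colim_class(2)[OF Ed c lg] C0.Comp_Hom[OF du] by auto
      then show "k j \<bullet>\<^bsub>?I\<^esub> const_arr C0 (DArr D u) \<in> Hom ?I (const_obj C0 (DObj D i)) E"
        unfolding kj C0.Comp_const_arr[OF sfd du k[OF ij(2), unfolded kj] lg]
        by (intro C0.const_Hom_I[OF diagram_Ident(3)[OF Dd ij(1)] E] C0.hom_rel_class(1)[OF Ed])
      have "EA (k j \<bullet>\<^bsub>?I\<^esub> const_arr C0 (DArr D u)) = (m' \<bullet> kap j) \<bullet> EA (const_arr C0 (DArr D u))"
        using EAc[OF C0.const_arr_Hom[OF sfd du] k[OF ij(2)] Dc[OF ij(1)] Dc[OF ij(2)] E0] kE[OF ij(2)] by simp
      also have "\<dots> = m' \<bullet> kap j \<bullet> EA (const_arr C0 (DArr D u))"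
        using Comp_assoc[OF _ kH[OF ij(2)] m(2)]
          EAH[OF C0.const_arr_Hom[OF sfd du] Dc[OF ij(1)] Dc[OF ij(2)]] by blast
      also have "kap j \<bullet> EA (const_arr C0 (DArr D u)) = kap i"
        using coc ij u by (simp add: is_cocone_def DDs)
      finally show "EA (k j \<bullet>\<^bsub>?I\<^esub> const_arr C0 (DArr D u)) = EA (k i)"
        using kE[OF ij(1)] by simp
    qed
    from C0.Ind_cocone[OF sfd E k this] obtain h0 where h0: "h0 \<in> Hom ?I D E"
      "\<And>i. i \<in> Obj (Idx D) \<Longrightarrow> h0 \<bullet>\<^bsub>?I\<^esub> C0.iota D i = k i"
      and h0u: "\<And>h. h \<in> Hom ?I D E \<Longrightarrow> (\<forall>i\<in>Obj (Idx D). h \<bullet>\<^bsub>?I\<^esub> C0.iota D i = k i) \<Longrightarrow> h = h0"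
      by blast
    note Eh0 = EAH[OF h0(1) D0 E0]
    show "\<exists>!h. h \<in> Hom C (EO D) M \<and> (\<forall>i\<in>Obj (Idx DD). h \<bullet> lam i = kap i)"
      unfolding DDs
    proof (rule ex1I[of _ "m \<bullet> EA h0"], intro conjI ballI)
      show "m \<bullet> EA h0 \<in> Hom C (EO D) M" using Eh0 m(1) by (rule Comp_Hom)
      fix i assume i: "i \<in> Obj (Idx D)"
      have "(m \<bullet> EA h0) \<bullet> lam i = m \<bullet> EA h0 \<bullet> lam i"
        using lamH[OF i] Eh0 m(1) by (rule Comp_assoc)
      also have "EA h0 \<bullet> lam i = m' \<bullet> kap i"
        using EAc[OF iH[OF i] h0(1) Dc[OF i] D0 E0] h0(2)[OF i] kE[OF i] by (simp add: lam_def)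
      finally show "(m \<bullet> EA h0) \<bullet> lam i = kap i" using mm[OF kH[OF i]] by simp
    next
      fix h assume h: "h \<in> Hom C (EO D) M \<and> (\<forall>i\<in>Obj (Idx D). h \<bullet> lam i = kap i)"
      then have hH: "h \<in> Hom C (EO D) M" by blast
      obtain x where x: "x \<in> Hom ?I D E" "EA x = m' \<bullet> h"
        using EAsurj[OF Comp_Hom[OF hH m(2)] D0 E0] by blast
      obtain \<psi> where xp: "x = (D, \<psi>, E)" using x(1) by (cases x) (simp add: Ind_simps)
      have "x \<bullet>\<^bsub>?I\<^esub> C0.iota D i = k i" if i: "i \<in> Obj (Idx D)" for i
      proof (rule EAinj[OF _ _ k[OF i] Dc[OF i] E0])
        have "\<psi> i \<in> hom_colim C0 (DObj D i) E"
          using x(1) i unfolding xp by (auto simp: Ind_simps ind_hom_def)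
        then show "x \<bullet>\<^bsub>?I\<^esub> C0.iota D i \<in> Hom ?I (const_obj C0 (DObj D i)) E"
          unfolding xp C0.Comp_iota[OF sfd x(1)[unfolded xp] i]
          by (rule C0.const_Hom_I[OF diagram_Ident(3)[OF Dd i] E])
        have "EA (x \<bullet>\<^bsub>?I\<^esub> C0.iota D i) = (m' \<bullet> h) \<bullet> lam i"
          using EAc[OF iH[OF i] x(1) Dc[OF i] D0 E0] x(2) by (simp add: lam_def)
        also have "\<dots> = m' \<bullet> kap i"
          using Comp_assoc[OF lamH[OF i] hH m(2)] h i by simp
        finally show "EA (x \<bullet>\<^bsub>?I\<^esub> C0.iota D i) = EA (k i)" using kE[OF i] by simp
      qed
      then have "x = h0" using h0u[OF x(1)] by blast
      then show "h = m \<bullet> EA h0" using mm[OF hH] x(2) by simp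
    qed
  qed
  have "compact_at X DD (EO D) lam"
    using cX DDsfd col by (simp add: compact_object_iff)
  then obtain j s where s: "j \<in> Obj (Idx D)" "s \<in> Hom C X (DObj DD j)" "lam j \<bullet> s = f'"
    using f(2) unfolding compact_at_def DDs(1) by blast
  show thesis
  proof (rule that)
    show "DObj D j \<in> Obj C0" using diagram_Ident(3)[OF Dd s(1)] .
    show "s \<in> Hom C X (EO (const_obj C0 (DObj D j)))" using s(2) by (simp add: DDs)
    show "f \<bullet> lam j \<in> Hom C (EO (const_obj C0 (DObj D j))) X"
      using Comp_Hom[OF lamH[OF s(1)] f(1)] by (simp add: DDs)
    show "(f \<bullet> lam j) \<bullet> s = Ident C X"
      using Comp_assoc[OF s(2) lamH[OF s(1)] f(1)] s(3) f(3) by simp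
  qed
qed

lemma compact_tensor:
  assumes Y: "compact_object U C Y" and X: "compact_object U C X"
  shows "compact_object U C (Y \<boxtimes>\<^sub>o X)"
proof -
  obtain EO EA where EOA: "is_equivalence (Ind C0) C EO (EA :: ('u, 'p, 'b) ind_arr \<Rightarrow> 'a)"
    and smf: "symmetric_monoidal_functor C0 C (EO \<circ> const_obj C0) (EA \<circ> const_arr C0)"
    using Ind_equivalence by blast
  have cfun: "is_functor C0 C (EO \<circ> const_obj C0) (EA \<circ> const_arr C0)"
    using smf by (simp add: symmetric_monoidal_functor_def)
  obtain P s r where P: "P \<in> Obj C0" and s: "s \<in> Hom C X (EO (const_obj C0 P))"
    and r: "r \<in> Hom C (EO (const_obj C0 P)) X" and rs: "r \<bullet> s = Ident C X"
    using compact_retract_of_const[OF X EOA cfun] .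
  obtain P' where "is_dual C0 P P'" using rigid_C0 P unfolding rigid_def by blast
  then obtain ev coev where "left_dual C ((EO \<circ> const_obj C0) P) ((EO \<circ> const_obj C0) P') ev coev"
    using dual_transport[OF C0.symmetric_monoidal_axioms smf P] by blast
  then have cW: "compact_object U C (Y \<boxtimes>\<^sub>o EO (const_obj C0 P))"
    using left_dual.compact_tensor[OF _ tensor_colimits Y] by fastforce
  have Yo: "Y \<in> Obj C" "X \<in> Obj C" using Y X by (auto simp: compact_object_iff)
  note iY = Ident_Hom[OF Yo(1)]
  show ?thesis
  proof (rule compact_retract[OF cW TenA_Hom[OF iY s] TenA_Hom[OF iY r]])
    show "(Ident C Y \<boxtimes> r) \<bullet> (Ident C Y \<boxtimes> s) = Ident C (Y \<boxtimes>\<^sub>o X)"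
      using TenA_Comp[OF iY iY s r] Comp_Ident[OF iY] rs TenA_Ident[OF Yo] by simp
  qed
qed

end

section \<open>Linear functionals on Laurent polynomials\<close>

abbreviation sg :: "'i \<Rightarrow> 'i \<Rightarrow>\<^sub>0 int" where
  "sg i \<equiv> Poly_Mapping.single i 1"

text \<open>
  A formal distribution with coefficients in an abelian group is used through the additive functional
  that it defines on Laurent polynomials with integer coefficients. Multiplying a distribution by a
  polynomial then becomes multiplying the argument of the functional.
\<close>

definition lin :: "('a, 'm) ring_scheme \<Rightarrow> ('i \<Rightarrow> 'a) \<Rightarrow> ('i \<Rightarrow>\<^sub>0 int) \<Rightarrow> 'a" where
  "lin G F f = finsum G (\<lambda>k. add_pow G (Poly_Mapping.lookup f k) (F k)) (Poly_Mapping.keys f)"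

context abelian_group
begin

lemma int_scale_closed [simp]: "x \<in> carrier G \<Longrightarrow> add_pow G (c :: int) x \<in> carrier G"
  by (rule add.int_pow_closed)

lemma add_pow_int_0 [simp]: "add_pow G (0 :: int) x = \<zero>"
  by (simp add: add_pow_def)

lemma lin_superset:
  assumes F: "\<And>i. F i \<in> carrier G" and A: "finite A" "Poly_Mapping.keys f \<subseteq> A"
  shows "lin G F f = finsum G (\<lambda>k. add_pow G (Poly_Mapping.lookup f k) (F k)) A"
  unfolding lin_def
proof (rule add.finprod_mono_neutral_cong_left[OF A(1,2)])
  show "add_pow G (Poly_Mapping.lookup f i) (F i) = \<zero>" if "i \<in> A - Poly_Mapping.keys f" for i
    using that by (simp add: in_keys_iff)
qed (use F in auto)

lemma lin_closed [simp]: "(\<And>i. F i \<in> carrier G) \<Longrightarrow> lin G F f \<in> carrier G"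
  unfolding lin_def by (intro finsum_closed) auto

lemma lin_zero [simp]: "lin G F 0 = \<zero>"
  by (simp add: lin_def)

lemma lin_single: 
  assumes F: "\<And>i. F i \<in> carrier G"
  shows "lin G F (Poly_Mapping.single i c) = add_pow G c (F i)"
proof -
  have "lin G F (Poly_Mapping.single i c) = finsum G (\<lambda>k. add_pow G (Poly_Mapping.lookup (Poly_Mapping.single i c) k) (F k)) {i}"
    by (rule lin_superset[OF F]) (auto split: if_splits)
  also have "\<dots> = add_pow G c (F i)" using F by (simp add: finsum_singleton)
  finally show ?thesis .
qed

lemma lin_sg [simp]: "(\<And>i. F i \<in> carrier G) \<Longrightarrow> lin G F (sg i) = F i"
  by (simp add: lin_single)

lemma lin_add:
  assumes F: "\<And>i. F i \<in> carrier G"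
  shows "lin G F (f + g) = lin G F f \<oplus> lin G F g"
proof -
  let ?A = "Poly_Mapping.keys f \<union> Poly_Mapping.keys g"
  have "lin G F (f + g) = finsum G (\<lambda>k. add_pow G (Poly_Mapping.lookup (f + g) k) (F k)) ?A"
    using keys_add[of f g] by (intro lin_superset F) auto
  also have "\<dots> = finsum G (\<lambda>k. add_pow G (Poly_Mapping.lookup f k) (F k) \<oplus> add_pow G (Poly_Mapping.lookup g k) (F k)) ?A"
    using F by (intro finsum_cong') (auto simp: lookup_add add.int_pow_mult)
  also have "\<dots> = lin G F f \<oplus> lin G F g"
    using F by (subst finsum_addf) (auto simp: lin_superset[of F ?A])
  finally show ?thesis .
qed

lemma cancel_add:
  assumes "x \<in> carrier G" "y \<in> carrier G" "z \<in> carrier G" "x \<oplus> z = y"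
  shows "x = y \<ominus> z"
proof -
  have "x = (x \<oplus> z) \<ominus> z" using assms(1,3) by (simp add: minus_eq a_assoc r_neg)
  then show ?thesis by (simp only: assms(4))
qed

lemma add_cancel:
  assumes "x \<in> carrier G" "y \<in> carrier G" "z \<in> carrier G" "x = y \<ominus> z"
  shows "x \<oplus> z = y"
  using assms by (simp add: minus_eq a_assoc l_neg)

lemma diff_add_diff:
  assumes "a \<in> carrier G" "b \<in> carrier G" "c \<in> carrier G" "d \<in> carrier G"
  shows "(a \<oplus> b) \<ominus> (c \<oplus> d) = (a \<ominus> c) \<oplus> (b \<ominus> d)"
  using assms by (simp add: minus_eq minus_add a_ac)

lemma lin_diff:
  assumes F: "\<And>i. F i \<in> carrier G"
  shows "lin G F (f - g) = lin G F f \<ominus> lin G F g"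
  using lin_add[where f = "f - g" and g = g, OF F] F by (intro cancel_add) auto

text \<open>Laurent polynomials are free abelian on the monomials. Agreement is asked only on the
  monomials of \<open>f\<close>, and \<open>frag_induction\<close> stays within them; this matters
  because words are often compared only where one exponent is fixed.\<close>

lemma lin_unique:
  assumes F: "\<And>i. F i \<in> carrier G" and P: "\<And>f. P f \<in> carrier G"
    and Padd: "\<And>f g. P (f + g) = P f \<oplus> P g"
    and Psg: "\<And>i. i \<in> Poly_Mapping.keys f \<Longrightarrow> P (sg i) = F i"
  shows "P f = lin G F f"
proof -
  have sub: "P (f - g) = P f \<ominus> P g" for f g
    using Padd[of "f - g" g] P by (intro cancel_add) auto
  have P0: "P 0 = \<zero>" using sub[of 0 0] P by (simp add: minus_eq r_neg)
  have "Poly_Mapping.keys f \<subseteq> Poly_Mapping.keys f" by simp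
  then show ?thesis
  proof (induction f rule: frag_induction)
    case zero then show ?case using P0 by simp
  next
    case (one x) then show ?case using Psg F by (simp add: lin_single)
  next
    case (diff a b) then show ?case using sub F by (simp add: lin_diff)
  qed
qed

lemma lin_cong:
  assumes "\<And>i. F i \<in> carrier G" "\<And>i. F' i \<in> carrier G" "\<And>i. i \<in> Poly_Mapping.keys f \<Longrightarrow> F i = F' i"
  shows "lin G F f = lin G F' f"
  by (rule lin_unique) (use assms in \<open>auto simp: lin_add\<close>)

lemma lin_eq_zero:
  assumes "\<And>i. F i \<in> carrier G" "\<And>i. i \<in> Poly_Mapping.keys f \<Longrightarrow> F i = \<zero>"
  shows "lin G F f = \<zero>"
  unfolding lin_def using assms by (intro add.finprod_one_eqI) auto

text \<open>Reduces an identity for all polynomial multiples to monomial multiples, where the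
  exponents are explicit and a locality statement can be applied.\<close>

lemma lin_mult_cong:
  fixes F :: "'i :: comm_monoid_add \<Rightarrow> 'a"
  assumes F: "\<And>i. F i \<in> carrier G" and F': "\<And>i. F' i \<in> carrier G"
    and "\<And>i. i \<in> Poly_Mapping.keys f \<Longrightarrow> lin G F (e * sg i) = lin G F' (e' * sg i)"
  shows "lin G F (e * f) = lin G F' (e' * f)"
proof -
  let ?H = "\<lambda>i. lin G F (e * sg i)"
  have "lin G F (e * f) = lin G ?H f"
    by (rule lin_unique[of _ "\<lambda>f. lin G F (e * f)"]) (use F in \<open>auto simp: lin_add distrib_left\<close>)
  also have "\<dots> = lin G F' (e' * f)"
    by (rule lin_unique[of _ "\<lambda>f. lin G F' (e' * f)", symmetric]) (use F F' assms in \<open>auto simp: lin_add distrib_left\<close>)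
  finally show ?thesis .
qed

lemma lin_sum:
  assumes F: "\<And>i. F i \<in> carrier G" and "finite A"
  shows "lin G F (\<Sum>j\<in>A. f j) = finsum G (\<lambda>j. lin G F (f j)) A"
  using assms(2) by (induction A rule: finite_induct) (use F in \<open>auto simp: lin_add\<close>)

text \<open>Multiplying a distribution by a variable shifts its coefficients by one, which for the
  functional is multiplication of the argument by a monomial. The map \<open>e\<close> places two
  coefficient indices among the exponents; lowering a power raises a mode number, so
  \<open>s\<close> and \<open>t\<close> are positive unit vectors in the uses.\<close>

lemma mult_z_minus_w_funpow:
  fixes F :: "'i :: comm_monoid_add \<Rightarrow> 'a"
  assumes F: "\<And>i. F i \<in> carrier G"
    and s: "\<And>p q. s + e p q = e (p - 1) q" and t: "\<And>p q. t + e p q = e p (q - 1)"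
  shows "(mult_z_minus_w G ^^ K) (\<lambda>p q. F (e p q)) p q = lin G F ((sg s - sg t) ^ K * sg (e p q))"
proof (induction K arbitrary: p q)
  case 0 then show ?case using F by simp
next
  case (Suc K)
  have "(mult_z_minus_w G ^^ Suc K) (\<lambda>p q. F (e p q)) p q
    = lin G F ((sg s - sg t) ^ K * sg (e (p - 1) q)) \<ominus> lin G F ((sg s - sg t) ^ K * sg (e p (q - 1)))"
    by (simp add: mult_z_minus_w_def Suc.IH)
  also have "\<dots> = lin G F ((sg s - sg t) ^ K * (sg s * sg (e p q)) - (sg s - sg t) ^ K * (sg t * sg (e p q)))"
    using F by (simp add: lin_diff mult_single s t)
  also have "(sg s - sg t) ^ K * (sg s * sg (e p q)) - (sg s - sg t) ^ K * (sg t * sg (e p q))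
    = (sg s - sg t) ^ Suc K * sg (e p q)"
    by (simp add: algebra_simps)
  finally show ?case .
qed

end

lemma lin_hom:
  assumes "abelian_group G" "abelian_group G'" "\<And>i. F i \<in> carrier G"
    and "\<And>x. x \<in> carrier G \<Longrightarrow> h x \<in> carrier G'"
    and "\<And>x y. x \<in> carrier G \<Longrightarrow> y \<in> carrier G \<Longrightarrow> h (x \<oplus>\<^bsub>G\<^esub> y) = h x \<oplus>\<^bsub>G'\<^esub> h y"
  shows "h (lin G F f) = lin G' (\<lambda>i. h (F i)) f"
proof -
  interpret G: abelian_group G by fact
  interpret G': abelian_group G' by fact
  show ?thesis
    by (rule G'.lin_unique[of _ "\<lambda>f. h (lin G F f)"]) (use assms in \<open>auto simp: G.lin_add\<close>)
qed

section \<open>Expansions of powers of a difference\<close>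

lemma int_choose_0 [simp]: "int_choose m 0 = 1"
  by (simp add: int_choose_def)

lemma falling_Suc:
  "(\<Prod>i=0..<Suc n. m + 1 - int i) = (\<Prod>i=0..<Suc n. m - int i) + int (Suc n) * (\<Prod>i=0..<n. m - int i)"
proof -
  have "(\<Prod>i=0..<Suc n. m + 1 - int i) = (m + 1) * (\<Prod>i=0..<n. m + 1 - int (Suc i))"
    by (subst prod.atLeast0_lessThan_Suc_shift) (simp add: o_def)
  moreover have "(\<Prod>i=0..<Suc n. m - int i) = (\<Prod>i=0..<n. m - int i) * (m - int n)"
    by simp
  ultimately show ?thesis by (simp add: algebra_simps)
qed

text \<open>The division in \<open>int_choose\<close> is exact also for negative upper entries. By
  \<open>falling_Suc\<close> and induction on \<open>n\<close>, neighbouring values of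
  \<open>m\<close> differ by a multiple of the factorial; the product vanishes at 0, and induction
  on \<open>m\<close> runs in both directions.\<close>

lemma fact_dvd_falling: "fact n dvd (\<Prod>i=0..<n. m - int i)"
proof (induction n arbitrary: m)
  case (Suc n)
  let ?P = "\<lambda>m. \<Prod>i=0..<Suc n. m - int i"
  have d: "fact (Suc n) dvd int (Suc n) * (\<Prod>i=0..<n. m - int i)" for m
    using Suc.IH[of m] by (simp add: mult_dvd_mono)
  have step: "fact (Suc n) dvd ?P (m + 1) \<longleftrightarrow> fact (Suc n) dvd ?P m" for m
    unfolding falling_Suc using dvd_add_left_iff[OF d] by blast
  show ?case
  proof (induction m rule: int_induct[of _ 0])
    case base
    have "?P 0 = 0" by (rule prod_zero) auto
    then show ?case by (simp only: dvd_0_right)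
  next
    case (step1 i) then show ?case using step by blast
  next
    case (step2 i) then show ?case using step[of "i - 1"] by simp
  qed
qed simp

lemma fact_int_choose: "fact n * int_choose m n = (\<Prod>i=0..<n. m - int i)"
  unfolding int_choose_def using fact_dvd_falling by (rule dvd_mult_div_cancel)

lemma int_choose_Suc: "int_choose (m + 1) (Suc n) = int_choose m (Suc n) + int_choose m n"
proof -
  have "fact (Suc n) * int_choose (m + 1) (Suc n) = fact (Suc n) * (int_choose m (Suc n) + int_choose m n)"
    unfolding distrib_left fact_int_choose falling_Suc by (simp flip: fact_int_choose)
  then show ?thesis by simp
qed

lemma int_choose_absorb: "int (Suc n) * int_choose m (Suc n) = (m - int n) * int_choose m n"
proof -
  have "fact n * (int (Suc n) * int_choose m (Suc n)) = fact (Suc n) * int_choose m (Suc n)"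
    by simp
  also have "\<dots> = fact n * ((m - int n) * int_choose m n)"
    unfolding fact_int_choose by (simp flip: fact_int_choose)
  finally show ?thesis by simp
qed

lemma int_choose_eq_0: "n < j \<Longrightarrow> int_choose (int n) j = 0"
  unfolding int_choose_def by (subst prod_zero) auto

text \<open>Here \<open>\<mu> p j\<close> stands for X^p Y^j with a possibly negative
  \<open>p\<close>. Pascal's rule combines neighbouring terms, and cutting the series leaves a
  single boundary term, whose coefficient is \<open>int_choose l J\<close>.\<close>

lemma binomial_step:
  fixes X Y :: "'r :: comm_ring_1"
  assumes "\<And>p j. X * \<mu> p j = \<mu> (p + 1) j" "\<And>p j. Y * \<mu> p j = \<mu> p (Suc j)"
  shows "(X + Y) * (\<Sum>j<Suc J. of_int (int_choose l j) * \<mu> (l - int j) j)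
    = (\<Sum>j<Suc J. of_int (int_choose (l + 1) j) * \<mu> (l + 1 - int j) j)
      + of_int (int_choose l J) * \<mu> (l - int J) (Suc J)"
proof (induction J)
  case 0 then show ?case using assms by (simp add: distrib_right)
next
  case (Suc J)
  have "(X + Y) * (\<Sum>j<Suc (Suc J). of_int (int_choose l j) * \<mu> (l - int j) j)
    = (X + Y) * (\<Sum>j<Suc J. of_int (int_choose l j) * \<mu> (l - int j) j)
     + of_int (int_choose l (Suc J)) * (X * \<mu> (l - int (Suc J)) (Suc J))
     + of_int (int_choose l (Suc J)) * (Y * \<mu> (l - int (Suc J)) (Suc J))"
    by (simp add: algebra_simps)
  also have "X * \<mu> (l - int (Suc J)) (Suc J) = \<mu> (l - int J) (Suc J)"
    unfolding assms by (simp add: algebra_simps)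
  also have "Y * \<mu> (l - int (Suc J)) (Suc J) = \<mu> (l - int (Suc J)) (Suc (Suc J))"
    unfolding assms ..
  also have "(X + Y) * (\<Sum>j<Suc J. of_int (int_choose l j) * \<mu> (l - int j) j)
     + of_int (int_choose l (Suc J)) * \<mu> (l - int J) (Suc J)
    = (\<Sum>j<Suc J. of_int (int_choose (l + 1) j) * \<mu> (l + 1 - int j) j)
     + of_int (int_choose (l + 1) (Suc J)) * \<mu> (l - int J) (Suc J)"
    unfolding Suc.IH int_choose_Suc by (simp add: algebra_simps)
  finally show ?case by (simp add: algebra_simps)
qed

section \<open>Truncated expansions and bounds on exponents\<close>

type_synonym laurent = "(int \<times> int \<times> int) \<Rightarrow>\<^sub>0 int"

abbreviation mon :: "int \<Rightarrow> int \<Rightarrow> int \<Rightarrow> laurent" where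
  "mon p q r \<equiv> sg (p, q, r)"

abbreviation (input) xx :: laurent where "xx \<equiv> mon 1 0 0"
abbreviation (input) yy :: laurent where "yy \<equiv> mon 0 1 0"
abbreviation (input) zz :: laurent where "zz \<equiv> mon 0 0 1"

lemma single_as_of_int: "Poly_Mapping.single k (c * d) = of_int c * Poly_Mapping.single k (d :: int)"
  for k :: "int \<times> int \<times> int"
proof -
  have "of_int c * Poly_Mapping.single k d = Poly_Mapping.single 0 c * Poly_Mapping.single k d"
    by (metis id_apply of_int_eq_id single_of_int)
  then show ?thesis by (simp add: mult_single)
qed

text \<open>
  The first \<open>J\<close> terms of the expansions of \<open>(x - y)\<close> to the power \<open>l\<close> in the regions where \<open>y\<close>,
  respectively \<open>x\<close>, is small. Functionals vanishing on high powers of the small variable cannot tell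
  them from the full series once \<open>J\<close> is large.
\<close>

definition expand_xy :: "nat \<Rightarrow> int \<Rightarrow> laurent" where
  "expand_xy J l = (\<Sum>j<J. Poly_Mapping.single (l - int j, int j, 0) (int_choose l j * (- 1) ^ j))"

definition expand_yx :: "nat \<Rightarrow> int \<Rightarrow> laurent" where
  "expand_yx J l = (\<Sum>j<J. Poly_Mapping.single (int j, l - int j, 0)
     (int_choose l j * (if even (l - int j) then 1 else - 1)))"

lemma expand_xy_step:
  "(xx - yy) * expand_xy (Suc J) l = expand_xy (Suc J) (l + 1)
     + Poly_Mapping.single (l - int J, int (Suc J), 0) (int_choose l J * (- 1) ^ Suc J)"
proof -
  have "xx - yy = xx + Poly_Mapping.single (0, 1, 0) (- 1)" by (simp add: single_uminus)
  then show ?thesis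
    unfolding expand_xy_def single_as_of_int
    by (simp only:) (rule binomial_step[where \<mu> = "\<lambda>p j. Poly_Mapping.single (p, int j, 0) ((- 1) ^ j)"],
      simp_all add: mult_single add.commute)
qed

lemma expand_yx_step:
  "(xx - yy) * expand_yx (Suc J) l = expand_yx (Suc J) (l + 1)
     + Poly_Mapping.single (int (Suc J), l - int J, 0)
         (int_choose l J * (if even (l - int J) then 1 else - 1))"
proof -
  \<comment> \<open>The integer power now belongs to -y, which is why the sign depends on the parity
    of the possibly negative number \<open>l - int j\<close>.\<close>
  have "xx - yy = Poly_Mapping.single (0, 1, 0) (- 1) + xx" by (simp add: single_uminus)
  then show ?thesis
    unfolding expand_yx_def single_as_of_int
    by (simp only:) (rule binomial_step[where \<mu> = "\<lambda>p j. Poly_Mapping.single (int j, p, 0) (if even p then 1 else - 1)"],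
      simp_all add: mult_single add.commute)
qed

text \<open>The degree \<phi> is one of the exponents \<open>px\<close>, \<open>py\<close>,
  \<open>pz\<close> or the negative of one. Such bounds are what a truncation property of a
  functional is tested against.\<close>

definition min_exp :: "('i \<Rightarrow> int) \<Rightarrow> int \<Rightarrow> ('i \<Rightarrow>\<^sub>0 int) \<Rightarrow> bool" where
  "min_exp \<phi> a f \<longleftrightarrow> (\<forall>i\<in>Poly_Mapping.keys f. a \<le> \<phi> i)"

abbreviation px :: "int \<times> int \<times> int \<Rightarrow> int" where "px \<equiv> fst"
abbreviation py :: "int \<times> int \<times> int \<Rightarrow> int" where "py \<equiv> \<lambda>i. fst (snd i)"
abbreviation pz :: "int \<times> int \<times> int \<Rightarrow> int" where "pz \<equiv> \<lambda>i. snd (snd i)"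

lemma min_exp_add: "min_exp \<phi> a f \<Longrightarrow> min_exp \<phi> a g \<Longrightarrow> min_exp \<phi> a (f + g)"
  using keys_add[of f g] unfolding min_exp_def by blast

lemma min_exp_diff: "min_exp \<phi> a f \<Longrightarrow> min_exp \<phi> a g \<Longrightarrow> min_exp \<phi> a (f - g)"
  using keys_diff[of f g] unfolding min_exp_def by blast

lemma min_exp_sum: "(\<And>j. j \<in> A \<Longrightarrow> min_exp \<phi> a (f j)) \<Longrightarrow> min_exp \<phi> a (sum f A)"
  using keys_sum[of f A] unfolding min_exp_def by blast

lemma min_exp_mult:
  assumes "\<And>i j. \<phi> (i + j) = \<phi> i + \<phi> j" "min_exp \<phi> a f" "min_exp \<phi> b g"
  shows "min_exp \<phi> (a + b) (f * g)"
  unfolding min_exp_def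
proof
  fix i assume "i \<in> Poly_Mapping.keys (f * g)"
  then obtain j k where "i = j + k" "j \<in> Poly_Mapping.keys f" "k \<in> Poly_Mapping.keys g"
    using keys_mult[of f g] by blast
  then show "a + b \<le> \<phi> i" using assms by (simp add: min_exp_def add_mono)
qed

lemma min_exp_single: "a \<le> \<phi> i \<Longrightarrow> min_exp \<phi> a (Poly_Mapping.single i c)"
  by (simp add: min_exp_def)

lemma min_exp_power:
  assumes "\<And>i j. \<phi> (i + j) = \<phi> i + \<phi> j" "min_exp \<phi> 0 f"
  shows "min_exp \<phi> 0 (f ^ n)"
proof (induction n)
  case 0
  have "\<phi> 0 = 0" using assms(1)[of 0 0] by simp
  then show ?case by (simp add: min_exp_def)
next
  case (Suc n) then show ?case using min_exp_mult[OF assms(1) assms(2) Suc] by simp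
qed

text \<open>Think of \<open>E l\<close> as a truncation of d^l. Each factor \<open>d\<close> leads
  to the truncation for the next exponent up to an error of degree at least \<open>b\<close>, and
  multiplying earlier errors by \<open>d\<close> does not lower their degree.\<close>

lemma tail_power:
  fixes d :: "'i :: comm_monoid_add \<Rightarrow>\<^sub>0 int"
  assumes \<phi>: "\<And>i j. \<phi> (i + j) = \<phi> i + \<phi> j" and d: "min_exp \<phi> 0 d"
    and tail: "\<And>l. min_exp \<phi> b (d * E l - E (l + 1))"
  shows "min_exp \<phi> b (d ^ A * E l - E (l + int A))"
proof (induction A)
  case 0 then show ?case by (simp add: min_exp_def)
next
  case (Suc A)
  have "d ^ Suc A * E l - E (l + int (Suc A))
    = d * (d ^ A * E l - E (l + int A)) + (d * E (l + int A) - E (l + int A + 1))"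
    by (simp add: algebra_simps)
  then show ?case
    using min_exp_mult[OF \<phi> d Suc] min_exp_add[OF _ tail[of "l + int A"]] by simp
qed

lemma expand_xy_tail:
  assumes "1 \<le> J"
  shows "min_exp py (int J) ((xx - yy) ^ A * expand_xy J l - expand_xy J (l + int A))"
proof (rule tail_power)
  show "min_exp py 0 (xx - yy)" by (intro min_exp_diff min_exp_single) auto
  show "min_exp py (int J) ((xx - yy) * expand_xy J l - expand_xy J (l + 1))" for l
    using expand_xy_step[of "J - 1" l] assms by (simp add: min_exp_def)
qed simp

lemma expand_yx_tail:
  assumes "1 \<le> J"
  shows "min_exp px (int J) ((xx - yy) ^ A * expand_yx J l - expand_yx J (l + int A))"
proof (rule tail_power)
  show "min_exp px 0 (xx - yy)" by (intro min_exp_diff min_exp_single) auto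
  show "min_exp px (int J) ((xx - yy) * expand_yx J l - expand_yx J (l + 1))" for l
    using expand_yx_step[of "J - 1" l] assms by (simp add: min_exp_def)
qed simp

lemma int_choose_zero: "int_choose 0 j = (if j = 0 then 1 else 0)"
  using int_choose_eq_0[of 0 j] by auto

text \<open>For a natural exponent the binomial series is finite: in the step to the next exponent
  the boundary coefficient is \<open>int_choose (int n) J'\<close> with n < J', which is 0. Hence
  both expansions become the same polynomial, the point at which locality can be applied to
  them.\<close>

lemma expand_xy_nat: "n < J \<Longrightarrow> expand_xy J (int n) = (xx - yy) ^ n"
proof (induction n)
  case 0
  have "expand_xy J 0 = (\<Sum>j<J. if j = 0 then 1 else 0)"
    unfolding expand_xy_def by (rule sum.cong) (auto simp: int_choose_zero simp flip: zero_prod_def)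
  then show ?case using 0 by simp
next
  case (Suc n)
  obtain J' where J: "J = Suc J'" using Suc.prems by (cases J) auto
  have "int_choose (int n) J' = 0" using Suc.prems J by (intro int_choose_eq_0) simp
  then show ?case using expand_xy_step[of J' "int n"] Suc J by (simp add: add.commute)
qed

lemma expand_yx_nat: "n < J \<Longrightarrow> expand_yx J (int n) = (xx - yy) ^ n"
proof (induction n)
  case 0
  have "expand_yx J 0 = (\<Sum>j<J. if j = 0 then 1 else 0)"
    unfolding expand_yx_def by (rule sum.cong) (auto simp: int_choose_zero simp flip: zero_prod_def)
  then show ?case using 0 by simp
next
  case (Suc n)
  obtain J' where J: "J = Suc J'" using Suc.prems by (cases J) auto
  have "int_choose (int n) J' = 0" using Suc.prems J by (intro int_choose_eq_0) simp
  then show ?case using expand_yx_step[of J' "int n"] Suc J by (simp add: add.commute)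
qed

lemma expand_xy_min_exp: "min_exp py 0 (expand_xy J l)" "min_exp pz 0 (expand_xy J l)"
  unfolding expand_xy_def by (intro min_exp_sum min_exp_single; simp)+

lemma expand_yx_min_exp: "min_exp px 0 (expand_yx J l)" "min_exp pz 0 (expand_yx J l)"
  unfolding expand_yx_def by (intro min_exp_sum min_exp_single; simp)+

text \<open>Every term of the binomial expansion contains u^A or w^B. The set \<open>S\<close> keeps
  track of the cofactors, which have to stay ordinary polynomials.\<close>

lemma power_add_split:
  fixes u w :: "'r :: comm_ring_1"
  assumes S: "1 \<in> S" "0 \<in> S" "u \<in> S" "w \<in> S" "\<And>a b. a \<in> S \<Longrightarrow> b \<in> S \<Longrightarrow> a + b \<in> S"
    "\<And>a b. a \<in> S \<Longrightarrow> b \<in> S \<Longrightarrow> a * b \<in> S"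
  shows "\<exists>g\<in>S. \<exists>h\<in>S. (u + w) ^ (A + B) = u ^ A * g + w ^ B * h"
proof (induction "A + B" arbitrary: A B)
  case 0 then show ?case using S by (intro bexI[of _ 1] bexI[of _ 0]) auto
next
  case (Suc n)
  have pow: "(u + w) ^ k \<in> S" for k using S by (induction k) auto
  show ?case
  proof (cases "A = 0 \<or> B = 0")
    case True
    then show ?thesis
    proof
      assume "A = 0" then show ?thesis using S pow by (intro bexI[of _ "(u + w) ^ B"] bexI[of _ 0]) auto
    next
      assume "B = 0" then show ?thesis using S pow by (intro bexI[of _ 0] bexI[of _ "(u + w) ^ A"]) auto
    qed
  next
    case False
    then obtain A' B' where AB: "A = Suc A'" "B = Suc B'" by (metis not0_implies_Suc)
    obtain g h where gh: "g \<in> S" "h \<in> S" "(u + w) ^ (A' + B) = u ^ A' * g + w ^ B * h"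
      using Suc.hyps(1)[of A' B] Suc.hyps(2) AB by auto
    obtain g' h' where gh': "g' \<in> S" "h' \<in> S" "(u + w) ^ (A + B') = u ^ A * g' + w ^ B' * h'"
      using Suc.hyps(1)[of A B'] Suc.hyps(2) AB by auto
    have "(u + w) ^ (A + B) = u * (u + w) ^ (A' + B) + w * (u + w) ^ (A + B')"
      using AB by (simp add: distrib_right)
    also have "\<dots> = u ^ A * (g + w * g') + w ^ B * (u * h + h')"
      unfolding gh(3) gh'(3) by (simp add: AB algebra_simps)
    finally show ?thesis using gh gh' S by blast
  qed
qed

section \<open>Formal calculus with truncated distributions\<close>

text \<open>The ordinary polynomials. Lower bounds on the exponents of a Laurent polynomial survive
  multiplication by them.\<close>

definition nonneg :: "laurent set" where
  "nonneg = {f. min_exp px 0 f \<and> min_exp py 0 f \<and> min_exp pz 0 f}"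

lemma nonneg_mult: "f \<in> nonneg \<Longrightarrow> g \<in> nonneg \<Longrightarrow> f * g \<in> nonneg"
  using min_exp_mult[of px 0 f 0 g] min_exp_mult[of py 0 f 0 g] min_exp_mult[of pz 0 f 0 g]
  by (simp add: nonneg_def)

lemma nonneg_add: "f \<in> nonneg \<Longrightarrow> g \<in> nonneg \<Longrightarrow> f + g \<in> nonneg"
  by (simp add: nonneg_def min_exp_add)

lemma nonneg_diff: "f \<in> nonneg \<Longrightarrow> g \<in> nonneg \<Longrightarrow> f - g \<in> nonneg"
  by (simp add: nonneg_def min_exp_diff)

lemma nonneg_gens: "0 \<in> nonneg" "1 \<in> nonneg" "xx \<in> nonneg" "yy \<in> nonneg" "zz \<in> nonneg"
  by (simp_all add: nonneg_def min_exp_def)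

lemma nonneg_power: "f \<in> nonneg \<Longrightarrow> f ^ n \<in> nonneg"
  by (induction n) (simp_all add: nonneg_gens nonneg_mult)

text \<open>Dong's trick: \<open>y - z = (y - x) + (x - z)\<close>, so a high power of \<open>y - z\<close> lies in the ideal.\<close>

lemma dong_split:
  "\<exists>g\<in>nonneg. \<exists>h\<in>nonneg. (yy - zz) ^ (A + K + K) = (xx - yy) ^ A * g + (xx - zz) ^ K * (yy - zz) ^ K * h"
proof -
  have n: "yy - xx \<in> nonneg" "xx - zz \<in> nonneg" "yy - zz \<in> nonneg"
    by (intro nonneg_diff nonneg_gens)+
  obtain g h where gh: "g \<in> nonneg" "h \<in> nonneg"
    "((yy - xx) + (xx - zz)) ^ (A + K) = (yy - xx) ^ A * g + (xx - zz) ^ K * h"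
    using power_add_split[of nonneg "yy - xx" "xx - zz" A K] n nonneg_gens nonneg_add nonneg_mult by blast
  have neg: "(yy - xx) ^ A = (- 1) ^ A * (xx - yy) ^ A"
    by (simp flip: power_mult_distrib)
  \<comment> \<open>One of the two surplus exponents \<open>K\<close> is set aside to supply the
    factor \<open>(yy - zz) ^ K\<close> of the second summand.\<close>
  have "(yy - zz) ^ (A + K + K) = ((yy - xx) + (xx - zz)) ^ (A + K) * (yy - zz) ^ K"
    by (simp add: power_add)
  also have "\<dots> = (xx - yy) ^ A * ((- 1) ^ A * g * (yy - zz) ^ K) + (xx - zz) ^ K * (yy - zz) ^ K * h"
    unfolding gh(3) neg by (simp only: distrib_right distrib_left mult_ac)
  finally show ?thesis
    using gh(1,2) n(3) nonneg_diff[OF nonneg_gens(1,2)]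
    by (intro bexI[of _ "(- 1) ^ A * g * (yy - zz) ^ K"] bexI[of _ h] nonneg_mult nonneg_power) simp_all
qed

lemma yz_power: "\<exists>h\<in>nonneg. (yy - zz) ^ n = yy ^ n + zz * h"
proof (induction n)
  case 0 then show ?case using nonneg_gens by (intro bexI[of _ 0]) auto
next
  case (Suc n)
  then obtain h where h: "h \<in> nonneg" "(yy - zz) ^ n = yy ^ n + zz * h" by blast
  have "(yy - zz) ^ Suc n = yy ^ Suc n + zz * ((yy - zz) * h - yy ^ n)"
    unfolding power_Suc h(2) by (simp add: algebra_simps)
  moreover have "(yy - zz) * h - yy ^ n \<in> nonneg"
    using h nonneg_gens by (intro nonneg_diff nonneg_mult nonneg_power)
  ultimately show ?case by blast
qed

lemma mon_mult: "mon p q r * mon p' q' r' = mon (p + p') (q + q') (r + r')"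
  by (simp add: mult_single)

lemma yy_power: "yy ^ n * mon p q r = mon p (q + int n) r"
  by (induction n) (simp_all add: mult.assoc mon_mult algebra_simps)

context abelian_group
begin

lemma neg_zero [simp]: "\<ominus> \<zero> = \<zero>"
  by (metis a_inv_closed l_zero r_neg zero_closed)

lemma diff_zero: "x \<in> carrier G \<Longrightarrow> x \<ominus> \<zero> = x"
  by (simp add: minus_eq)

lemma lin_eqI:
  assumes "\<And>i. F i \<in> carrier G" "lin G F (f - g) = \<zero>"
  shows "lin G F f = lin G F g"
proof -
  have "lin G F f = lin G F (f - g) \<oplus> lin G F g"
    using lin_add[where f = "f - g" and g = g, OF assms(1)] by simp
  then show ?thesis using assms by simp
qed

lemma eq_of_diff_zero:
  assumes "x \<in> carrier G" "y \<in> carrier G" "x \<ominus> y = \<zero>"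
  shows "x = y"
proof -
  have "\<zero> \<oplus> y = x" by (rule add_cancel) (simp_all only: assms zero_closed)
  then show ?thesis using assms(2) by simp
qed

text \<open>On \<open>f\<close> the tail contributes only monomials with \<phi>-exponent at least
  \<open>Q\<close> and z-exponent at least -1, all of which \<open>F\<close> kills. So the power of
  x - y may be absorbed into the exponent of the expansion.\<close>

lemma lin_expand:
  fixes F :: "int \<times> int \<times> int \<Rightarrow> 'a"
  assumes F [simp]: "\<And>i. F i \<in> carrier G" and tr: "\<And>i. Q \<le> \<phi> i \<Longrightarrow> - 1 \<le> pz i \<Longrightarrow> F i = \<zero>"
    and \<phi>: "\<And>i j. \<phi> (i + j) = \<phi> i + \<phi> j" and f: "min_exp \<phi> b f" "min_exp pz (- 1) f" and J: "Q \<le> J + b"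
    and tail: "min_exp \<phi> J ((xx - yy) ^ A * E - E')" and E: "min_exp pz 0 E" "min_exp pz 0 E'"
  shows "lin G F (E * ((xx - yy) ^ A * f)) = lin G F (E' * f)"
proof (rule lin_eqI)
  let ?t = "(xx - yy) ^ A * E - E'"
  have "min_exp pz 0 (xx - yy)" by (intro min_exp_diff min_exp_single) auto
  then have "min_exp pz 0 ((xx - yy) ^ A)" by (intro min_exp_power) auto
  then have "min_exp pz 0 ?t"
    using min_exp_mult[OF _ _ E(1)] E(2) by (intro min_exp_diff) fastforce+
  then have tf: "min_exp \<phi> (J + b) (?t * f)" "min_exp pz (- 1) (?t * f)"
    using min_exp_mult[OF \<phi> tail f(1)] min_exp_mult[OF _ _ f(2), of 0 ?t] by auto
  have "lin G F (?t * f) = \<zero>"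
    by (rule lin_eq_zero) (use tf J tr in \<open>fastforce simp: min_exp_def\<close>)+
  moreover have "E * ((xx - yy) ^ A * f) - E' * f = ?t * f"
    by (simp add: algebra_simps)
  ultimately show "lin G F (E * ((xx - yy) ^ A * f) - E' * f) = \<zero>" by simp
qed simp

lemma lin_expand_xy:
  assumes "\<And>i. F i \<in> carrier G" "\<And>p q r. Q \<le> q \<Longrightarrow> - 1 \<le> r \<Longrightarrow> F (p, q, r) = \<zero>"
    and "1 \<le> J" "Q \<le> int J + b" "min_exp py b f" "min_exp pz (- 1) f"
  shows "lin G F (expand_xy J l * ((xx - yy) ^ A * f)) = lin G F (expand_xy J (l + int A) * f)"
  by (rule lin_expand[where \<phi> = py and Q = Q, OF _ _ _ assms(5,6,4) expand_xy_tail expand_xy_min_exp(2) expand_xy_min_exp(2)])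
    (use assms in auto)

lemma lin_expand_yx:
  assumes "\<And>i. F i \<in> carrier G" "\<And>p q r. Q \<le> p \<Longrightarrow> - 1 \<le> r \<Longrightarrow> F (p, q, r) = \<zero>"
    and "1 \<le> J" "Q \<le> int J + b" "min_exp px b f" "min_exp pz (- 1) f"
  shows "lin G F (expand_yx J l * ((xx - yy) ^ A * f)) = lin G F (expand_yx J (l + int A) * f)"
  by (rule lin_expand[where \<phi> = px and Q = Q, OF _ _ _ assms(5,6,4) expand_yx_tail expand_yx_min_exp(2) expand_yx_min_exp(2)])
    (use assms in auto)

text \<open>
  Here \<open>abc\<close>, \<open>bac\<close>, \<open>cab\<close> stand for the products of the fields of \<open>a\<close>, \<open>b\<close>, \<open>c\<close> at \<open>x\<close>, \<open>y\<close>, \<open>z\<close> in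
  the given order, applied to the vacuum, and \<open>uc\<close>, \<open>cu\<close> for those of \<open>c\<close> with the field at \<open>y\<close> of
  \<open>u\<close>, the \<open>l\<close>-th product of \<open>a\<close> and \<open>b\<close>. The functional \<open>D\<close> of the proof is the difference of the
  \<open>l\<close>-th product of the fields of \<open>a\<close> and \<open>b\<close> acting before and after \<open>c\<close>. Powers of \<open>x - y\<close> kill it,
  powers of \<open>(x - z) (y - z)\<close> kill it, hence so do powers of \<open>y - z\<close>. On the vacuum that product of
  fields agrees with the field of \<open>u\<close>, so the two agree on \<open>c\<close> up to a power of \<open>y - z\<close>, which at
  \<open>z = 0\<close> is an invertible power of \<open>y\<close>.
\<close>

lemma goddard_uniqueness:
  fixes abc bac cab uc cu :: "int \<times> int \<times> int \<Rightarrow> 'a" and l k Q :: int and K N :: nat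
  assumes [simp]: "\<And>i. abc i \<in> carrier G" "\<And>i. bac i \<in> carrier G" "\<And>i. cab i \<in> carrier G"
      "\<And>i. uc i \<in> carrier G" "\<And>i. cu i \<in> carrier G"
    and loc_ab: "\<And>f. lin G abc ((xx - yy) ^ K * f) = lin G bac ((xx - yy) ^ K * f)"
    and loc_c: "\<And>f. lin G abc ((xx - zz) ^ K * (yy - zz) ^ K * f) = lin G cab ((xx - zz) ^ K * (yy - zz) ^ K * f)"
    and vac_abc: "\<And>p q r. 0 \<le> r \<Longrightarrow> abc (p, q, r) = \<zero>" 
    and vac_bac: "\<And>p q r. 0 \<le> r \<Longrightarrow> bac (p, q, r) = \<zero>"
    and vac_uc: "\<And>p q r. 0 \<le> r \<Longrightarrow> uc (p, q, r) = \<zero>"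
    and vac_cab: "\<And>p q r. 0 \<le> q \<Longrightarrow> cab (p, q, r) = \<zero>"
    and loc_cab: "\<And>f. min_exp px 0 f \<Longrightarrow> lin G cab ((xx - yy) ^ K * f) = \<zero>"
    and loc_bac: "\<And>f. min_exp px 0 f \<Longrightarrow> lin G bac ((xx - zz) ^ K * f) = \<zero>"
    and loc_u: "\<And>f. lin G uc ((yy - zz) ^ N * f) = lin G cu ((yy - zz) ^ N * f)"
    and cu: "\<And>q r J. - q \<le> int J \<Longrightarrow> cu (0, q, r) = lin G cab (expand_xy J l * mon 0 q r)"
    and trunc_abc: "\<And>p q r. Q \<le> q \<Longrightarrow> - 1 \<le> r \<Longrightarrow> abc (p, q, r) = \<zero>"
    and trunc_bac: "\<And>p q r. Q \<le> p \<Longrightarrow> - 1 \<le> r \<Longrightarrow> bac (p, q, r) = \<zero>"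
  shows "\<forall>\<^sub>F J in sequentially.
    uc (0, k, - 1) = lin G abc (expand_xy J l * mon 0 k (- 1)) \<ominus> lin G bac (expand_yx J l * mon 0 k (- 1))"
proof -
  \<comment> \<open>The shifted exponent l + A is the larger of l and K, so the expansions turn into
    the polynomial (x - y)^K', which contains the locality factor (x - y)^K.\<close>
  define A where "A = nat (int K - l)"
  define K' where "K' = nat (l + int A)"
  have K': "l + int A = int K'" "K \<le> K'" by (auto simp: A_def K'_def)
  \<comment> \<open>The summand \<open>N\<close> pays for exchanging u and c, the rest for killing
    \<open>D\<close>. The start \<open>k0\<close> below is chosen so that y^N' brings it to
    y^k.\<close>
  define N' where "N' = N + (A + K + K)"
  define k0 where "k0 = k - int N'"
  \<comment> \<open>The range on which \<open>D\<close> is controlled: x-exponents from 0 on are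
    what \<open>loc_cab\<close> and \<open>loc_bac\<close> ask for, \<open>k0\<close> bounds the
    tails in y uniformly, and -1 is the bound in \<open>trunc_abc\<close> and
    \<open>trunc_bac\<close>.\<close>
  define dom where "dom f \<longleftrightarrow> min_exp px 0 f \<and> min_exp py k0 f \<and> min_exp pz (- 1) f" for f :: laurent
  have dom_mult: "dom (g * f)" if "g \<in> nonneg" "dom f" for f g
    using that min_exp_mult[of px 0 g 0 f] min_exp_mult[of py 0 g k0 f] min_exp_mult[of pz 0 g "- 1" f]
    by (simp add: nonneg_def dom_def)
  have mx: "min_exp px (a + b) (f * g)" if "min_exp px a f" "min_exp px b g" for a b f g
    by (rule min_exp_mult[OF _ that]) simp
  have my: "min_exp py (a + b) (f * g)" if "min_exp py a f" "min_exp py b g" for a b f g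
    by (rule min_exp_mult[OF _ that]) simp
  have mz: "min_exp pz (a + b) (f * g)" if "min_exp pz a f" "min_exp pz b g" for a b f g
    by (rule min_exp_mult[OF _ that]) simp
  have z_zero: "lin G abc f = \<zero>" "lin G bac f = \<zero>" "lin G uc f = \<zero>" if "min_exp pz 0 f" for f
    using that vac_abc vac_bac vac_uc by (auto intro!: lin_eq_zero simp: min_exp_def)
  \<comment> \<open>The summands ensure, in turn, that the expansions at \<open>K'\<close> are
    exact, that the tail in x is killed, that the tail in y is killed by the truncation bound
    \<open>Q\<close>, and that in y it is also killed by the vacuum.\<close>
  define J0 where "J0 = Suc K' + nat Q + nat (Q - k0) + nat (- k0)"
  have main: "uc (0, k, - 1) = lin G abc (expand_xy J l * mon 0 k (- 1)) \<ominus> lin G bac (expand_yx J l * mon 0 k (- 1))"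
    if "J0 \<le> J" for J
  proof -
    have J: "K' < J" "1 \<le> J" "Q \<le> int J" "Q \<le> int J + k0" "- k0 \<le> int J" "0 \<le> int J + k0"
      using that by (auto simp: J0_def)
    let ?E = "expand_xy J l" and ?E' = "expand_yx J l"
    \<comment> \<open>A product of fields has two terms, yet only one occurs with c outermost: in
      the other one a would meet the vacuum with a nonnegative x-exponent, which gives zero.\<close>
    define D where "D f = lin G abc (?E * f) \<ominus> lin G bac (?E' * f) \<ominus> lin G cab (?E * f)" for f
    have D_closed [simp]: "D f \<in> carrier G" for f by (simp add: D_def)
    have D_add: "D (f + g) = D f \<oplus> D g" for f g
      by (simp add: D_def distrib_left lin_add diff_add_diff)
    have xy: "D ((xx - yy) ^ A * f) = \<zero>" if f: "dom f" for f
    proof -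
      have E0: "min_exp px 0 ((xx - yy) ^ n * f)" for n
        using dom_mult[OF nonneg_power[OF nonneg_diff[OF nonneg_gens(3,4)]] f] by (simp add: dom_def)
      have "lin G abc (?E * ((xx - yy) ^ A * f)) = lin G abc ((xx - yy) ^ K' * f)"
        using lin_expand_xy[of abc Q J k0 f l A] trunc_abc J f K'(1) expand_xy_nat[OF J(1)] by (simp add: dom_def)
      moreover have "lin G bac (?E' * ((xx - yy) ^ A * f)) = lin G bac ((xx - yy) ^ K' * f)"
        using lin_expand_yx[of bac Q J 0 f l A] trunc_bac J f K'(1) expand_yx_nat[OF J(1)] by (simp add: dom_def)
      moreover have "lin G cab (?E * ((xx - yy) ^ A * f)) = lin G cab ((xx - yy) ^ K' * f)"
        using lin_expand_xy[of cab 0 J k0 f l A] vac_cab J f K'(1) expand_xy_nat[OF J(1)] by (simp add: dom_def)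
      moreover have split: "(xx - yy) ^ K' * f = (xx - yy) ^ K * ((xx - yy) ^ (K' - K) * f)"
        using K'(2) by (simp flip: power_add mult.assoc)
      moreover have "lin G abc ((xx - yy) ^ K' * f) = lin G bac ((xx - yy) ^ K' * f)"
        unfolding split by (rule loc_ab)
      moreover have "lin G cab ((xx - yy) ^ K' * f) = \<zero>"
        unfolding split by (intro loc_cab E0)
      ultimately show ?thesis by (simp add: D_def minus_eq r_neg)
    qed
    have zs: "D ((xx - zz) ^ K * (yy - zz) ^ K * f) = \<zero>" if f: "dom f" for f
    proof -
      have "dom ((yy - zz) ^ K * f)"
        using f by (intro dom_mult nonneg_power nonneg_diff nonneg_gens)
      then have "min_exp px 0 (?E' * ((yy - zz) ^ K * f))"
        using mx[OF expand_yx_min_exp(1)[of J l], of 0] by (simp add: dom_def)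
      then have "lin G bac ((xx - zz) ^ K * (?E' * ((yy - zz) ^ K * f))) = \<zero>" by (rule loc_bac)
      then have "lin G bac (?E' * ((xx - zz) ^ K * (yy - zz) ^ K * f)) = \<zero>" by (simp only: mult_ac)
      moreover have "lin G abc (?E * ((xx - zz) ^ K * (yy - zz) ^ K * f))
          = lin G cab (?E * ((xx - zz) ^ K * (yy - zz) ^ K * f))"
        using loc_c[of "?E * f"] by (simp only: mult_ac)
      ultimately show ?thesis by (simp add: D_def minus_eq r_neg)
    qed
    have yz: "D ((yy - zz) ^ (A + K + K) * f) = \<zero>" if f: "dom f" for f
    proof -
      obtain g h where gh: "g \<in> nonneg" "h \<in> nonneg"
        "(yy - zz) ^ (A + K + K) = (xx - yy) ^ A * g + (xx - zz) ^ K * (yy - zz) ^ K * h"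
        using dong_split by blast
      have "D ((yy - zz) ^ (A + K + K) * f) = D ((xx - yy) ^ A * (g * f)) \<oplus> D ((xx - zz) ^ K * (yy - zz) ^ K * (h * f))"
        unfolding gh(3) distrib_right D_add by (simp only: mult.assoc)
      then show ?thesis using xy[OF dom_mult[OF gh(1) f]] zs[OF dom_mult[OF gh(2) f]] by simp
    qed
    let ?m = "mon 0 k0 (- 1)"
    let ?f = "(yy - zz) ^ N' * ?m"
    have m: "dom ?m" by (simp add: dom_def min_exp_def)
    have fx: "?f = (yy - zz) ^ (A + K + K) * ((yy - zz) ^ N * ?m)"
      by (simp add: N'_def power_add mult_ac)
    have Df: "D ?f = \<zero>" unfolding fx
      using m by (intro yz dom_mult nonneg_power nonneg_diff nonneg_gens)
    have uc: "lin G uc ?f = lin G cab (?E * ?f)"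
    proof -
      have "lin G uc ?f = lin G cu (1 * ?f)"
        using loc_u[of "(yy - zz) ^ (A + K + K) * ?m"] by (simp add: N'_def power_add mult_ac)
      also have "lin G cu (1 * ?f) = lin G cab (?E * ?f)"
      proof (rule lin_mult_cong)
        fix i assume i: "i \<in> Poly_Mapping.keys ?f"
        \<comment> \<open>The polynomial \<open>?f\<close> contains no x. Its x-exponent is bounded
          by 0 from above by this estimate and from below by \<open>dom\<close>, so
          \<open>cu\<close> applies to each monomial.\<close>
        have yz0: "min_exp (\<lambda>i. - px i) 0 (yy - zz)" by (intro min_exp_diff) (simp_all add: min_exp_def)
        have "min_exp (\<lambda>i. - px i) (0 + 0) ?f"
          by (rule min_exp_mult[OF _ min_exp_power[OF _ yz0]]) (simp_all add: min_exp_def)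
        moreover have "dom ?f" using m by (intro dom_mult nonneg_power nonneg_diff nonneg_gens)
        ultimately have "- px i \<ge> 0" "px i \<ge> 0" "k0 \<le> py i"
          using i unfolding dom_def min_exp_def by fastforce+
        then obtain q r where "i = (0, q, r)" "k0 \<le> q" by (cases i) auto
        then show "lin G cu (1 * sg i) = lin G cab (?E * sg i)"
          using cu[of q J r] J(5) by simp
      qed simp_all
      finally show ?thesis by simp
    qed
    have D0: "lin G abc (?E * ?f) \<ominus> lin G bac (?E' * ?f) = lin G uc ?f"
      unfolding uc by (rule eq_of_diff_zero[OF _ _ Df[unfolded D_def]]) simp_all
    obtain h where h: "h \<in> nonneg" "(yy - zz) ^ N' = yy ^ N' + zz * h" using yz_power by blast
    have f: "?f = mon 0 k (- 1) + zz * (h * ?m)"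
      unfolding h(2) distrib_right yy_power by (simp add: k0_def mult.assoc)
    have hz: "min_exp pz 0 (zz * (h * ?m))"
    proof -
      have "min_exp pz (1 + (0 + (- 1))) (zz * (h * ?m))"
        using h(1) by (intro mz) (auto simp: nonneg_def min_exp_def)
      then show ?thesis by simp
    qed
    have "lin G abc (?E * (zz * (h * ?m))) = \<zero>" "lin G bac (?E' * (zz * (h * ?m))) = \<zero>"
      using mz[OF expand_xy_min_exp(2)[of J l] hz] mz[OF expand_yx_min_exp(2)[of J l] hz]
      by (auto intro: z_zero)
    then show ?thesis
      using D0 z_zero(3)[OF hz] unfolding f distrib_left by (simp add: lin_add)
  qed
  then show ?thesis unfolding eventually_sequentially by blast
qed

text \<open>
  Both sides, as functions of \<open>(m, k, l)\<close>, satisfy \<open>f (m + 1, k, l) = f (m, k + 1, l) + f (m, k, l + 1)\<close>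
  and vanish for large \<open>l\<close>. So equality for \<open>m = 0\<close> propagates upwards in \<open>m\<close>, and downwards by
  descending induction on \<open>l\<close>.
\<close>

lemma borcherds_recursion:
  fixes abc bac :: "int \<times> int \<times> int \<Rightarrow> 'a" and u :: "int \<Rightarrow> int \<Rightarrow> 'a" and K :: nat
  assumes [simp]: "\<And>i. abc i \<in> carrier G" "\<And>i. bac i \<in> carrier G" "\<And>l k. u l k \<in> carrier G"
    and loc_ab: "\<And>f. lin G abc ((xx - yy) ^ K * f) = lin G bac ((xx - yy) ^ K * f)"
    and trunc_abc: "\<And>p q r. Q \<le> q \<Longrightarrow> - 1 \<le> r \<Longrightarrow> abc (p, q, r) = \<zero>"
    and trunc_bac: "\<And>p q r. Q \<le> p \<Longrightarrow> - 1 \<le> r \<Longrightarrow> bac (p, q, r) = \<zero>"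
    and trunc_u: "\<And>l k. Q \<le> l \<Longrightarrow> u l k = \<zero>"
    and base: "\<And>l k. \<forall>\<^sub>F J in sequentially. u l k =
      lin G abc (expand_xy J l * mon 0 k (- 1)) \<ominus> lin G bac (expand_yx J l * mon 0 k (- 1))"
  shows "\<forall>\<^sub>F J in sequentially.
    lin G (\<lambda>(p, q, r :: int). u p q) (\<Sum>n<J. Poly_Mapping.single (int n + l, m + k - int n, 0) (int_choose m n))
    = lin G abc (expand_xy J l * mon m k (- 1)) \<ominus> lin G bac (expand_yx J l * mon m k (- 1))"
proof -
  let ?u = "\<lambda>(p, q, r :: int). u p q"
  have u_closed [simp]: "?u i \<in> carrier G" for i by (cases i) simp
  define e where "e J m k l = (\<Sum>n<J. Poly_Mapping.single (int n + l, m + k - int n, 0 :: int) (int_choose m n))"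
    for J m k l
  define L where "L J m k l = lin G ?u (e J m k l)" for J m k l
  define R where "R J m k l = lin G abc (expand_xy J l * mon m k (- 1)) \<ominus> lin G bac (expand_yx J l * mon m k (- 1))"
    for J m k l
  define E where "E m k l \<longleftrightarrow> (\<forall>\<^sub>F J in sequentially. L J m k l = R J m k l)" for m k l
  have [simp]: "L J m k l \<in> carrier G" "R J m k l \<in> carrier G" for J m k l
    by (simp_all add: L_def R_def)
  have L_step: "\<forall>\<^sub>F J in sequentially. L J (m + 1) k l = L J m (k + 1) l \<oplus> L J m k (l + 1)" for m k l
  proof (rule eventually_sequentiallyI)
    fix J assume J: "Suc (nat (Q - l)) \<le> J"
    then obtain J' where J': "J = Suc J'" by (cases J) auto
    \<comment> \<open>The boundary term of the cut sum. For this \<open>J\<close> its first index is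
      at least \<open>Q\<close>, so \<open>trunc_u\<close> kills it.\<close>
    let ?t = "Poly_Mapping.single (int (Suc J') + l, m + k - int J', 0) (int_choose m J') :: laurent"
    have "(yy + xx) * e J m k l = e J (m + 1) k l + ?t"
    proof -
      have "e J m k l = (\<Sum>j<Suc J'. of_int (int_choose m j) * mon (int j + l) (k + (m - int j)) 0)" for m
        unfolding e_def J'
      proof (rule sum.cong)
        fix n
        show "Poly_Mapping.single (int n + l, m + k - int n, 0) (int_choose m n)
          = of_int (int_choose m n) * mon (int n + l) (k + (m - int n)) 0"
          using single_as_of_int[of "(int n + l, m + k - int n, 0)" "int_choose m n" 1]
          by (simp add: algebra_simps)
      qed simp
      moreover have "(yy + xx) * (\<Sum>j<Suc J'. of_int (int_choose m j) * mon (int j + l) (k + (m - int j)) 0)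
        = (\<Sum>j<Suc J'. of_int (int_choose (m + 1) j) * mon (int j + l) (k + (m + 1 - int j)) 0)
          + of_int (int_choose m J') * mon (int (Suc J') + l) (k + (m - int J')) 0"
        by (rule binomial_step[where \<mu> = "\<lambda>p j. mon (int j + l) (k + p) 0"]) (simp_all add: mon_mult algebra_simps)
      ultimately show ?thesis
        using single_as_of_int[of "(int (Suc J') + l, m + k - int J', 0)" "int_choose m J'" 1]
        by (simp add: algebra_simps)
    qed
    moreover have "(yy + xx) * e J m k l = e J m (k + 1) l + e J m k (l + 1)"
      by (simp add: e_def distrib_right sum_distrib_left mult_single algebra_simps sum.distrib)
    ultimately have "e J (m + 1) k l + ?t = e J m (k + 1) l + e J m k (l + 1)" by simp
    then have "lin G ?u (e J (m + 1) k l + ?t) = lin G ?u (e J m (k + 1) l + e J m k (l + 1))" by simp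
    moreover have "lin G ?u ?t = \<zero>"
      using J J' by (subst lin_single) (auto simp: trunc_u)
    ultimately show "L J (m + 1) k l = L J m (k + 1) l \<oplus> L J m k (l + 1)"
      by (simp add: lin_add L_def)
  qed
  have R_step: "\<forall>\<^sub>F J in sequentially. R J (m + 1) k l = R J m (k + 1) l \<oplus> R J m k (l + 1)" for m k l
  proof (rule eventually_sequentiallyI)
    fix J assume J: "Suc (nat (Q - m) + nat (Q - k)) \<le> J"
    let ?m = "mon m k (- 1)"
    have m: "min_exp px m ?m" "min_exp py k ?m" "min_exp pz (- 1) ?m" by (simp_all add: min_exp_def)
    \<comment> \<open>The difference is (x - y) x^m y^k / z, and the factor x - y raises the
      exponent of the expansions from \<open>l\<close> to \<open>l + 1\<close>.\<close>
    have mm: "mon (m + 1) k (- 1) - mon m (k + 1) (- 1) = (xx - yy) ^ 1 * ?m"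
      by (simp add: left_diff_distrib mon_mult add.commute)
    have "lin G abc (expand_xy J l * mon (m + 1) k (- 1)) \<ominus> lin G abc (expand_xy J l * mon m (k + 1) (- 1))
      = lin G abc (expand_xy J (l + 1) * ?m)"
      using lin_expand_xy[of abc Q J k ?m l 1] trunc_abc m J mm
      by (simp flip: lin_diff right_diff_distrib)
    moreover have "lin G bac (expand_yx J l * mon (m + 1) k (- 1)) \<ominus> lin G bac (expand_yx J l * mon m (k + 1) (- 1))
      = lin G bac (expand_yx J (l + 1) * ?m)"
      using lin_expand_yx[of bac Q J m ?m l 1] trunc_bac m J mm
      by (simp flip: lin_diff right_diff_distrib)
    ultimately have abc: "lin G abc (expand_xy J l * mon (m + 1) k (- 1))
       = lin G abc (expand_xy J (l + 1) * ?m) \<oplus> lin G abc (expand_xy J l * mon m (k + 1) (- 1))"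
      and bac: "lin G bac (expand_yx J l * mon (m + 1) k (- 1))
       = lin G bac (expand_yx J (l + 1) * ?m) \<oplus> lin G bac (expand_yx J l * mon m (k + 1) (- 1))"
      using add_cancel by (metis assms(1) lin_closed, metis assms(2) lin_closed)
    show "R J (m + 1) k l = R J m (k + 1) l \<oplus> R J m k (l + 1)"
      unfolding R_def abc bac by (subst diff_add_diff) (simp_all add: a_comm)
  qed
  have L_zero: "L J m k l = \<zero>" if "Q \<le> l" for J m k l
    unfolding L_def e_def using that
    by (subst lin_sum) (auto simp: lin_single trunc_u intro!: add.finprod_one_eqI)
  have R_zero: "\<forall>\<^sub>F J in sequentially. R J m k l = \<zero>" if "int K \<le> l" for m k l
  proof (rule eventually_sequentiallyI)
    fix J assume J: "Suc (nat l) \<le> J"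
    have "(xx - yy) ^ nat l * f = (xx - yy) ^ K * ((xx - yy) ^ (nat l - K) * f)" for f
      using that by (simp flip: power_add mult.assoc)
    then show "R J m k l = \<zero>"
      using expand_xy_nat[of "nat l" J] expand_yx_nat[of "nat l" J] J that loc_ab
      by (simp add: R_def minus_eq r_neg)
  qed
  have up: "E (m + 1) k l" if "E m (k + 1) l" "E m k (l + 1)" for m k l
    unfolding E_def
    using L_step[of m k l] R_step[of m k l] that[unfolded E_def]
    by eventually_elim simp
  have down: "E m (k + 1) l" if "E (m + 1) k l" "E m k (l + 1)" for m k l
    unfolding E_def
    using L_step[of m k l] R_step[of m k l] that[unfolded E_def]
  proof eventually_elim
    case (elim J)
    then have "L J m (k + 1) l \<oplus> L J m k (l + 1) = R J m (k + 1) l \<oplus> L J m k (l + 1)" by simp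
    then show ?case by (rule add.right_cancel[THEN iffD1, rotated 3]) simp_all
  qed
  have E0: "E 0 k l" for k l
  proof -
    have "L J 0 k l = u l k" if "1 \<le> J" for J
    proof -
      have "e J 0 k l = (\<Sum>n<J. if n = 0 then Poly_Mapping.single (l, k, 0) 1 else 0)"
        unfolding e_def by (rule sum.cong) (auto simp: int_choose_zero)
      then show ?thesis using that by (simp add: L_def)
    qed
    then have "\<forall>\<^sub>F J in sequentially. L J 0 k l = u l k" by (intro eventually_sequentiallyI)
    with base[of l k] show ?thesis unfolding E_def R_def by eventually_elim simp
  qed
  have "E m k l"
  proof (induction m arbitrary: k l rule: int_induct[of _ 0])
    case base then show ?case by (rule E0)
  next
    case (step1 m) then show ?case using up by blast
  next
    case (step2 m k l)
    have E_big: "E (m - 1) k l" if "max Q (int K) \<le> l" for k l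
    proof -
      have "\<forall>\<^sub>F J in sequentially. R J (m - 1) k l = \<zero>" using that by (intro R_zero) simp
      then show ?thesis unfolding E_def by eventually_elim (use that L_zero in simp)
    qed
    have "E (m - 1) k l" if "l = max Q (int K) - int n" for n k l
      using that
    proof (induction n arbitrary: k l)
      case 0 then show ?case by (intro E_big) simp
    next
      case (Suc n)
      have "E (m - 1) (k - 1) (l + 1)" using Suc.prems by (intro Suc.IH) simp
      then show ?case using down[of "m - 1" "k - 1" l] step2.IH by simp
    qed
    from this[of l "nat (max Q (int K) - l)" k] E_big[of l k] show ?case
      by (cases "max Q (int K) \<le> l") auto
  qed
  then show ?thesis unfolding E_def L_def R_def e_def .
qed

end

section \<open>Additive structure of the Hom groups\<close>

lemma HomG_simps [simp]:
  "carrier (HomG C X Y) = Hom C X Y" "zero (HomG C X Y) = HZero C X Y" "add (HomG C X Y) = HAdd C"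
  by (simp_all add: HomG_def)

lemma additive_map:
  assumes "abelian_group G" "abelian_group G'"
    and h: "\<And>x. x \<in> carrier G \<Longrightarrow> h x \<in> carrier G'"
    and hadd: "\<And>x y. x \<in> carrier G \<Longrightarrow> y \<in> carrier G \<Longrightarrow> h (x \<oplus>\<^bsub>G\<^esub> y) = h x \<oplus>\<^bsub>G'\<^esub> h y"
  shows "h \<zero>\<^bsub>G\<^esub> = \<zero>\<^bsub>G'\<^esub>"
    and "\<And>x. x \<in> carrier G \<Longrightarrow> h (add_pow G (c :: int) x) = add_pow G' c (h x)"
    and "\<And>x y. x \<in> carrier G \<Longrightarrow> y \<in> carrier G \<Longrightarrow> h (x \<ominus>\<^bsub>G\<^esub> y) = h x \<ominus>\<^bsub>G'\<^esub> h y"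
proof -
  interpret G: abelian_group G by fact
  interpret G': abelian_group G' by fact
  have "h \<zero>\<^bsub>G\<^esub> \<oplus>\<^bsub>G'\<^esub> h \<zero>\<^bsub>G\<^esub> = h \<zero>\<^bsub>G\<^esub>" using hadd[of "\<zero>\<^bsub>G\<^esub>" "\<zero>\<^bsub>G\<^esub>"] by simp
  then show "h \<zero>\<^bsub>G\<^esub> = \<zero>\<^bsub>G'\<^esub>" using h[OF G.zero_closed] by simp
  show "h (add_pow G c x) = add_pow G' c (h x)" if x: "x \<in> carrier G" for x
    using lin_hom[where G = G and G' = G' and F = "\<lambda>_ :: nat. x" and h = h and f = "Poly_Mapping.single 0 c"]
      assms x by (simp add: G.lin_single G'.lin_single)
  show "h (x \<ominus>\<^bsub>G\<^esub> y) = h x \<ominus>\<^bsub>G'\<^esub> h y" if "x \<in> carrier G" "y \<in> carrier G" for x y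
  proof -
    have "h (x \<ominus>\<^bsub>G\<^esub> y) \<oplus>\<^bsub>G'\<^esub> h y = h x"
      using hadd[of "x \<ominus>\<^bsub>G\<^esub> y" y] that G.add_cancel[of x "x \<ominus>\<^bsub>G\<^esub> y" y] 
      by (simp add: G.minus_eq G.a_assoc G.l_neg)
    then show ?thesis using h that by (intro G'.cancel_add) auto
  qed
qed

lemma (in abelian_group) lin_fun_diff:
  assumes [simp]: "\<And>i. F i \<in> carrier G" "\<And>i. F' i \<in> carrier G"
  shows "lin G (\<lambda>i. F i \<ominus> F' i) f = lin G F f \<ominus> lin G F' f"
  by (rule lin_unique[of _ "\<lambda>f. lin G F f \<ominus> lin G F' f", symmetric])
    (simp_all add: lin_add diff_add_diff)

lemma (in abelian_group) lin_uminus: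
  assumes [simp]: "\<And>i. F i \<in> carrier G"
  shows "lin G F (- f) = \<ominus> lin G F f"
  using lin_diff[where F = F and f = 0 and g = f] by (simp add: minus_eq)

lemma (in abelian_group) lin_of_int:
  fixes F :: "int \<times> int \<times> int \<Rightarrow> 'a"
  assumes [simp]: "\<And>i. F i \<in> carrier G"
  shows "lin G F (of_int c * f) = add_pow G c (lin G F f)"
proof -
  have "of_int c * sg i = Poly_Mapping.single i c" for i :: "int \<times> int \<times> int"
    using single_as_of_int[of i c 1] by simp
  then have "lin G F (of_int c * f) = lin G (\<lambda>i. add_pow G c (F i)) f"
    by (intro lin_unique[of _ "\<lambda>f. lin G F (of_int c * f)"]) (simp_all add: distrib_left lin_add lin_single)
  moreover have "add_pow G c (lin G F f) = lin G (\<lambda>i. add_pow G c (F i)) f"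
    by (intro lin_unique[of _ "\<lambda>f. add_pow G c (lin G F f)"]) (simp_all add: lin_add add.int_pow_distrib)
  ultimately show ?thesis by simp
qed

lemma mult_z_minus_w_hom:
  assumes "abelian_group G" "abelian_group G'"
    and h: "\<And>x. x \<in> carrier G \<Longrightarrow> h x \<in> carrier G'"
    and hadd: "\<And>x y. x \<in> carrier G \<Longrightarrow> y \<in> carrier G \<Longrightarrow> h (x \<oplus>\<^bsub>G\<^esub> y) = h x \<oplus>\<^bsub>G'\<^esub> h y"
    and F: "\<And>p q. F p q \<in> carrier G"
  shows "(mult_z_minus_w G ^^ K) F p q \<in> carrier G"
    "h ((mult_z_minus_w G ^^ K) F p q) = (mult_z_minus_w G' ^^ K) (\<lambda>p q. h (F p q)) p q"
proof -
  interpret G: abelian_group G by fact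
  show c: "(mult_z_minus_w G ^^ K) F p q \<in> carrier G" for K p q
    by (induction K arbitrary: p q) (simp_all add: F mult_z_minus_w_def)
  show "h ((mult_z_minus_w G ^^ K) F p q) = (mult_z_minus_w G' ^^ K) (\<lambda>p q. h (F p q)) p q"
    by (induction K arbitrary: p q)
      (simp_all add: mult_z_minus_w_def additive_map(3)[OF assms(1,2), of h] h hadd c)
qed

lemma mult_z_minus_w_zero:
  assumes "abelian_group G"
  shows "(mult_z_minus_w G ^^ K) (\<lambda>p q. \<zero>\<^bsub>G\<^esub>) = (\<lambda>p q. \<zero>\<^bsub>G\<^esub>)"
proof -
  interpret abelian_group G by fact
  show ?thesis by (induction K) (simp_all add: mult_z_minus_w_def minus_eq)
qed

context preadditive_symmetric_monoidal
begin

lemma HomG_ab: "f \<in> Hom C X Y \<Longrightarrow> abelian_group (HomG C X Y)"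
  using HomG_group Hom_Obj by blast

lemma precomp_additive:
  assumes e: "e \<in> Hom C S' S" and Y: "Y \<in> Obj C"
  shows "HZero C S Y \<bullet> e = HZero C S' Y"
    and "f \<in> Hom C S Y \<Longrightarrow> add_pow (HomG C S Y) (c :: int) f \<bullet> e = add_pow (HomG C S' Y) c (f \<bullet> e)"
    and "f \<in> Hom C S Y \<Longrightarrow> g \<in> Hom C S Y \<Longrightarrow>
      (f \<ominus>\<^bsub>HomG C S Y\<^esub> g) \<bullet> e = (f \<bullet> e) \<ominus>\<^bsub>HomG C S' Y\<^esub> (g \<bullet> e)"
    and "(\<And>i. F i \<in> Hom C S Y) \<Longrightarrow> lin (HomG C S Y) F P \<bullet> e = lin (HomG C S' Y) (\<lambda>i. F i \<bullet> e) P"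
proof -
  note S = Hom_Obj[OF e]
  note g = HomG_group[OF S(2) Y] HomG_group[OF S(1) Y]
  have h: "x \<bullet> e \<in> carrier (HomG C S' Y)" if "x \<in> carrier (HomG C S Y)" for x
    using that Comp_Hom[OF e] by simp
  have a: "(x \<oplus>\<^bsub>HomG C S Y\<^esub> y) \<bullet> e = (x \<bullet> e) \<oplus>\<^bsub>HomG C S' Y\<^esub> (y \<bullet> e)"
    if "x \<in> carrier (HomG C S Y)" "y \<in> carrier (HomG C S Y)" for x y
    using that Comp_HAdd_left[OF e] by simp
  show "HZero C S Y \<bullet> e = HZero C S' Y"
    using additive_map(1)[OF g, of "\<lambda>x. x \<bullet> e"] h a by simp
  show "f \<in> Hom C S Y \<Longrightarrow> add_pow (HomG C S Y) c f \<bullet> e = add_pow (HomG C S' Y) c (f \<bullet> e)"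
    using additive_map(2)[OF g, of "\<lambda>x. x \<bullet> e"] h a by simp
  show "f \<in> Hom C S Y \<Longrightarrow> g \<in> Hom C S Y \<Longrightarrow>
      (f \<ominus>\<^bsub>HomG C S Y\<^esub> g) \<bullet> e = (f \<bullet> e) \<ominus>\<^bsub>HomG C S' Y\<^esub> (g \<bullet> e)"
    using additive_map(3)[OF g, of "\<lambda>x. x \<bullet> e"] h a by simp
  show "(\<And>i. F i \<in> Hom C S Y) \<Longrightarrow> lin (HomG C S Y) F P \<bullet> e = lin (HomG C S' Y) (\<lambda>i. F i \<bullet> e) P"
    using lin_hom[OF g, of F "\<lambda>x. x \<bullet> e"] h a by simp
qed

lemma postcomp_additive:
  assumes e: "e \<in> Hom C Y Y'" and S: "S \<in> Obj C"
  shows "e \<bullet> HZero C S Y = HZero C S Y'"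
    and "f \<in> Hom C S Y \<Longrightarrow> e \<bullet> add_pow (HomG C S Y) (c :: int) f = add_pow (HomG C S Y') c (e \<bullet> f)"
    and "f \<in> Hom C S Y \<Longrightarrow> g \<in> Hom C S Y \<Longrightarrow>
      e \<bullet> (f \<ominus>\<^bsub>HomG C S Y\<^esub> g) = (e \<bullet> f) \<ominus>\<^bsub>HomG C S Y'\<^esub> (e \<bullet> g)"
    and "(\<And>i. F i \<in> Hom C S Y) \<Longrightarrow> e \<bullet> lin (HomG C S Y) F P = lin (HomG C S Y') (\<lambda>i. e \<bullet> F i) P"
proof -
  note Y = Hom_Obj[OF e]
  note g = HomG_group[OF S Y(1)] HomG_group[OF S Y(2)]
  have h: "e \<bullet> x \<in> carrier (HomG C S Y')" if "x \<in> carrier (HomG C S Y)" for x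
    using that Comp_Hom[OF _ e] by simp
  have a: "e \<bullet> (x \<oplus>\<^bsub>HomG C S Y\<^esub> y) = (e \<bullet> x) \<oplus>\<^bsub>HomG C S Y'\<^esub> (e \<bullet> y)"
    if "x \<in> carrier (HomG C S Y)" "y \<in> carrier (HomG C S Y)" for x y
    using that Comp_HAdd_right[OF _ _ e] by simp
  show "e \<bullet> HZero C S Y = HZero C S Y'"
    using additive_map(1)[OF g, of "\<lambda>x. e \<bullet> x"] h a by simp
  show "f \<in> Hom C S Y \<Longrightarrow> e \<bullet> add_pow (HomG C S Y) c f = add_pow (HomG C S Y') c (e \<bullet> f)"
    using additive_map(2)[OF g, of "\<lambda>x. e \<bullet> x"] h a by simp
  show "f \<in> Hom C S Y \<Longrightarrow> g \<in> Hom C S Y \<Longrightarrow>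
      e \<bullet> (f \<ominus>\<^bsub>HomG C S Y\<^esub> g) = (e \<bullet> f) \<ominus>\<^bsub>HomG C S Y'\<^esub> (e \<bullet> g)"
    using additive_map(3)[OF g, of "\<lambda>x. e \<bullet> x"] h a by simp
  show "(\<And>i. F i \<in> Hom C S Y) \<Longrightarrow> e \<bullet> lin (HomG C S Y) F P = lin (HomG C S Y') (\<lambda>i. e \<bullet> F i) P"
    using lin_hom[OF g, of F "\<lambda>x. e \<bullet> x"] h a by simp
qed

lemma tensor_left_additive:
  assumes e: "e \<in> Hom C Z W" and S: "S \<in> Obj C" and Y: "Y \<in> Obj C"
  shows "e \<boxtimes> HZero C S Y = HZero C (Z \<boxtimes>\<^sub>o S) (W \<boxtimes>\<^sub>o Y)"
    and "f \<in> Hom C S Y \<Longrightarrow> e \<boxtimes> add_pow (HomG C S Y) (c :: int) f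
      = add_pow (HomG C (Z \<boxtimes>\<^sub>o S) (W \<boxtimes>\<^sub>o Y)) c (e \<boxtimes> f)"
    and "(\<And>i. F i \<in> Hom C S Y) \<Longrightarrow>
      e \<boxtimes> lin (HomG C S Y) F P = lin (HomG C (Z \<boxtimes>\<^sub>o S) (W \<boxtimes>\<^sub>o Y)) (\<lambda>i. e \<boxtimes> F i) P"
proof -
  note Z = Hom_Obj[OF e]
  note g = HomG_group[OF S Y] HomG_group[OF Ten_Obj[OF Z(1) S] Ten_Obj[OF Z(2) Y]]
  have h: "e \<boxtimes> x \<in> carrier (HomG C (Z \<boxtimes>\<^sub>o S) (W \<boxtimes>\<^sub>o Y))" if "x \<in> carrier (HomG C S Y)" for x
    using that TenA_Hom[OF e] by simp
  have a: "e \<boxtimes> (x \<oplus>\<^bsub>HomG C S Y\<^esub> y) = (e \<boxtimes> x) \<oplus>\<^bsub>HomG C (Z \<boxtimes>\<^sub>o S) (W \<boxtimes>\<^sub>o Y)\<^esub> (e \<boxtimes> y)"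
    if "x \<in> carrier (HomG C S Y)" "y \<in> carrier (HomG C S Y)" for x y
    using that TenA_HAdd_right[OF e] by simp
  show "e \<boxtimes> HZero C S Y = HZero C (Z \<boxtimes>\<^sub>o S) (W \<boxtimes>\<^sub>o Y)"
    using additive_map(1)[OF g, of "\<lambda>x. e \<boxtimes> x"] h a by simp
  show "f \<in> Hom C S Y \<Longrightarrow> e \<boxtimes> add_pow (HomG C S Y) c f
      = add_pow (HomG C (Z \<boxtimes>\<^sub>o S) (W \<boxtimes>\<^sub>o Y)) c (e \<boxtimes> f)"
    using additive_map(2)[OF g, of "\<lambda>x. e \<boxtimes> x"] h a by simp
  show "(\<And>i. F i \<in> Hom C S Y) \<Longrightarrow>
      e \<boxtimes> lin (HomG C S Y) F P = lin (HomG C (Z \<boxtimes>\<^sub>o S) (W \<boxtimes>\<^sub>o Y)) (\<lambda>i. e \<boxtimes> F i) P"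
    using lin_hom[OF g, of F "\<lambda>x. e \<boxtimes> x"] h a by simp
qed

lemma tensor_right_additive:
  assumes e: "e \<in> Hom C Z W" and S: "S \<in> Obj C" and Y: "Y \<in> Obj C"
  shows "HZero C S Y \<boxtimes> e = HZero C (S \<boxtimes>\<^sub>o Z) (Y \<boxtimes>\<^sub>o W)"
    and "f \<in> Hom C S Y \<Longrightarrow> add_pow (HomG C S Y) (c :: int) f \<boxtimes> e
      = add_pow (HomG C (S \<boxtimes>\<^sub>o Z) (Y \<boxtimes>\<^sub>o W)) c (f \<boxtimes> e)"
proof -
  note Z = Hom_Obj[OF e]
  note g = HomG_group[OF S Y] HomG_group[OF Ten_Obj[OF S Z(1)] Ten_Obj[OF Y Z(2)]]
  show "HZero C S Y \<boxtimes> e = HZero C (S \<boxtimes>\<^sub>o Z) (Y \<boxtimes>\<^sub>o W)"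
    using additive_map(1)[OF g, of "\<lambda>x. x \<boxtimes> e"] TenA_Hom[OF _ e] TenA_HAdd_left[OF _ _ e] by simp
  show "f \<in> Hom C S Y \<Longrightarrow> add_pow (HomG C S Y) c f \<boxtimes> e
      = add_pow (HomG C (S \<boxtimes>\<^sub>o Z) (Y \<boxtimes>\<^sub>o W)) c (f \<boxtimes> e)"
    using additive_map(2)[OF g, of "\<lambda>x. x \<boxtimes> e"] TenA_Hom[OF _ e] TenA_HAdd_left[OF _ _ e] by simp
qed

end

text \<open>Endomorphisms of the unit act on every object \<open>X\<close> by tensoring and the left
  unit constraint, additively and with 1 acting as the identity. Hence 1/n acts on \<open>X\<close>,
  and f = f (n (1/n)) = (n f) (1/n) = 0.\<close>

lemma (in ind_rigid_category) Hom_torsion_free: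
  assumes f: "f \<in> Hom C X Y" and n: "n \<noteq> 0" and z: "add_pow (HomG C X Y) (int n) f = HZero C X Y"
  shows "f = HZero C X Y"
proof -
  let ?I = "Unit C" and ?E = "HomG C (Unit C) (Unit C)"
  note XY = Hom_Obj[OF f]
  obtain q where q: "q \<in> ring_hom rat_ring ?E" using rational by blast
  have qH: "q x \<in> Hom C ?I ?I" for x
    using ring_hom_closed[OF q, of x] by (simp add: rat_ring_def)
  have q_add: "q (x + y) = HAdd C (q x) (q y)" for x y
    using ring_hom_add[OF q, of x y] by (simp add: rat_ring_def)
  have q_one: "q 1 = Ident C ?I"
    using ring_hom_one[OF q] by (simp add: rat_ring_def HomG_def)
  interpret E: abelian_group ?E using HomG_group[OF Unit_Obj Unit_Obj] .
  have qn: "add_pow ?E (int k) (q x) = q (of_nat k * x)" for k x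
  proof (induction k)
    case 0
    have "HAdd C (q 0) (q 0) = q 0" using q_add[of 0 0] by simp
    then have "q 0 = HZero C ?I ?I" using E.add.l_cancel_one[of "q 0" "q 0"] qH by simp
    then show ?case by simp
  next
    case (Suc k)
    have "add_pow ?E (int (Suc k)) (q x) = add_pow ?E (int k) (q x) \<oplus>\<^bsub>?E\<^esub> q x"
      using E.add.int_pow_mult[of "q x" "int k" 1] qH E.add.int_pow_1[of "q x"] by (simp add: add.commute)
    moreover have "of_nat (Suc k) * x = of_nat k * x + x" by (simp add: algebra_simps)
    ultimately show ?case using Suc q_add by simp
  qed
  obtain l' where l': "l' \<in> Arr C" "Dom C l' = X" "Cod C l' = ?I \<boxtimes>\<^sub>o X" "LUnit C X \<bullet> l' = Ident C X"
    using LUnit_iso[OF XY(1)] by (rule iso_inverse)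
  let ?k = "\<lambda>e. LUnit C X \<bullet> (e \<boxtimes> Ident C X) \<bullet> l'"
  have lH: "l' \<in> Hom C X (?I \<boxtimes>\<^sub>o X)" "LUnit C X \<in> Hom C (?I \<boxtimes>\<^sub>o X) X"
    using l' LUnit_arr[OF XY(1)] by (auto intro!: HomI)
  note iX = Ident_Hom[OF XY(1)] and IX = Ten_Obj[OF Unit_Obj XY(1)]
  have kH: "?k e \<in> Hom C X X" if "e \<in> Hom C ?I ?I" for e
    using Comp_Hom[OF Comp_Hom[OF lH(1) TenA_Hom[OF that iX]] lH(2)] .
  have kn: "?k (add_pow ?E c e) = add_pow (HomG C X X) c (?k e)" if e: "e \<in> Hom C ?I ?I" for c :: int and e
    using tensor_right_additive(2)[OF iX Unit_Obj Unit_Obj e, of c]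
      precomp_additive(2)[OF lH(1) IX TenA_Hom[OF e iX], of c]
      postcomp_additive(2)[OF lH(2) XY(1) Comp_Hom[OF lH(1) TenA_Hom[OF e iX]], of c] by simp
  let ?e = "q (1 / of_nat n)"
  have "?k (q 1) = Ident C X"
    using l' XY unfolding q_one by (simp add: TenA_Ident Unit_Obj Ident_Comp_arr arr)
  then have "f = f \<bullet> ?k (q 1)" using Comp_Ident[OF f] by simp
  also have "q 1 = add_pow ?E (int n) ?e" using n qn[of n "1 / of_nat n"] by simp
  also have "f \<bullet> ?k (add_pow ?E (int n) ?e) = add_pow (HomG C X Y) (int n) (f \<bullet> ?k ?e)"
    unfolding kn[OF qH] by (rule postcomp_additive(2)[OF f XY(1) kH[OF qH]])
  also have "\<dots> = add_pow (HomG C X Y) (int n) f \<bullet> ?k ?e"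
    by (rule precomp_additive(2)[OF kH[OF qH] XY(2) f, symmetric])
  also have "\<dots> = HZero C X Y"
    unfolding z by (rule precomp_additive(1)[OF kH[OF qH] XY(2)])
  finally show ?thesis .
qed

section \<open>Modes of a vertex algebra\<close>

text \<open>Collects what the argument takes from the ind-completion: compactness of tensor
  products, and the possibility of cancelling positive integers in Hom groups.\<close>

locale compact_vertex_algebra = preadditive_symmetric_monoidal C
  for C :: "('o, 'a, 'x) additive_smcat_scheme" (structure) +
  fixes U :: "'u itself" and A :: "('o, 'a, 'v) va_data_scheme"
  assumes va: "vertex_algebra U C A"
    and compact_ten: "compact_object U C X \<Longrightarrow> compact_object U C Y \<Longrightarrow> compact_object U C (X \<boxtimes>\<^sub>o Y)"
    and torsion_free: "f \<in> Hom C X Y \<Longrightarrow> n \<noteq> 0 \<Longrightarrow>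
      add_pow (HomG C X Y) (int n) f = HZero C X Y \<Longrightarrow> f = HZero C X Y"
begin

abbreviation V :: 'o where "V \<equiv> VObj A"
abbreviation vac :: 'a where "vac \<equiv> Vac A"

text \<open>The n-th product of generalized elements: arrows into \<open>V\<close> from arbitrary
  sources play the role of vectors, and their sources are tensored.\<close>

definition md :: "int \<Rightarrow> 'a \<Rightarrow> 'a \<Rightarrow> 'a" where
  "md n f g = Mode A n \<bullet> (f \<boxtimes> g)"

lemmas V_Obj = vertex_algebra.V_Obj[OF va]

lemma Mode_arr: "Mode A n \<in> Arr C" "Dom C (Mode A n) = V \<boxtimes>\<^sub>o V" "Cod C (Mode A n) = V"
  using vertex_algebra.Mode_Hom[OF va] by (auto simp: Hom_def)

lemma vac_arr: "vac \<in> Arr C" "Dom C vac = Unit C" "Cod C vac = V"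
  using vertex_algebra.Vac_Hom[OF va] by (auto simp: Hom_def)

lemma T_arr: "Trans A \<in> Arr C" "Dom C (Trans A) = V" "Cod C (Trans A) = V"
  using vertex_algebra.Trans_Hom[OF va] by (auto simp: Hom_def)

lemma md_arr:
  assumes "f \<in> Arr C" "g \<in> Arr C" "Cod C f = V" "Cod C g = V"
  shows "md n f g \<in> Arr C" "Dom C (md n f g) = Dom C f \<boxtimes>\<^sub>o Dom C g" "Cod C (md n f g) = V"
  using assms V_Obj by (simp_all add: md_def arr Mode_arr)

lemma md_Hom: "f \<in> Hom C X V \<Longrightarrow> g \<in> Hom C Y V \<Longrightarrow> md n f g \<in> Hom C (X \<boxtimes>\<^sub>o Y) V"
  using md_arr[of f g n] by (simp add: Hom_def)

lemma md_comp:
  assumes "f \<in> Arr C" "g \<in> Arr C" "Cod C f = V" "Cod C g = V"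
    and "h \<in> Arr C" "h' \<in> Arr C" "Cod C h = Dom C f" "Cod C h' = Dom C g"
  shows "md n (f \<bullet> h) (g \<bullet> h') = md n f g \<bullet> (h \<boxtimes> h')"
  using assms V_Obj by (simp add: md_def arr Mode_arr Comp_assoc_arr interchange)

lemma md_comp_right:
  assumes "f \<in> Arr C" "g \<in> Arr C" "Cod C f = V" "Cod C g = V"
    and "h' \<in> Arr C" "Cod C h' = Dom C g"
  shows "md n f (g \<bullet> h') = md n f g \<bullet> (Ident C (Dom C f) \<boxtimes> h')"
  using md_comp[OF assms(1-4), of "Ident C (Dom C f)" h'] assms by (simp add: arr Comp_Ident_arr)

lemma md_additive:
  assumes f: "f \<in> Hom C X V" and S: "S \<in> Obj C"
  shows "md n f (HZero C S V) = HZero C (X \<boxtimes>\<^sub>o S) V"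
    and "g \<in> Hom C S V \<Longrightarrow> md n f (add_pow (HomG C S V) (c :: int) g) = add_pow (HomG C (X \<boxtimes>\<^sub>o S) V) c (md n f g)"
    and "(\<And>i. F i \<in> Hom C S V) \<Longrightarrow> md n f (lin (HomG C S V) F P) = lin (HomG C (X \<boxtimes>\<^sub>o S) V) (\<lambda>i. md n f (F i)) P"
proof -
  note mH = vertex_algebra.Mode_Hom[OF va, of n] and XS = Ten_Obj[OF Hom_Obj(1)[OF f] S]
  show "md n f (HZero C S V) = HZero C (X \<boxtimes>\<^sub>o S) V"
    unfolding md_def tensor_left_additive(1)[OF f S V_Obj] by (rule postcomp_additive(1)[OF mH XS])
  show "g \<in> Hom C S V \<Longrightarrow> md n f (add_pow (HomG C S V) c g) = add_pow (HomG C (X \<boxtimes>\<^sub>o S) V) c (md n f g)"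
    unfolding md_def using tensor_left_additive(2)[OF f S V_Obj, of g c]
      postcomp_additive(2)[OF mH XS TenA_Hom[OF f], of g c] by simp
  show "(\<And>i. F i \<in> Hom C S V) \<Longrightarrow> md n f (lin (HomG C S V) F P) = lin (HomG C (X \<boxtimes>\<^sub>o S) V) (\<lambda>i. md n f (F i)) P"
    unfolding md_def using tensor_left_additive(3)[OF f S V_Obj, of F P]
      postcomp_additive(4)[OF mH XS TenA_Hom[OF f], of F P] by simp
qed

text \<open>
  The locality axiom on an arbitrary third argument \<open>v\<close>, transported to three-variable
  distributions; \<open>e i j\<close> places the modes \<open>i\<close> of \<open>\<alpha>\<close> and \<open>j\<close> of \<open>\<beta>\<close> among the three exponents, and
  \<open>s\<close>, \<open>t\<close> are the exponents of the two variables involved.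
\<close>

definition local_pair :: "nat \<Rightarrow> 'o \<Rightarrow> 'o \<Rightarrow> 'a \<Rightarrow> 'a \<Rightarrow> bool" where
  "local_pair K X X' \<alpha> \<beta> \<longleftrightarrow>
    (\<forall>Z v e s t \<Phi> \<Psi> i j. v \<in> Hom C Z V \<longrightarrow>
      (\<forall>i j. s + e i j = e (i + 1) j) \<longrightarrow> (\<forall>i j. t + e i j = e i (j + 1)) \<longrightarrow>
      (\<forall>k. \<Phi> k \<in> Hom C ((X \<boxtimes>\<^sub>o X') \<boxtimes>\<^sub>o Z) V) \<longrightarrow> (\<forall>k. \<Psi> k \<in> Hom C ((X \<boxtimes>\<^sub>o X') \<boxtimes>\<^sub>o Z) V) \<longrightarrow>
      (\<forall>i j. \<Phi> (e i j) = md i \<alpha> (md j \<beta> v) \<bullet> Assoc C X X' Z) \<longrightarrow>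
      (\<forall>i j. \<Psi> (e i j) = md j \<beta> (md i \<alpha> v) \<bullet> Assoc C X' X Z \<bullet> (Braid C X X' \<boxtimes> Ident C Z)) \<longrightarrow>
      lin (HomG C ((X \<boxtimes>\<^sub>o X') \<boxtimes>\<^sub>o Z) V) \<Phi> ((sg s - sg t) ^ K * sg (e i j :: int \<times> int \<times> int))
      = lin (HomG C ((X \<boxtimes>\<^sub>o X') \<boxtimes>\<^sub>o Z) V) \<Psi> ((sg s - sg t) ^ K * sg (e i j)) \<and>
      lin (HomG C ((X \<boxtimes>\<^sub>o X') \<boxtimes>\<^sub>o Z) V) \<Phi> ((sg t - sg s) ^ K * sg (e i j))
      = lin (HomG C ((X \<boxtimes>\<^sub>o X') \<boxtimes>\<^sub>o Z) V) \<Psi> ((sg t - sg s) ^ K * sg (e i j)))"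

text \<open>The axiom has the identity of \<open>V\<close> as third argument; precomposition with
  \<open>v\<close> gives the general case. All large \<open>K\<close> are provided, so that several
  pairs can share one exponent, and both signs of the difference, since they differ by a power of
  -1.\<close>

lemma locality_modes:
  assumes cX: "compact_object U C X" and cX': "compact_object U C X'"
    and a: "\<alpha> \<in> Hom C X V" and b: "\<beta> \<in> Hom C X' V"
  shows "\<exists>K0. \<forall>K\<ge>K0. local_pair K X X' \<alpha> \<beta>"
proof -
  let ?S = "(X \<boxtimes>\<^sub>o X') \<boxtimes>\<^sub>o V"
  let ?G = "HomG C ?S V"
  let ?iV = "Ident C V"
  define P where "P p q = Y_coeff A q \<bullet> (?iV \<boxtimes> Y_coeff A p) \<bullet> Assoc C V V V \<bullet> ((\<alpha> \<boxtimes> \<beta>) \<boxtimes> ?iV)" for p q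
  define Q where "Q p q = Y_coeff A p \<bullet> (?iV \<boxtimes> Y_coeff A q) \<bullet> Assoc C V V V \<bullet> (Braid C V V \<boxtimes> ?iV) \<bullet> ((\<alpha> \<boxtimes> \<beta>) \<boxtimes> ?iV)" for p q
  obtain K0 where K0: "(mult_z_minus_w ?G ^^ K0) (\<lambda>p q. P p q \<ominus>\<^bsub>?G\<^esub> Q p q) = (\<lambda>p q. HZero C ?S V)"
    using vertex_algebra.locality[OF va cX cX' a b] unfolding P_def Q_def by blast
  note XX = Hom_Obj(1)[OF a] Hom_Obj(1)[OF b]
  have S: "?S \<in> Obj C" using XX V_Obj by (simp add: arr)
  interpret G: abelian_group ?G using HomG_group[OF S V_Obj] .
  have K: "(mult_z_minus_w ?G ^^ K) (\<lambda>p q. P p q \<ominus>\<^bsub>?G\<^esub> Q p q) = (\<lambda>p q. HZero C ?S V)" if "K0 \<le> K" for K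
  proof -
    have "(mult_z_minus_w ?G ^^ ((K - K0) + K0)) (\<lambda>p q. P p q \<ominus>\<^bsub>?G\<^esub> Q p q)
      = (mult_z_minus_w ?G ^^ (K - K0)) (\<lambda>p q. HZero C ?S V)"
      unfolding funpow_add o_apply K0 ..
    then show ?thesis using that mult_z_minus_w_zero[OF G.abelian_group_axioms, of "K - K0"] by simp
  qed
  note [simp] = arr Mode_arr V_Obj HomD[OF a] HomD[OF b] XX Comp_assoc_arr Comp_Ident_arr Ident_Comp_arr md_arr
  have PQ: "P p q \<in> Hom C ?S V" "Q p q \<in> Hom C ?S V" for p q
    by (auto intro!: HomI simp: P_def Q_def Y_coeff_def)
  have "local_pair K X X' \<alpha> \<beta>" if KK: "K0 \<le> K" for K
    unfolding local_pair_def
  proof (intro allI impI)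
    fix Z v and e :: "int \<Rightarrow> int \<Rightarrow> int \<times> int \<times> int" and s t \<Phi> \<Psi> i j
    assume v: "v \<in> Hom C Z V" and s: "\<forall>i j. s + e i j = e (i + 1) j" and t: "\<forall>i j. t + e i j = e i (j + 1)"
      and Ph: "\<forall>k. \<Phi> k \<in> Hom C ((X \<boxtimes>\<^sub>o X') \<boxtimes>\<^sub>o Z) V" and Ps: "\<forall>k. \<Psi> k \<in> Hom C ((X \<boxtimes>\<^sub>o X') \<boxtimes>\<^sub>o Z) V"
      and Phe: "\<forall>i j. \<Phi> (e i j) = md i \<alpha> (md j \<beta> v) \<bullet> Assoc C X X' Z"
      and Pse: "\<forall>i j. \<Psi> (e i j) = md j \<beta> (md i \<alpha> v) \<bullet> Assoc C X' X Z \<bullet> (Braid C X X' \<boxtimes> Ident C Z)"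
    let ?S' = "(X \<boxtimes>\<^sub>o X') \<boxtimes>\<^sub>o Z"
    let ?H = "HomG C ?S' V"
    note [simp] = HomD[OF v] Hom_Obj(1)[OF v]
    interpret H: abelian_group ?H by (rule HomG_group) simp_all
    let ?v = "Ident C (X \<boxtimes>\<^sub>o X') \<boxtimes> v"
    have vH: "?v \<in> Hom C ?S' ?S" by (intro HomI) simp_all
    \<comment> \<open>In the axiom \<alpha> carries the second variable, so its mode is
      \<open>- q - 1\<close>, while that of \<beta> is \<open>- p - 1\<close>.\<close>
    have hP: "P p q \<bullet> ?v = \<Phi> (e (- q - 1) (- p - 1))" for p q
    proof -
      have "P p q \<bullet> ?v = Y_coeff A q \<bullet> (?iV \<boxtimes> Y_coeff A p) \<bullet> Assoc C V V V \<bullet> ((\<alpha> \<boxtimes> \<beta>) \<boxtimes> v)"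
        by (simp add: P_def Y_coeff_def interchange)
      also have "\<dots> = Mode A (- q - 1) \<bullet> (\<alpha> \<boxtimes> (Mode A (- p - 1) \<bullet> (\<beta> \<boxtimes> v))) \<bullet> Assoc C X X' Z"
        by (simp add: Y_coeff_def Assoc_nat interchange_assoc)
      finally show ?thesis using Phe by (simp add: md_def)
    qed
    have hQ: "Q p q \<bullet> ?v = \<Psi> (e (- q - 1) (- p - 1))" for p q
    proof -
      have "Q p q \<bullet> ?v = Y_coeff A p \<bullet> (?iV \<boxtimes> Y_coeff A q) \<bullet> Assoc C V V V \<bullet> ((Braid C V V \<bullet> (\<alpha> \<boxtimes> \<beta>)) \<boxtimes> v)"
        by (simp add: Q_def Y_coeff_def interchange)
      also have "Braid C V V \<bullet> (\<alpha> \<boxtimes> \<beta>) = (\<beta> \<boxtimes> \<alpha>) \<bullet> Braid C X X'"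
        by (simp add: Braid_nat)
      also have "((\<beta> \<boxtimes> \<alpha>) \<bullet> Braid C X X') \<boxtimes> v = ((\<beta> \<boxtimes> \<alpha>) \<boxtimes> v) \<bullet> (Braid C X X' \<boxtimes> Ident C Z)"
        by (simp add: interchange)
      also have "Y_coeff A p \<bullet> (?iV \<boxtimes> Y_coeff A q) \<bullet> Assoc C V V V \<bullet> \<dots>
        = Mode A (- p - 1) \<bullet> (\<beta> \<boxtimes> (Mode A (- q - 1) \<bullet> (\<alpha> \<boxtimes> v))) \<bullet> Assoc C X' X Z \<bullet> (Braid C X X' \<boxtimes> Ident C Z)"
        by (simp add: Y_coeff_def Assoc_nat_assoc interchange_assoc)
      finally show ?thesis using Pse by (simp add: md_def)
    qed
    define F where "F k = \<Phi> k \<ominus>\<^bsub>?H\<^esub> \<Psi> k" for k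
    have PhH: "\<Phi> k \<in> carrier ?H" and PsH: "\<Psi> k \<in> carrier ?H" for k
      using Ph[rule_format, of k] Ps[rule_format, of k] by (simp_all only: HomG_simps)
    have FH: "F k \<in> carrier ?H" for k
      unfolding F_def using PhH PsH by (rule H.minus_closed)
    have hF: "(P p q \<ominus>\<^bsub>?G\<^esub> Q p q) \<bullet> ?v = F (e (- q - 1) (- p - 1))" for p q
      unfolding F_def using precomp_additive(3)[OF vH V_Obj PQ] hP hQ by simp
    have "(mult_z_minus_w ?H ^^ K) (\<lambda>p q. F (e (- q - 1) (- p - 1))) p q
      = (mult_z_minus_w ?G ^^ K) (\<lambda>p q. P p q \<ominus>\<^bsub>?G\<^esub> Q p q) p q \<bullet> ?v" for p q
      unfolding hF[symmetric]
      by (rule mult_z_minus_w_hom(2)[OF G.abelian_group_axioms H.abelian_group_axioms, of "\<lambda>x. x \<bullet> ?v", symmetric])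
        (use Comp_Hom[OF vH] Comp_HAdd_left[OF vH] G.minus_closed PQ in auto)
    then have "(mult_z_minus_w ?H ^^ K) (\<lambda>p q. F (e (- q - 1) (- p - 1))) p q = HZero C ?S' V" for p q
      unfolding K[OF KK] using precomp_additive(1)[OF vH V_Obj] by simp
    then have "lin ?H F ((sg t - sg s) ^ K * sg (e (- q - 1) (- p - 1))) = HZero C ?S' V" for p q
      using H.mult_z_minus_w_funpow[of F t "\<lambda>p q. e (- q - 1) (- p - 1)" s K p q] FH s t by simp
    from this[of "- i - 1" "- j - 1"]
    have z: "lin ?H F ((sg t - sg s) ^ K * sg (e i j)) = HZero C ?S' V" by simp
    have eq: "lin ?H \<Phi> f = lin ?H \<Psi> f" if "lin ?H F f = HZero C ?S' V" for f
    proof (rule H.eq_of_diff_zero[OF H.lin_closed[of \<Phi>, OF PhH] H.lin_closed[of \<Psi>, OF PsH]])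
      show "lin ?H \<Phi> f \<ominus>\<^bsub>?H\<^esub> lin ?H \<Psi> f = \<zero>\<^bsub>?H\<^esub>"
        using H.lin_fun_diff[of \<Phi> \<Psi> f, OF PhH PsH] that unfolding F_def by simp
    qed
    have "(sg s - sg t) ^ K = (- 1) ^ K * (sg t - sg s) ^ K"
      by (simp flip: power_mult_distrib)
    then have "(sg s - sg t) ^ K * sg (e i j) = (if even K then (sg t - sg s) ^ K * sg (e i j) else - ((sg t - sg s) ^ K * sg (e i j)))"
      by simp
    then have "lin ?H F ((sg s - sg t) ^ K * sg (e i j)) = HZero C ?S' V"
      using z H.lin_uminus[of F "(sg t - sg s) ^ K * sg (e i j)"] FH H.neg_zero by auto
    then show "lin ?H \<Phi> ((sg s - sg t) ^ K * sg (e i j)) = lin ?H \<Psi> ((sg s - sg t) ^ K * sg (e i j)) \<and>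
      lin ?H \<Phi> ((sg t - sg s) ^ K * sg (e i j)) = lin ?H \<Psi> ((sg t - sg s) ^ K * sg (e i j))"
      using eq z by blast
  qed
  then show ?thesis by blast
qed

end

lemma (in abelian_group) add_pow_diff:
  assumes "x \<in> carrier G" "y \<in> carrier G"
  shows "add_pow G (c :: int) (x \<ominus> y) = add_pow G c x \<ominus> add_pow G c y"
  by (rule additive_map(3)[OF abelian_group_axioms abelian_group_axioms])
    (use assms in \<open>simp_all add: add.int_pow_distrib\<close>)

lemma (in abelian_group) add_pow_diff_zero:
  assumes "x \<in> carrier G" "y \<in> carrier G" "add_pow G (c :: int) x = add_pow G c y"
  shows "add_pow G c (x \<ominus> y) = \<zero>"
  using assms by (simp add: add_pow_diff) (simp add: minus_eq r_neg)

context compact_vertex_algebra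
begin

section \<open>Vacuum and translation in terms of modes\<close>

lemma md_vac_nonneg:
  assumes f: "f \<in> Hom C X V" and n: "0 \<le> n"
  shows "md n f vac = HZero C (X \<boxtimes>\<^sub>o Unit C) V"
proof -
  note [simp] = HomD[OF f] Hom_Obj(1)[OF f] arr Mode_arr vac_arr V_Obj Comp_assoc_arr Comp_Ident_arr Ident_Comp_arr
  have "Mode A n \<bullet> (Ident C V \<boxtimes> vac) = HZero C (V \<boxtimes>\<^sub>o Unit C) V"
    using vertex_algebra.vacuum_right[OF va, of "- n - 1"] n by (simp add: Y_coeff_def)
  moreover have "md n f vac = (Mode A n \<bullet> (Ident C V \<boxtimes> vac)) \<bullet> (f \<boxtimes> Ident C (Unit C))"
    by (simp add: md_def interchange)
  ultimately show ?thesis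
    using precomp_additive(1)[OF TenA_Hom[OF f Ident_Hom[OF Unit_Obj]] V_Obj] by simp
qed

lemma md_vac_minus_one:
  assumes f: "f \<in> Hom C X V"
  shows "md (- 1) f vac = f \<bullet> RUnit C X"
proof -
  note [simp] = HomD[OF f] Hom_Obj(1)[OF f] arr Mode_arr vac_arr V_Obj Comp_assoc_arr Comp_Ident_arr Ident_Comp_arr
  have "Mode A (- 1) \<bullet> (Ident C V \<boxtimes> vac) = RUnit C V"
    using vertex_algebra.vacuum_right_0[OF va] by (simp add: Y_coeff_def)
  moreover have "md (- 1) f vac = (Mode A (- 1) \<bullet> (Ident C V \<boxtimes> vac)) \<bullet> (f \<boxtimes> Ident C (Unit C))"
    by (simp add: md_def interchange)
  ultimately show ?thesis by (simp add: RUnit_nat)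
qed

lemma T_md:
  assumes f: "f \<in> Hom C X V" and g: "g \<in> Hom C Z V"
  shows "Trans A \<bullet> md n f g
    = HAdd C (add_pow (HomG C (X \<boxtimes>\<^sub>o Z) V) (- n) (md (n - 1) f g)) (md n f (Trans A \<bullet> g))"
proof -
  note [simp] = HomD[OF f] HomD[OF g] Hom_Obj(1)[OF f] Hom_Obj(1)[OF g] arr Mode_arr T_arr V_Obj
    Comp_assoc_arr Comp_Ident_arr Ident_Comp_arr
  let ?G = "HomG C (V \<boxtimes>\<^sub>o V) V"
  interpret G: abelian_group ?G by (rule HomG_group) simp_all
  have M: "Mode A k \<in> Hom C (V \<boxtimes>\<^sub>o V) V" for k by (intro HomI) simp_all
  have TM: "Trans A \<bullet> Mode A n \<in> Hom C (V \<boxtimes>\<^sub>o V) V" "Mode A n \<bullet> (Ident C V \<boxtimes> Trans A) \<in> Hom C (V \<boxtimes>\<^sub>o V) V"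
    by (auto intro!: HomI)
  have P: "add_pow ?G (- n) (Mode A (n - 1)) \<in> Hom C (V \<boxtimes>\<^sub>o V) V"
    using G.int_scale_closed[of "Mode A (n - 1)" "- n"] M by simp
  \<comment> \<open>The translation axiom at the exponent -n-1: the derivative contributes the
    factor -n and the coefficient of z^(-n), which is the mode n - 1.\<close>
  have ax: "(Trans A \<bullet> Mode A n) \<ominus>\<^bsub>?G\<^esub> (Mode A n \<bullet> (Ident C V \<boxtimes> Trans A)) = add_pow ?G (- n) (Mode A (n - 1))"
    using fun_cong[OF vertex_algebra.translation[OF va], of "- n - 1"] by (simp add: fd_deriv_def Y_coeff_def)
  have "add_pow ?G (- n) (Mode A (n - 1)) \<oplus>\<^bsub>?G\<^esub> (Mode A n \<bullet> (Ident C V \<boxtimes> Trans A)) = Trans A \<bullet> Mode A n"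
    by (rule G.add_cancel[OF _ _ _ ax[symmetric]]) (simp_all only: HomG_simps TM P)
  then have TMn: "Trans A \<bullet> Mode A n = HAdd C (add_pow ?G (- n) (Mode A (n - 1))) (Mode A n \<bullet> (Ident C V \<boxtimes> Trans A))"
    by (simp only: HomG_simps)
  have fg: "f \<boxtimes> g \<in> Hom C (X \<boxtimes>\<^sub>o Z) (V \<boxtimes>\<^sub>o V)" using f g by (rule TenA_Hom)
  have "Trans A \<bullet> md n f g = (Trans A \<bullet> Mode A n) \<bullet> (f \<boxtimes> g)" by (simp add: md_def)
  also have "\<dots> = HAdd C (add_pow ?G (- n) (Mode A (n - 1)) \<bullet> (f \<boxtimes> g)) ((Mode A n \<bullet> (Ident C V \<boxtimes> Trans A)) \<bullet> (f \<boxtimes> g))"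
    unfolding TMn by (rule Comp_HAdd_left[OF fg P TM(2)])
  also have "add_pow ?G (- n) (Mode A (n - 1)) \<bullet> (f \<boxtimes> g) = add_pow (HomG C (X \<boxtimes>\<^sub>o Z) V) (- n) (md (n - 1) f g)"
    unfolding md_def by (rule precomp_additive(2)[OF fg V_Obj M])
  also have "(Mode A n \<bullet> (Ident C V \<boxtimes> Trans A)) \<bullet> (f \<boxtimes> g) = md n f (Trans A \<bullet> g)"
    by (simp add: md_def interchange)
  finally show ?thesis .
qed

lemma T_md_vac:
  assumes f: "f \<in> Hom C X V"
  shows "Trans A \<bullet> md n f vac = add_pow (HomG C (X \<boxtimes>\<^sub>o Unit C) V) (- n) (md (n - 1) f vac)"
proof -
  have v: "vac \<in> Hom C (Unit C) V" using vac_arr by (intro HomI)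
  interpret H: abelian_group "HomG C (X \<boxtimes>\<^sub>o Unit C) V"
    by (rule HomG_group) (use Hom_Obj[OF f] V_Obj in \<open>simp_all add: arr\<close>)
  have "md n f (Trans A \<bullet> vac) = HZero C (X \<boxtimes>\<^sub>o Unit C) V"
    using md_additive(1)[OF f Unit_Obj] vertex_algebra.translation_vacuum[OF va] by simp
  then show ?thesis
    using T_md[OF f v, of n] H.r_zero[OF H.int_scale_closed[of "md (n - 1) f vac" "- n"]] md_Hom[OF f v] by simp
qed

section \<open>The l-th product of two fields applied to the vacuum\<close>

context
  fixes X X' \<alpha> \<beta> and l :: int and \<Psi> :: "int \<times> int \<times> int \<Rightarrow> 'a"
  assumes a: "\<alpha> \<in> Hom C X V" and b: "\<beta> \<in> Hom C X' V"
  defines "\<Psi> \<equiv> \<lambda>(p, q, r). md p \<alpha> (md q \<beta> vac) \<bullet> Assoc C X X' (Unit C)"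
begin

private abbreviation (input) "H \<equiv> HomG C ((X \<boxtimes>\<^sub>o X') \<boxtimes>\<^sub>o Unit C) V"

lemma vac_Hom: "vac \<in> Hom C (Unit C) V"
  using vac_arr by (intro HomI)

lemma Psi_Hom [simp]: "\<Psi> i \<in> Hom C ((X \<boxtimes>\<^sub>o X') \<boxtimes>\<^sub>o Unit C) V"
  unfolding \<Psi>_def
  using Comp_Hom[OF is_iso_Hom[OF Assoc_iso[OF Hom_Obj(1)[OF a] Hom_Obj(1)[OF b] Unit_Obj]]
      md_Hom[OF a md_Hom[OF b vac_Hom]]] by (cases i) simp

lemma Psi_zero: "0 \<le> q \<Longrightarrow> \<Psi> (p, q, r) = HZero C ((X \<boxtimes>\<^sub>o X') \<boxtimes>\<^sub>o Unit C) V"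
  unfolding \<Psi>_def
  using md_vac_nonneg[OF b, of q] md_additive(1)[OF a Ten_Obj[OF Hom_Obj(1)[OF b] Unit_Obj], of p]
    precomp_additive(1)[OF is_iso_Hom[OF Assoc_iso[OF Hom_Obj(1)[OF a] Hom_Obj(1)[OF b] Unit_Obj]] V_Obj]
  by simp

interpretation H: abelian_group "HomG C ((X \<boxtimes>\<^sub>o X') \<boxtimes>\<^sub>o Unit C) V"
  using HomG_ab[OF Psi_Hom] .

lemma Psi_carrier [simp]: "\<Psi> i \<in> carrier (HomG C ((X \<boxtimes>\<^sub>o X') \<boxtimes>\<^sub>o Unit C) V)"
  using Psi_Hom by simp

lemma lin_Psi_Hom [simp]: "lin (HomG C ((X \<boxtimes>\<^sub>o X') \<boxtimes>\<^sub>o Unit C) V) \<Psi> f \<in> Hom C ((X \<boxtimes>\<^sub>o X') \<boxtimes>\<^sub>o Unit C) V"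
  using H.lin_closed[of \<Psi> f, OF Psi_carrier] by simp

lemma scale_Psi_Hom [simp]:
  "add_pow (HomG C ((X \<boxtimes>\<^sub>o X') \<boxtimes>\<^sub>o Unit C) V) (c :: int) (\<Psi> i) \<in> Hom C ((X \<boxtimes>\<^sub>o X') \<boxtimes>\<^sub>o Unit C) V"
  using H.int_scale_closed[OF Psi_carrier, of c i] by simp

text \<open>\<open>T\<close> differentiates each of the two fields and kills the vacuum, so on the
  functional it acts as -(d/dx + d/dy) on the argument.\<close>

lemma T_Psi:
  "Trans A \<bullet> \<Psi> (p, q, r) = lin H \<Psi> (Poly_Mapping.single (p - 1, q, r) (- p) + Poly_Mapping.single (p, q - 1, r) (- q))"
proof -
  let ?a = "Assoc C X X' (Unit C)"
  have aH: "?a \<in> Hom C ((X \<boxtimes>\<^sub>o X') \<boxtimes>\<^sub>o Unit C) (X \<boxtimes>\<^sub>o (X' \<boxtimes>\<^sub>o Unit C))"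
    by (rule is_iso_Hom[OF Assoc_iso[OF Hom_Obj(1)[OF a] Hom_Obj(1)[OF b] Unit_Obj]])
  have g: "md k \<beta> vac \<in> Hom C (X' \<boxtimes>\<^sub>o Unit C) V" for k by (rule md_Hom[OF b vac_Hom])
  note m = md_Hom[OF a g]
  let ?G = "HomG C (X \<boxtimes>\<^sub>o (X' \<boxtimes>\<^sub>o Unit C)) V"
  interpret G: abelian_group ?G using HomG_ab[OF m] .
  have TV: "Trans A \<in> Hom C V V" using T_arr by (intro HomI)
  have sc: "add_pow ?G c (md p \<alpha> (md q \<beta> vac)) \<in> Hom C (X \<boxtimes>\<^sub>o (X' \<boxtimes>\<^sub>o Unit C)) V" for c :: int and p q
    using G.int_scale_closed m by simp
  have "Trans A \<bullet> \<Psi> (p, q, r) = (Trans A \<bullet> md p \<alpha> (md q \<beta> vac)) \<bullet> ?a"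
    using Comp_assoc[OF aH m TV] by (simp add: \<Psi>_def)
  also have "Trans A \<bullet> md p \<alpha> (md q \<beta> vac)
    = HAdd C (add_pow ?G (- p) (md (p - 1) \<alpha> (md q \<beta> vac))) (add_pow ?G (- q) (md p \<alpha> (md (q - 1) \<beta> vac)))"
    unfolding T_md[OF a g] T_md_vac[OF b]
    using md_additive(2)[OF a Ten_Obj[OF Hom_Obj(1)[OF b] Unit_Obj] g, of p "- q" "q - 1"] by simp
  also have "\<dots> \<bullet> ?a = HAdd C (add_pow H (- p) (\<Psi> (p - 1, q, r))) (add_pow H (- q) (\<Psi> (p, q - 1, r)))"
    using Comp_HAdd_left[OF aH sc sc] precomp_additive(2)[OF aH V_Obj m] by (simp add: \<Psi>_def)
  finally show ?thesis by (simp add: H.lin_add H.lin_single)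
qed

private definition cf :: "nat \<Rightarrow> int" where "cf i = int_choose l i * (- 1) ^ i"

text \<open>The terms of the expansion of (x - y)^l y^(-j-1) with a negative y-exponent; the
  remaining ones vanish because \<beta> annihilates the vacuum there.\<close>

private definition E :: "nat \<Rightarrow> laurent" where
  "E j = (\<Sum>i<Suc j. Poly_Mapping.single (l - int i, int i - int j - 1, 0) (cf i))"

private lemma cf_absorb: "int (Suc i) * cf (Suc i) = cf i * (int i - l)"
proof -
  have "int (Suc i) * cf (Suc i) = - ((- 1) ^ i * (int (Suc i) * int_choose l (Suc i)))"
    by (simp add: cf_def del: of_nat_Suc)
  also have "\<dots> = cf i * (int i - l)"
    unfolding int_choose_absorb by (simp add: cf_def algebra_simps)
  finally show ?thesis .
qed

text \<open>Formally, -(d/dx + d/dy) kills (x - y)^l and turns y^(-j-1) into (j+1) y^(-j-2). On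
  coefficients, j+1 is split into (j+1-i) + i: the first part is the y-derivative, and by
  \<open>cf_absorb\<close> the second, shifted by one, is the x-derivative.\<close>

private lemma E_derivative:
  "(\<Sum>i<Suc j. of_int (cf i) * (Poly_Mapping.single (l - int i - 1, int i - int j - 1, 0) (- (l - int i))
     + Poly_Mapping.single (l - int i, int i - int j - 1 - 1, 0) (- (int i - int j - 1)))) = of_int (int (Suc j)) * E (Suc j)"
proof -
  let ?s = "\<lambda>i c. Poly_Mapping.single (l - int i, int i - int j - 2, 0) c :: laurent"
  have "of_int (int (Suc j)) * E (Suc j) = (\<Sum>i<Suc (Suc j). ?s i (int (Suc j) * cf i))"
    unfolding E_def sum_distrib_left single_as_of_int by (rule sum.cong) (simp_all add: algebra_simps)
  also have "\<dots> = (\<Sum>i<Suc (Suc j). ?s i ((int (Suc j) - int i) * cf i)) + (\<Sum>i<Suc (Suc j). ?s i (int i * cf i))"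
    by (simp only: flip: sum.distrib single_add) (simp add: algebra_simps)
  also have "(\<Sum>i<Suc (Suc j). ?s i ((int (Suc j) - int i) * cf i)) = (\<Sum>i<Suc j. ?s i (cf i * (- (int i - int j - 1))))"
    by (subst sum.lessThan_Suc) (simp add: algebra_simps)
  also have "(\<Sum>i<Suc (Suc j). ?s i (int i * cf i)) = (\<Sum>i<Suc j. Poly_Mapping.single (l - int i - 1, int i - int j - 1, 0) (cf i * (- (l - int i))))"
  proof -
    have "?s (Suc i) (int (Suc i) * cf (Suc i)) = Poly_Mapping.single (l - int i - 1, int i - int j - 1, 0) (cf i * (- (l - int i)))" for i
      unfolding cf_absorb by (simp add: algebra_simps)
    then have "(\<Sum>i<Suc j. ?s (Suc i) (int (Suc i) * cf (Suc i)))
      = (\<Sum>i<Suc j. Poly_Mapping.single (l - int i - 1, int i - int j - 1, 0) (cf i * (- (l - int i))))"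
      by (rule sum.cong[OF refl])
    moreover have "(\<Sum>i<Suc (Suc j). ?s i (int i * cf i)) = (\<Sum>i<Suc j. ?s (Suc i) (int (Suc i) * cf (Suc i)))"
      by (subst sum.lessThan_Suc_shift) simp
    ultimately show ?thesis by simp
  qed
  finally show ?thesis
    unfolding distrib_left single_as_of_int[symmetric] sum.distrib by (simp add: algebra_simps)
qed

private lemma T_lin_E: "Trans A \<bullet> lin H \<Psi> (E j) = add_pow H (int (Suc j)) (lin H \<Psi> (E (Suc j)))"
proof -
  define D :: "int \<times> int \<times> int \<Rightarrow> laurent" where
    "D = (\<lambda>(p, q, r). Poly_Mapping.single (p - 1, q, r) (- p) + Poly_Mapping.single (p, q - 1, r) (- q))"
  have TV: "Trans A \<in> Hom C V V" using T_arr by (intro HomI)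
  have TD: "Trans A \<bullet> \<Psi> i = lin H \<Psi> (D i)" for i
    using T_Psi by (cases i) (simp add: D_def)
  have "Trans A \<bullet> lin H \<Psi> (E j) = lin H (\<lambda>i. lin H \<Psi> (D i)) (E j)"
    using postcomp_additive(4)[OF TV Hom_Obj(1)[OF Psi_Hom] Psi_Hom] TD by simp
  also have "\<dots> = finsum H (\<lambda>i. add_pow H (cf i) (lin H \<Psi> (D (l - int i, int i - int j - 1, 0)))) {..<Suc j}"
    unfolding E_def by (subst H.lin_sum) (simp_all add: H.lin_single del: sum.lessThan_Suc)
  also have "\<dots> = lin H \<Psi> (\<Sum>i<Suc j. of_int (cf i) * D (l - int i, int i - int j - 1, 0))"
    by (subst H.lin_sum) (simp_all add: H.lin_of_int del: sum.lessThan_Suc)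
  also have "(\<Sum>i<Suc j. of_int (cf i) * D (l - int i, int i - int j - 1, 0)) = of_int (int (Suc j)) * E (Suc j)"
    unfolding D_def prod.case by (rule E_derivative)
  also have "lin H \<Psi> (of_int (int (Suc j)) * E (Suc j)) = add_pow H (int (Suc j)) (lin H \<Psi> (E (Suc j)))"
    by (rule H.lin_of_int) simp
  finally show ?thesis .
qed

private lemma md_vac_eq_E: "md (- int j - 1) (md l \<alpha> \<beta>) vac = lin H \<Psi> (E j)"
proof (induction j)
  case 0
  note [simp] = HomD[OF a] HomD[OF b] Hom_Obj(1)[OF a] Hom_Obj(1)[OF b] arr md_arr
    Comp_assoc_arr Comp_Ident_arr Ident_Comp_arr
  \<comment> \<open>Mode -1 on the vacuum returns an arrow up to the unit constraint.
    \<open>RUnit_tensor\<close> compares the constraint on the second factor with the one on the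
    whole tensor product.\<close>
  have "E 0 = mon l (- 1) 0" by (simp add: E_def cf_def)
  then have "lin H \<Psi> (E 0) = md l \<alpha> (\<beta> \<bullet> RUnit C X') \<bullet> Assoc C X X' (Unit C)"
    using H.lin_sg[of \<Psi>, OF Psi_carrier] md_vac_minus_one[OF b] by (simp add: \<Psi>_def)
  also have "\<dots> = md l \<alpha> \<beta> \<bullet> RUnit C (X \<boxtimes>\<^sub>o X')"
    using RUnit_tensor[of X X'] by (simp add: md_comp_right)
  finally show ?case using md_vac_minus_one[OF md_Hom[OF a b]] by simp
next
  case (Suc j)
  let ?u = "md l \<alpha> \<beta>"
  let ?x = "md (- int (Suc j) - 1) ?u vac" and ?y = "lin H \<Psi> (E (Suc j))"
  have uH: "?u \<in> Hom C (X \<boxtimes>\<^sub>o X') V" by (rule md_Hom[OF a b])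
  have xH: "?x \<in> carrier H" using md_Hom[OF uH vac_Hom] by simp
  have yH: "?y \<in> carrier H" by (rule H.lin_closed[OF Psi_carrier])
  have "add_pow H (int (Suc j)) ?x = Trans A \<bullet> md (- int j - 1) ?u vac"
    unfolding T_md_vac[OF uH] by (simp add: algebra_simps)
  also have "\<dots> = add_pow H (int (Suc j)) ?y" unfolding Suc by (rule T_lin_E)
  \<comment> \<open>The recursion (j+1) a_(j+1) = T a_j fixes the modes only up to torsion;
    \<open>torsion_free\<close> divides by \<open>Suc j\<close>.\<close>
  finally have "add_pow H (int (Suc j)) (?x \<ominus>\<^bsub>H\<^esub> ?y) = \<zero>\<^bsub>H\<^esub>"
    by (rule H.add_pow_diff_zero[OF xH yH])
  then have "?x \<ominus>\<^bsub>H\<^esub> ?y = \<zero>\<^bsub>H\<^esub>"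
    using torsion_free[OF H.minus_closed[OF xH yH, unfolded HomG_simps], of "Suc j"] by (simp only: HomG_simps)
  then show ?case by (rule H.eq_of_diff_zero[OF xH yH])
qed

text \<open>Terms of the expansion with y-exponent at least 0 vanish on the vacuum. So every cut at
  or beyond \<open>- q\<close> gives the same value.\<close>

lemma product_vacuum_expansion:
  assumes J: "- q \<le> int J"
  shows "md q (md l \<alpha> \<beta>) vac = lin H \<Psi> (expand_xy J l * mon 0 q r)"
proof (cases "0 \<le> q")
  case True
  have "lin H \<Psi> (expand_xy J l * mon 0 q r) = \<zero>\<^bsub>H\<^esub>"
  proof (rule H.lin_eq_zero)
    fix i assume i: "i \<in> Poly_Mapping.keys (expand_xy J l * mon 0 q r)"
    have "min_exp py (0 + q) (expand_xy J l * mon 0 q r)"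
      by (intro min_exp_mult expand_xy_min_exp) (simp_all add: min_exp_def)
    then show "\<Psi> i = \<zero>\<^bsub>H\<^esub>" using i True Psi_zero by (cases i) (auto simp: min_exp_def)
  qed simp
  then show ?thesis using md_vac_nonneg[OF md_Hom[OF a b] True] by simp
next
  case False
  define j where "j = nat (- q - 1)"
  have q: "q = - int j - 1" "Suc j \<le> J" using False J by (auto simp: j_def)
  have "lin H \<Psi> (expand_xy J l * mon 0 q r) = finsum H (\<lambda>i. add_pow H (cf i) (\<Psi> (l - int i, int i + q, r))) {..<J}"
    unfolding expand_xy_def sum_distrib_right
    by (subst H.lin_sum) (simp_all add: mult_single H.lin_single cf_def)
  also have "\<dots> = finsum H (\<lambda>i. add_pow H (cf i) (\<Psi> (l - int i, int i - int j - 1, 0))) {..<Suc j}"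
  proof (rule H.add.finprod_mono_neutral_cong_left[symmetric])
    fix i assume "i \<in> {..<J} - {..<Suc j}"
    then show "add_pow H (cf i) (\<Psi> (l - int i, int i + q, r)) = \<zero>\<^bsub>H\<^esub>"
      using Psi_zero[of "int i + q" "l - int i" r] q(1) H.add.int_pow_one[of "cf i"] by simp
  next
    show "add_pow H (cf i) (\<Psi> (l - int i, int i - int j - 1, 0)) = add_pow H (cf i) (\<Psi> (l - int i, int i + q, r))" for i
      unfolding q(1) \<Psi>_def by (simp add: algebra_simps)
  qed (use q in auto)
  also have "\<dots> = lin H \<Psi> (E j)"
    unfolding E_def by (subst H.lin_sum) (simp_all add: H.lin_single del: sum.lessThan_Suc)
  finally show ?thesis using md_vac_eq_E[of j] q(1) by simp
qed

end

end

section \<open>Coherence and additive operations\<close>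

context symmetric_monoidal
begin

lemma pentagon_assoc:
  assumes "W \<in> Obj C" "X \<in> Obj C" "Y \<in> Obj C" "Z \<in> Obj C"
    and "k \<in> Arr C" "Cod C k = ((W \<boxtimes>\<^sub>o X) \<boxtimes>\<^sub>o Y) \<boxtimes>\<^sub>o Z"
  shows "(Ident C W \<boxtimes> Assoc C X Y Z) \<bullet> Assoc C W (X \<boxtimes>\<^sub>o Y) Z \<bullet> (Assoc C W X Y \<boxtimes> Ident C Z) \<bullet> k
    = Assoc C W X (Y \<boxtimes>\<^sub>o Z) \<bullet> Assoc C (W \<boxtimes>\<^sub>o X) Y Z \<bullet> k"
proof -
  have "((Ident C W \<boxtimes> Assoc C X Y Z) \<bullet> Assoc C W (X \<boxtimes>\<^sub>o Y) Z \<bullet> (Assoc C W X Y \<boxtimes> Ident C Z)) \<bullet> k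
    = (Assoc C W X (Y \<boxtimes>\<^sub>o Z) \<bullet> Assoc C (W \<boxtimes>\<^sub>o X) Y Z) \<bullet> k"
    using assms by (simp only: pentagon)
  then show ?thesis using assms by (simp add: Comp_assoc_arr arr)
qed

text \<open>
  The isomorphisms that move the third factor past the first one and past both. All operations are
  pulled back to \<open>((Z \<otimes> X) \<otimes> Y) \<otimes> W\<close>, where one hexagon and the pentagon give every coherence
  that is needed and no inverse associator appears.
\<close>

context
  fixes X Y Z W
  assumes objs [simp]: "X \<in> Obj C" "Y \<in> Obj C" "Z \<in> Obj C" "W \<in> Obj C"
begin

definition rot :: 'a where
  "rot = Assoc C X (Z \<boxtimes>\<^sub>o Y) W \<bullet> (Assoc C X Z Y \<boxtimes> Ident C W) \<bullet> ((Braid C Z X \<boxtimes> Ident C Y) \<boxtimes> Ident C W)"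

definition cyc :: 'a where
  "cyc = Assoc C (X \<boxtimes>\<^sub>o Y) Z W \<bullet> (Braid C Z (X \<boxtimes>\<^sub>o Y) \<boxtimes> Ident C W) \<bullet> (Assoc C Z X Y \<boxtimes> Ident C W)"

lemma rot_arr: "rot \<in> Arr C" "Dom C rot = ((Z \<boxtimes>\<^sub>o X) \<boxtimes>\<^sub>o Y) \<boxtimes>\<^sub>o W"
  "Cod C rot = X \<boxtimes>\<^sub>o ((Z \<boxtimes>\<^sub>o Y) \<boxtimes>\<^sub>o W)"
  by (simp_all add: rot_def arr)

lemma cyc_arr: "cyc \<in> Arr C" "Dom C cyc = ((Z \<boxtimes>\<^sub>o X) \<boxtimes>\<^sub>o Y) \<boxtimes>\<^sub>o W"
  "Cod C cyc = (X \<boxtimes>\<^sub>o Y) \<boxtimes>\<^sub>o (Z \<boxtimes>\<^sub>o W)"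
  by (simp_all add: cyc_def arr)

text \<open>Naturality moves the braiding through the associator and the pentagon regroups. The left
  side is the form in which locality delivers the exchange of the two outer fields.\<close>

lemma rot_Braid:
  "Assoc C X Z (Y \<boxtimes>\<^sub>o W) \<bullet> (Braid C Z X \<boxtimes> Ident C (Y \<boxtimes>\<^sub>o W)) \<bullet> Assoc C (Z \<boxtimes>\<^sub>o X) Y W
    = (Ident C X \<boxtimes> Assoc C Z Y W) \<bullet> rot"
proof -
  have "Assoc C (X \<boxtimes>\<^sub>o Z) Y W \<bullet> ((Braid C Z X \<boxtimes> Ident C Y) \<boxtimes> Ident C W)
    = (Braid C Z X \<boxtimes> Ident C (Y \<boxtimes>\<^sub>o W)) \<bullet> Assoc C (Z \<boxtimes>\<^sub>o X) Y W"
    by (simp add: Assoc_nat arr TenA_Ident)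
  then show ?thesis
    unfolding rot_def by (subst pentagon_assoc) (simp_all add: arr)
qed

text \<open>The hexagon, tensored with \<open>W\<close>: passing \<open>X\<close> and then
  \<open>Y\<close> is passing \<open>X \<boxtimes>\<^sub>o Y\<close> at once. Naturality of the
  associator exposes the hexagon and the pentagon restores the bracketing.\<close>

lemma rot_cyc:
  "(Ident C X \<boxtimes> (Assoc C Y Z W \<bullet> (Braid C Z Y \<boxtimes> Ident C W))) \<bullet> rot = Assoc C X Y (Z \<boxtimes>\<^sub>o W) \<bullet> cyc"
proof -
  note [simp] = arr Comp_assoc_arr Comp_Ident_arr Ident_Comp_arr
  let ?i = "Ident C"
  have "(?i X \<boxtimes> (Assoc C Y Z W \<bullet> (Braid C Z Y \<boxtimes> ?i W))) \<bullet> rot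
    = (?i X \<boxtimes> Assoc C Y Z W) \<bullet> (?i X \<boxtimes> (Braid C Z Y \<boxtimes> ?i W)) \<bullet> rot"
    by (simp add: interchange_assoc rot_arr)
  also have "(?i X \<boxtimes> (Braid C Z Y \<boxtimes> ?i W)) \<bullet> rot
    = Assoc C X (Y \<boxtimes>\<^sub>o Z) W \<bullet> ((?i X \<boxtimes> Braid C Z Y) \<boxtimes> ?i W) \<bullet> (Assoc C X Z Y \<boxtimes> ?i W) \<bullet> ((Braid C Z X \<boxtimes> ?i Y) \<boxtimes> ?i W)"
    by (simp add: Assoc_nat_assoc rot_def)
  also have "((?i X \<boxtimes> Braid C Z Y) \<boxtimes> ?i W) \<bullet> (Assoc C X Z Y \<boxtimes> ?i W) \<bullet> ((Braid C Z X \<boxtimes> ?i Y) \<boxtimes> ?i W)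
    = ((?i X \<boxtimes> Braid C Z Y) \<bullet> Assoc C X Z Y \<bullet> (Braid C Z X \<boxtimes> ?i Y)) \<boxtimes> ?i W"
    by (simp add: interchange)
  also have "\<dots> = (Assoc C X Y Z \<bullet> Braid C Z (X \<boxtimes>\<^sub>o Y) \<bullet> Assoc C Z X Y) \<boxtimes> ?i W"
    by (simp add: hexagon)
  also have "\<dots> = (Assoc C X Y Z \<boxtimes> ?i W) \<bullet> (Braid C Z (X \<boxtimes>\<^sub>o Y) \<boxtimes> ?i W) \<bullet> (Assoc C Z X Y \<boxtimes> ?i W)"
    by (simp add: interchange)
  also have "(?i X \<boxtimes> Assoc C Y Z W) \<bullet> Assoc C X (Y \<boxtimes>\<^sub>o Z) W \<bullet> \<dots> = Assoc C X Y (Z \<boxtimes>\<^sub>o W) \<bullet> cyc"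
    by (simp add: pentagon_assoc cyc_def)
  finally show ?thesis .
qed

text \<open>Makes \<open>cyc\<close> cancellable on the right, so that an identity found on the
  common source descends.\<close>

lemma cyc_right_inverse: "\<exists>e. e \<in> Arr C \<and> Dom C e = Cod C cyc \<and> Cod C e = Dom C cyc \<and> cyc \<bullet> e = Ident C (Cod C cyc)"
proof -
  note [simp] = arr Comp_assoc_arr Comp_Ident_arr Ident_Comp_arr
  have XY: "X \<boxtimes>\<^sub>o Y \<in> Obj C" by simp
  obtain a where a: "a \<in> Arr C" "Dom C a = (X \<boxtimes>\<^sub>o Y) \<boxtimes>\<^sub>o (Z \<boxtimes>\<^sub>o W)" "Cod C a = ((X \<boxtimes>\<^sub>o Y) \<boxtimes>\<^sub>o Z) \<boxtimes>\<^sub>o W"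
    "Assoc C (X \<boxtimes>\<^sub>o Y) Z W \<bullet> a = Ident C ((X \<boxtimes>\<^sub>o Y) \<boxtimes>\<^sub>o (Z \<boxtimes>\<^sub>o W))"
    using Assoc_iso[OF XY objs(3,4)] by (rule iso_inverse)
  obtain b where b: "b \<in> Arr C" "Dom C b = Z \<boxtimes>\<^sub>o (X \<boxtimes>\<^sub>o Y)" "Cod C b = (Z \<boxtimes>\<^sub>o X) \<boxtimes>\<^sub>o Y"
    "Assoc C Z X Y \<bullet> b = Ident C (Z \<boxtimes>\<^sub>o (X \<boxtimes>\<^sub>o Y))"
    using Assoc_iso[OF objs(3,1,2)] by (rule iso_inverse)
  let ?e = "((b \<bullet> Braid C (X \<boxtimes>\<^sub>o Y) Z) \<boxtimes> Ident C W) \<bullet> a"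
  have "Assoc C Z X Y \<bullet> b \<bullet> Braid C (X \<boxtimes>\<^sub>o Y) Z = (Assoc C Z X Y \<bullet> b) \<bullet> Braid C (X \<boxtimes>\<^sub>o Y) Z"
    using b(1-3) by simp
  then have ab: "Assoc C Z X Y \<bullet> b \<bullet> Braid C (X \<boxtimes>\<^sub>o Y) Z = Braid C (X \<boxtimes>\<^sub>o Y) Z"
    unfolding b(4) by simp
  have "cyc \<bullet> ?e = Assoc C (X \<boxtimes>\<^sub>o Y) Z W \<bullet> ((Braid C Z (X \<boxtimes>\<^sub>o Y) \<bullet> Assoc C Z X Y \<bullet> b \<bullet> Braid C (X \<boxtimes>\<^sub>o Y) Z) \<boxtimes> Ident C W) \<bullet> a"
    using a(1-3) b(1-3) by (simp add: cyc_def interchange_assoc)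
  also have "\<dots> = Ident C (Cod C cyc)"
    unfolding ab using a by (simp add: Braid_symmetric TenA_Ident cyc_arr)
  finally show ?thesis
    using a(1-3) b(1-3) by (intro exI[of _ ?e]) (simp add: cyc_arr)
qed

end

end

text \<open>The variable that does not occur in a locality factor keeps its exponent, so the mode
  belonging to it can be frozen while the other two are exchanged.\<close>

lemma keys_difference_power:
  fixes s t k :: "int \<times> int \<times> int"
  assumes "\<And>i j. \<phi> (i + j) = \<phi> i + \<phi> j" "\<phi> s = (0 :: int)" "\<phi> t = 0"
    and "i \<in> Poly_Mapping.keys ((sg s - sg t) ^ K * sg k)"
  shows "\<phi> i = \<phi> k"
  using assms(4)
proof (induction K arbitrary: i)
  case 0 then show ?case by simp
next
  case (Suc K)
  have "i \<in> Poly_Mapping.keys ((sg s - sg t) * ((sg s - sg t) ^ K * sg k))"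
    using Suc.prems by (simp add: mult.assoc)
  then obtain a b where ab: "i = a + b" "a \<in> Poly_Mapping.keys (sg s - sg t)"
    "b \<in> Poly_Mapping.keys ((sg s - sg t) ^ K * sg k)"
    using keys_mult by blast
  then have "a \<in> {s, t}" using keys_diff[of "sg s" "sg t"] by auto
  then show ?case using assms(1-3) ab(1) Suc.IH[OF ab(3)] by auto
qed

lemma keys_expand:
  "i \<in> Poly_Mapping.keys (expand_xy J l * mon p q r) \<Longrightarrow> pz i = r"
  "i \<in> Poly_Mapping.keys (expand_yx J l * mon p q r) \<Longrightarrow> pz i = r"
  unfolding expand_xy_def expand_yx_def sum_distrib_right mult_single
  using keys_sum by (fastforce split: if_splits)+

section \<open>Transport of locality into longer words\<close>

context compact_vertex_algebra
begin

text \<open>Describes whatever surrounds an exchanged pair of fields: an outer mode, a coherence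
  arrow, or a composite of these.\<close>

definition additive_op :: "'o \<Rightarrow> 'o \<Rightarrow> ('a \<Rightarrow> 'a) \<Rightarrow> bool" where
  "additive_op S B h \<longleftrightarrow> S \<in> Obj C \<and> B \<in> Obj C \<and> (\<forall>x\<in>Hom C S V. h x \<in> Hom C B V) \<and> h (HZero C S V) = HZero C B V \<and>
    (\<forall>(F :: int \<times> int \<times> int \<Rightarrow> 'a) P. (\<forall>i. F i \<in> Hom C S V) \<longrightarrow>
       h (lin (HomG C S V) F P) = lin (HomG C B V) (\<lambda>i. h (F i)) P)"

lemma additive_opD:
  assumes "additive_op S B h"
  shows "S \<in> Obj C" "B \<in> Obj C" "\<And>x. x \<in> Hom C S V \<Longrightarrow> h x \<in> Hom C B V" "h (HZero C S V) = HZero C B V"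
    "\<And>(F :: int \<times> int \<times> int \<Rightarrow> 'a) P. (\<And>i. F i \<in> Hom C S V) \<Longrightarrow>
       h (lin (HomG C S V) F P) = lin (HomG C B V) (\<lambda>i. h (F i)) P"
  using assms by (simp_all only: additive_op_def) simp

lemma additive_op_precomp:
  assumes e: "e \<in> Hom C B S"
  shows "additive_op S B (\<lambda>x. x \<bullet> e)"
  unfolding additive_op_def
proof (intro conjI ballI allI impI)
  show "S \<in> Obj C" "B \<in> Obj C" using Hom_Obj[OF e] by simp_all
  show "x \<bullet> e \<in> Hom C B V" if "x \<in> Hom C S V" for x using e that by (rule Comp_Hom)
  show "HZero C S V \<bullet> e = HZero C B V" by (rule precomp_additive(1)[OF e V_Obj])
  fix F :: "int \<times> int \<times> int \<Rightarrow> 'a" and P assume "\<forall>i. F i \<in> Hom C S V"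
  then show "lin (HomG C S V) F P \<bullet> e = lin (HomG C B V) (\<lambda>i. F i \<bullet> e) P"
    by (intro precomp_additive(4)[OF e V_Obj]) blast
qed

lemma additive_op_md:
  assumes f: "f \<in> Hom C X V" and S: "S \<in> Obj C"
  shows "additive_op S (X \<boxtimes>\<^sub>o S) (md n f)"
  unfolding additive_op_def
proof (intro conjI ballI allI impI)
  show "S \<in> Obj C" by fact
  show "X \<boxtimes>\<^sub>o S \<in> Obj C" using Hom_Obj(1)[OF f] S by (rule Ten_Obj)
  show "md n f x \<in> Hom C (X \<boxtimes>\<^sub>o S) V" if "x \<in> Hom C S V" for x using f that by (rule md_Hom)
  show "md n f (HZero C S V) = HZero C (X \<boxtimes>\<^sub>o S) V" by (rule md_additive(1)[OF f S])
  fix F :: "int \<times> int \<times> int \<Rightarrow> 'a" and P assume "\<forall>i. F i \<in> Hom C S V"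
  then show "md n f (lin (HomG C S V) F P) = lin (HomG C (X \<boxtimes>\<^sub>o S) V) (\<lambda>i. md n f (F i)) P"
    by (intro md_additive(3)[OF f S]) blast
qed

lemma additive_op_comp:
  assumes g: "additive_op S B g" and h: "additive_op B D h"
  shows "additive_op S D (\<lambda>x. h (g x))"
  unfolding additive_op_def
proof (intro conjI ballI allI impI)
  show "S \<in> Obj C" "D \<in> Obj C" using additive_opD(1)[OF g] additive_opD(2)[OF h] .
  show "h (g x) \<in> Hom C D V" if "x \<in> Hom C S V" for x
    by (rule additive_opD(3)[OF h additive_opD(3)[OF g that]])
  show "h (g (HZero C S V)) = HZero C D V" using additive_opD(4)[OF g] additive_opD(4)[OF h] by simp
  fix F :: "int \<times> int \<times> int \<Rightarrow> 'a" and P assume "\<forall>i. F i \<in> Hom C S V"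
  then have F: "F i \<in> Hom C S V" for i by blast
  show "h (g (lin (HomG C S V) F P)) = lin (HomG C D V) (\<lambda>i. h (g (F i))) P"
    unfolding additive_opD(5)[of S B g F P, OF g F]
    by (rule additive_opD(5)[of B D h "\<lambda>i. g (F i)" P, OF h additive_opD(3)[OF g F]])
qed

lemma additive_op_transfer:
  fixes F \<Phi> :: "int \<times> int \<times> int \<Rightarrow> 'a"
  assumes h: "additive_op S B h" and \<Phi>: "\<And>i. \<Phi> i \<in> Hom C S V" and F: "\<And>i. F i \<in> Hom C B V"
    and eq: "\<And>i. i \<in> Poly_Mapping.keys P \<Longrightarrow> F i = h (\<Phi> i)"
  shows "lin (HomG C B V) F P = h (lin (HomG C S V) \<Phi> P)"
proof -
  interpret B: abelian_group "HomG C B V" using HomG_ab[OF F] .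
  have h\<Phi>: "h (\<Phi> i) \<in> carrier (HomG C B V)" for i
    using additive_opD(3)[OF h \<Phi>] by simp
  have "lin (HomG C B V) F P = lin (HomG C B V) (\<lambda>i. h (\<Phi> i)) P"
    by (rule B.lin_cong) (use F h\<Phi> eq in \<open>simp_all only: HomG_simps\<close>)
  also have "\<dots> = h (lin (HomG C S V) \<Phi> P)"
    by (rule additive_opD(5)[of S B h \<Phi> P, OF h \<Phi>, symmetric])
  finally show ?thesis .
qed

lemma local_pair_transfer:
  fixes s t :: "int \<times> int \<times> int" and F F' \<Phi> \<Psi> :: "int \<times> int \<times> int \<Rightarrow> 'a"
  assumes loc: "local_pair K X X' \<alpha> \<beta>" and v: "v \<in> Hom C Z V"
    and e: "\<And>i j. s + e i j = e (i + 1) j" "\<And>i j. t + e i j = e i (j + 1)"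
    and h: "additive_op ((X \<boxtimes>\<^sub>o X') \<boxtimes>\<^sub>o Z) B h"
    and \<Phi>: "\<And>k. \<Phi> k \<in> Hom C ((X \<boxtimes>\<^sub>o X') \<boxtimes>\<^sub>o Z) V" "\<And>i j. \<Phi> (e i j) = md i \<alpha> (md j \<beta> v) \<bullet> Assoc C X X' Z"
    and \<Psi>: "\<And>k. \<Psi> k \<in> Hom C ((X \<boxtimes>\<^sub>o X') \<boxtimes>\<^sub>o Z) V"
      "\<And>i j. \<Psi> (e i j) = md j \<beta> (md i \<alpha> v) \<bullet> Assoc C X' X Z \<bullet> (Braid C X X' \<boxtimes> Ident C Z)"
    and F: "\<And>k. F k \<in> Hom C B V" "\<And>k. F' k \<in> Hom C B V"
    and D: "D = sg s - sg t \<or> D = sg t - sg s"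
    and eq: "\<And>k. k \<in> Poly_Mapping.keys (D ^ K * sg (e i j)) \<Longrightarrow> F k = h (\<Phi> k) \<and> F' k = h (\<Psi> k)"
  shows "lin (HomG C B V) F (D ^ K * sg (e i j)) = lin (HomG C B V) F' (D ^ K * sg (e i j))"
proof -
  let ?H = "HomG C ((X \<boxtimes>\<^sub>o X') \<boxtimes>\<^sub>o Z) V"
  have "lin ?H \<Phi> (D ^ K * sg (e i j)) = lin ?H \<Psi> (D ^ K * sg (e i j))"
    using loc[unfolded local_pair_def, rule_format, of v Z s e t \<Phi> \<Psi> i j] v e \<Phi> \<Psi> D by auto
  then show ?thesis
    using additive_op_transfer[OF h \<Phi>(1) F(1)] additive_op_transfer[OF h \<Psi>(1) F(2)] eq by simp
qed

end

section \<open>The Borcherds identity\<close>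

lemma (in abelian_group) finsum_diff:
  assumes "finite I" and [simp]: "\<And>i. f i \<in> carrier G" "\<And>i. g i \<in> carrier G"
  shows "finsum G (\<lambda>i. f i \<ominus> g i) I = finsum G f I \<ominus> finsum G g I"
  using assms(1) by (induction I rule: finite_induct) (simp_all add: Pi_def diff_add_diff, simp add: minus_eq)

context compact_vertex_algebra
begin

lemma md_left_zero:
  assumes h: "h \<in> Hom C Z V" and X: "X \<in> Obj C"
  shows "md n (HZero C X V) h = HZero C (X \<boxtimes>\<^sub>o Z) V"
  unfolding md_def tensor_right_additive(1)[OF h X V_Obj]
  by (rule postcomp_additive(1)[OF vertex_algebra.Mode_Hom[OF va] Ten_Obj[OF X Hom_Obj(1)[OF h]]])

section \<open>Words in the three fields on a common source\<close>

context
  fixes X1 X2 X3 :: 'o and \<alpha> \<beta> \<gamma> :: 'a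
  assumes a: "\<alpha> \<in> Hom C X1 V" and b: "\<beta> \<in> Hom C X2 V" and g: "\<gamma> \<in> Hom C X3 V"
begin

private abbreviation (input) "I \<equiv> Unit C"
private abbreviation (input) "B \<equiv> ((X3 \<boxtimes>\<^sub>o X1) \<boxtimes>\<^sub>o X2) \<boxtimes>\<^sub>o Unit C"
private abbreviation (input) "G \<equiv> HomG C (((X3 \<boxtimes>\<^sub>o X1) \<boxtimes>\<^sub>o X2) \<boxtimes>\<^sub>o Unit C) V"

lemma objs: "X1 \<in> Obj C" "X2 \<in> Obj C" "X3 \<in> Obj C"
  using Hom_Obj[OF a] Hom_Obj[OF b] Hom_Obj[OF g] by simp_all

lemmas typing = objs HomD[OF a] HomD[OF b] HomD[OF g] V_Obj arr md_arr vac_arr Comp_assoc_arr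
  cyc_arr[OF objs Unit_Obj] rot_arr[OF objs Unit_Obj]

text \<open>The regrouping for words with \<gamma> outermost; the common source already lists
  \<open>X3\<close> first, so no braiding enters.\<close>

private definition "ta = Assoc C X3 (X1 \<boxtimes>\<^sub>o X2) I \<bullet> (Assoc C X3 X1 X2 \<boxtimes> Ident C I)"
private abbreviation (input) "th \<equiv> cyc X1 X2 X3 (Unit C)"
private abbreviation (input) "ro \<equiv> rot X1 X2 X3 (Unit C)"

private lemma ta_arr: "ta \<in> Arr C" "Dom C ta = B" "Cod C ta = X3 \<boxtimes>\<^sub>o ((X1 \<boxtimes>\<^sub>o X2) \<boxtimes>\<^sub>o I)"
  by (simp_all add: ta_def typing)

text \<open>
  Exponents \<open>(p, q, r)\<close> are the modes of \<open>\<alpha>\<close>, \<open>\<beta>\<close> and \<open>\<gamma>\<close>; the names list the order in which the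
  modes are composed, the rightmost being applied to the vacuum first.
\<close>

private definition "abc i = md (px i) \<alpha> (md (py i) \<beta> (md (pz i) \<gamma> vac)) \<bullet> Assoc C X1 X2 (X3 \<boxtimes>\<^sub>o I) \<bullet> th"
private definition "bac i = md (py i) \<beta> (md (px i) \<alpha> (md (pz i) \<gamma> vac)) \<bullet> Assoc C X2 X1 (X3 \<boxtimes>\<^sub>o I)
    \<bullet> (Braid C X1 X2 \<boxtimes> Ident C (X3 \<boxtimes>\<^sub>o I)) \<bullet> th"
private definition "acb i = md (px i) \<alpha> (md (pz i) \<gamma> (md (py i) \<beta> vac) \<bullet> Assoc C X3 X2 I) \<bullet> ro"
private definition "cab i = md (pz i) \<gamma> (md (px i) \<alpha> (md (py i) \<beta> vac) \<bullet> Assoc C X1 X2 I) \<bullet> ta"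
private definition "uc l i = md (py i) (md l \<alpha> \<beta>) (md (pz i) \<gamma> vac) \<bullet> th"
private definition "cu l i = md (pz i) \<gamma> (md (py i) (md l \<alpha> \<beta>) vac) \<bullet> ta"

private lemma op_Homs: "abc i \<in> Hom C B V" "bac i \<in> Hom C B V" "acb i \<in> Hom C B V" "cab i \<in> Hom C B V"
    "uc l i \<in> Hom C B V" "cu l i \<in> Hom C B V"
  by (intro HomI; simp add: abc_def bac_def acb_def cab_def uc_def cu_def typing ta_arr)+

private lemma G_ab: "abelian_group G"
  using HomG_ab[OF op_Homs(1)] .

interpretation G: abelian_group "HomG C (((X3 \<boxtimes>\<^sub>o X1) \<boxtimes>\<^sub>o X2) \<boxtimes>\<^sub>o Unit C) V"
  by (rule G_ab)

private lemma op_carrier: "abc i \<in> carrier G" "bac i \<in> carrier G" "acb i \<in> carrier G" "cab i \<in> carrier G"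
    "uc l i \<in> carrier G" "cu l i \<in> carrier G"
  using op_Homs by simp_all

private lemma vec_Hom: "md r \<gamma> vac \<in> Hom C (X3 \<boxtimes>\<^sub>o I) V" "md q \<beta> vac \<in> Hom C (X2 \<boxtimes>\<^sub>o I) V"
    "md p \<alpha> vac \<in> Hom C (X1 \<boxtimes>\<^sub>o I) V" "vac \<in> Hom C I V"
  by (intro HomI; simp add: typing)+

private lemma th_Hom: "th \<in> Hom C B ((X1 \<boxtimes>\<^sub>o X2) \<boxtimes>\<^sub>o (X3 \<boxtimes>\<^sub>o I))"
  by (intro HomI; simp add: typing)

private lemma op_abc: "additive_op ((X1 \<boxtimes>\<^sub>o X2) \<boxtimes>\<^sub>o (X3 \<boxtimes>\<^sub>o I)) B (\<lambda>x. x \<bullet> th)"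
  by (rule additive_op_precomp[OF th_Hom])

private lemma loc_ab:
  assumes K: "local_pair K X1 X2 \<alpha> \<beta>"
  shows "lin G abc ((xx - yy) ^ K * f) = lin G bac ((xx - yy) ^ K * f)"
proof (rule G.lin_mult_cong)
  fix i :: "int \<times> int \<times> int"
  obtain p q r where i: "i = (p, q, r)" by (cases i)
  let ?\<Phi> = "\<lambda>k. md (px k) \<alpha> (md (py k) \<beta> (md r \<gamma> vac)) \<bullet> Assoc C X1 X2 (X3 \<boxtimes>\<^sub>o I)"
  let ?\<Psi> = "\<lambda>k. md (py k) \<beta> (md (px k) \<alpha> (md r \<gamma> vac)) \<bullet> Assoc C X2 X1 (X3 \<boxtimes>\<^sub>o I) \<bullet> (Braid C X1 X2 \<boxtimes> Ident C (X3 \<boxtimes>\<^sub>o I))"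
  show "lin G abc ((xx - yy) ^ K * sg i) = lin G bac ((xx - yy) ^ K * sg i)"
    unfolding i
  proof (rule local_pair_transfer[OF K vec_Hom(1)[of r], where s = "(1, 0, 0)" and t = "(0, 1, 0)" and e = "\<lambda>i j. (i, j, r)" and h = "\<lambda>x. x \<bullet> th"
        and \<Phi> = ?\<Phi> and \<Psi> = ?\<Psi> and i = p and j = q])
    fix k assume "k \<in> Poly_Mapping.keys ((xx - yy) ^ K * mon p q r)"
    then have "pz k = r" using keys_difference_power[of pz "(1, 0, 0)" "(0, 1, 0)" k K "(p, q, r)"] by simp
    then show "abc k = ?\<Phi> k \<bullet> th \<and> bac k = ?\<Psi> k \<bullet> th"
      by (simp add: abc_def bac_def typing)
  qed (auto intro!: op_abc op_Homs HomI simp: typing)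
qed (rule op_carrier)+

text \<open>One half of moving \<gamma> from the outside to the vacuum: here it passes \<beta>
  beneath the outer field of \<alpha>, and in \<open>loc_cab_acb\<close> it passes \<alpha>. The
  pair is taken with \<gamma> first because the common source starts with \<open>X3\<close>.\<close>

private lemma loc_acb:
  assumes K: "local_pair K X3 X2 \<gamma> \<beta>"
  shows "lin G acb ((yy - zz) ^ K * f) = lin G abc ((yy - zz) ^ K * f)"
proof (rule G.lin_mult_cong)
  fix i :: "int \<times> int \<times> int"
  obtain p q r where i: "i = (p, q, r)" by (cases i)
  let ?\<Phi> = "\<lambda>k. md (pz k) \<gamma> (md (py k) \<beta> vac) \<bullet> Assoc C X3 X2 I"
  let ?\<Psi> = "\<lambda>k. md (py k) \<beta> (md (pz k) \<gamma> vac) \<bullet> Assoc C X2 X3 I \<bullet> (Braid C X3 X2 \<boxtimes> Ident C I)"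
  let ?h = "\<lambda>x. md p \<alpha> x \<bullet> ro"
  have "ro \<in> Hom C B (X1 \<boxtimes>\<^sub>o ((X3 \<boxtimes>\<^sub>o X2) \<boxtimes>\<^sub>o I))" by (intro HomI; simp add: typing)
  then have h: "additive_op ((X3 \<boxtimes>\<^sub>o X2) \<boxtimes>\<^sub>o I) B ?h"
    by (intro additive_op_comp[OF additive_op_md[OF a] additive_op_precomp]) (simp_all add: typing)
  show "lin G acb ((yy - zz) ^ K * sg i) = lin G abc ((yy - zz) ^ K * sg i)"
    unfolding i
  proof (rule local_pair_transfer[OF K vec_Hom(4), where s = "(0, 0, 1)" and t = "(0, 1, 0)" and e = "\<lambda>i j. (p, j, i)" and h = ?h
        and \<Phi> = ?\<Phi> and \<Psi> = ?\<Psi> and i = r and j = q])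
    fix k assume "k \<in> Poly_Mapping.keys ((yy - zz) ^ K * mon p q r)"
    then have k: "px k = p" using keys_difference_power[of px "(0, 1, 0)" "(0, 0, 1)" k K "(p, q, r)"] by simp
    have "?h (?\<Psi> k) = md p \<alpha> (md (py k) \<beta> (md (pz k) \<gamma> vac))
      \<bullet> (Ident C X1 \<boxtimes> (Assoc C X2 X3 I \<bullet> (Braid C X3 X2 \<boxtimes> Ident C I))) \<bullet> ro"
      by (subst md_comp_right) (simp_all add: typing)
    then have "abc k = ?h (?\<Psi> k)"
      unfolding rot_cyc[OF objs Unit_Obj] by (simp add: abc_def k)
    then show "acb k = ?h (?\<Phi> k) \<and> abc k = ?h (?\<Psi> k)"
      by (simp add: acb_def k)
  qed (use h in \<open>auto intro!: op_Homs HomI simp: typing\<close>)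
qed (rule op_carrier)+

private lemma loc_cab_acb:
  assumes K: "local_pair K X3 X1 \<gamma> \<alpha>"
  shows "lin G cab ((xx - zz) ^ K * f) = lin G acb ((xx - zz) ^ K * f)"
proof (rule G.lin_mult_cong)
  fix i :: "int \<times> int \<times> int"
  obtain p q r where i: "i = (p, q, r)" by (cases i)
  let ?b = "md q \<beta> vac"
  let ?\<Phi> = "\<lambda>k. md (pz k) \<gamma> (md (px k) \<alpha> ?b) \<bullet> Assoc C X3 X1 (X2 \<boxtimes>\<^sub>o I)"
  let ?\<Psi> = "\<lambda>k. md (px k) \<alpha> (md (pz k) \<gamma> ?b) \<bullet> Assoc C X1 X3 (X2 \<boxtimes>\<^sub>o I) \<bullet> (Braid C X3 X1 \<boxtimes> Ident C (X2 \<boxtimes>\<^sub>o I))"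
  let ?h = "\<lambda>x. x \<bullet> Assoc C (X3 \<boxtimes>\<^sub>o X1) X2 I"
  have h: "additive_op ((X3 \<boxtimes>\<^sub>o X1) \<boxtimes>\<^sub>o (X2 \<boxtimes>\<^sub>o I)) B ?h"
    by (rule additive_op_precomp) (intro HomI; simp add: typing)
  show "lin G cab ((xx - zz) ^ K * sg i) = lin G acb ((xx - zz) ^ K * sg i)"
    unfolding i
  proof (rule local_pair_transfer[OF K vec_Hom(2)[of q], where s = "(0, 0, 1)" and t = "(1, 0, 0)" and e = "\<lambda>i j. (j, q, i)" and h = ?h
        and \<Phi> = ?\<Phi> and \<Psi> = ?\<Psi> and i = r and j = p])
    fix k assume "k \<in> Poly_Mapping.keys ((xx - zz) ^ K * mon p q r)"
    then have k: "py k = q" using keys_difference_power[of py "(1, 0, 0)" "(0, 0, 1)" k K "(p, q, r)"] by simp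
    have "cab k = md (pz k) \<gamma> (md (px k) \<alpha> ?b) \<bullet> (Ident C X3 \<boxtimes> Assoc C X1 X2 I) \<bullet> ta"
      unfolding cab_def k by (subst md_comp_right) (simp_all add: typing ta_arr)
    also have "(Ident C X3 \<boxtimes> Assoc C X1 X2 I) \<bullet> ta = Assoc C X3 X1 (X2 \<boxtimes>\<^sub>o I) \<bullet> Assoc C (X3 \<boxtimes>\<^sub>o X1) X2 I"
      unfolding ta_def using objs by (intro pentagon) (simp_all add: typing)
    finally have "cab k = ?h (?\<Phi> k)" by (simp add: typing)
    moreover have "acb k = md (px k) \<alpha> (md (pz k) \<gamma> ?b) \<bullet> (Ident C X1 \<boxtimes> Assoc C X3 X2 I) \<bullet> ro"
      unfolding acb_def k by (subst md_comp_right) (simp_all add: typing)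
    then have "acb k = ?h (?\<Psi> k)"
      unfolding rot_Braid[OF objs Unit_Obj, symmetric] by (simp add: typing)
    ultimately show "cab k = ?h (?\<Phi> k) \<and> acb k = ?h (?\<Psi> k)" by blast
  qed (use h in \<open>auto intro!: op_Homs HomI simp: typing\<close>)
qed (rule op_carrier)+

private lemma lin_zero_of_keys:
  fixes F :: "int \<times> int \<times> int \<Rightarrow> 'a"
  assumes F: "\<And>i. F i \<in> carrier G"
    and z: "\<And>i. i \<in> Poly_Mapping.keys f \<Longrightarrow> lin G F (e * sg i) = HZero C B V"
  shows "lin G F (e * f) = HZero C B V"
proof -
  have zero: "lin G (\<lambda>_. HZero C B V) P = HZero C B V" for P :: laurent
    using G.lin_eq_zero[of "\<lambda>_. HZero C B V" P] G.zero_closed by simp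
  have "lin G F (e * f) = lin G (\<lambda>_. HZero C B V) (e * f)"
    by (rule G.lin_mult_cong) (use F z zero G.zero_closed in simp_all)
  then show ?thesis using zero by simp
qed

private lemma vec_zero: "0 \<le> n \<Longrightarrow> md n \<alpha> vac = HZero C (X1 \<boxtimes>\<^sub>o I) V" "0 \<le> n \<Longrightarrow> md n \<beta> vac = HZero C (X2 \<boxtimes>\<^sub>o I) V"
  "0 \<le> n \<Longrightarrow> md n \<gamma> vac = HZero C (X3 \<boxtimes>\<^sub>o I) V"
  by (rule md_vac_nonneg[OF a] md_vac_nonneg[OF b] md_vac_nonneg[OF g]; assumption)+

private lemma min_exp_diff_power: "0 \<le> px i \<Longrightarrow> px s = 0 \<or> px s = 1 \<Longrightarrow> px t = 0 \<Longrightarrow> min_exp px 0 ((sg s - sg t) ^ K * sg i)"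
proof -
  assume "0 \<le> px i" "px s = 0 \<or> px s = 1" "px t = 0"
  then have "min_exp px (0 + 0) ((sg s - sg t) ^ K * sg i)"
    by (intro min_exp_mult min_exp_power min_exp_diff min_exp_single) auto
  then show ?thesis by simp
qed

text \<open>The power of x - y lets \<alpha> and \<beta> change places next to the vacuum and keeps
  x-exponents nonnegative, and a nonnegative mode of \<alpha> annihilates the vacuum.\<close>

private lemma loc_cab:
  assumes K: "local_pair K X1 X2 \<alpha> \<beta>" and f: "min_exp px 0 f"
  shows "lin G cab ((xx - yy) ^ K * f) = HZero C B V"
proof (rule lin_zero_of_keys)
  fix i :: "int \<times> int \<times> int" assume "i \<in> Poly_Mapping.keys f"
  then have px: "0 \<le> px i" using f by (simp add: min_exp_def)
  obtain p q r where i: "i = (p, q, r)" by (cases i)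
  let ?\<Phi> = "\<lambda>k. md (px k) \<alpha> (md (py k) \<beta> vac) \<bullet> Assoc C X1 X2 I"
  let ?\<Psi> = "\<lambda>k. md (py k) \<beta> (md (px k) \<alpha> vac) \<bullet> Assoc C X2 X1 I \<bullet> (Braid C X1 X2 \<boxtimes> Ident C I)"
  let ?h = "\<lambda>x. md r \<gamma> x \<bullet> ta"
  have "ta \<in> Hom C B (X3 \<boxtimes>\<^sub>o ((X1 \<boxtimes>\<^sub>o X2) \<boxtimes>\<^sub>o I))" using ta_arr by (intro HomI)
  then have h: "additive_op ((X1 \<boxtimes>\<^sub>o X2) \<boxtimes>\<^sub>o I) B ?h"
    by (intro additive_op_comp[OF additive_op_md[OF g] additive_op_precomp]) (simp_all add: typing)
  have PsH: "?\<Psi> k \<in> Hom C ((X1 \<boxtimes>\<^sub>o X2) \<boxtimes>\<^sub>o I) V" for k by (intro HomI; simp add: typing)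
  have "lin G cab ((xx - yy) ^ K * mon p q r) = lin G (\<lambda>k. ?h (?\<Psi> k)) ((xx - yy) ^ K * mon p q r)"
  proof (rule local_pair_transfer[OF K vec_Hom(4), where s = "(1, 0, 0)" and t = "(0, 1, 0)" and e = "\<lambda>i j. (i, j, r)" and h = ?h
        and \<Phi> = ?\<Phi> and \<Psi> = ?\<Psi> and i = p and j = q])
    fix k assume "k \<in> Poly_Mapping.keys ((xx - yy) ^ K * mon p q r)"
    then have "pz k = r" using keys_difference_power[of pz "(1, 0, 0)" "(0, 1, 0)" k K "(p, q, r)"] by simp
    then show "cab k = ?h (?\<Phi> k) \<and> ?h (?\<Psi> k) = ?h (?\<Psi> k)" by (simp add: cab_def)
  next
    show "?h (?\<Psi> k) \<in> Hom C B V" for k by (rule additive_opD(3)[OF h PsH])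
  qed (use h PsH in \<open>auto intro!: op_Homs HomI simp: typing\<close>)
  also have "\<dots> = \<zero>\<^bsub>G\<^esub>"
  proof (rule G.lin_eq_zero)
    show "?h (?\<Psi> k) \<in> carrier G" for k using additive_opD(3)[OF h PsH] by simp
    fix k assume "k \<in> Poly_Mapping.keys ((xx - yy) ^ K * mon p q r)"
    then have "0 \<le> px k" using min_exp_diff_power[of i "(1, 0, 0)" "(0, 1, 0)" K] px i by (auto simp: min_exp_def)
    then have "?\<Psi> k = HZero C (X2 \<boxtimes>\<^sub>o (X1 \<boxtimes>\<^sub>o I)) V \<bullet> Assoc C X2 X1 I \<bullet> (Braid C X1 X2 \<boxtimes> Ident C I)"
      using md_additive(1)[OF b, of "X1 \<boxtimes>\<^sub>o I"] by (simp add: vec_zero typing)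
    also have "\<dots> = HZero C ((X1 \<boxtimes>\<^sub>o X2) \<boxtimes>\<^sub>o I) V"
      by (rule precomp_additive(1)[OF _ V_Obj]) (intro HomI; simp add: typing)
    finally show "?h (?\<Psi> k) = \<zero>\<^bsub>G\<^esub>" using additive_opD(4)[OF h] by simp
  qed
  finally show "lin G cab ((xx - yy) ^ K * sg i) = HZero C B V" unfolding i by simp
qed (rule op_carrier)

text \<open>As for \<open>loc_cab\<close>, with \<alpha> moved past \<gamma> beneath the outer field
  of \<beta>.\<close>

private lemma loc_bac:
  assumes K: "local_pair K X1 X3 \<alpha> \<gamma>" and f: "min_exp px 0 f"
  shows "lin G bac ((xx - zz) ^ K * f) = HZero C B V"
proof (rule lin_zero_of_keys)
  fix i :: "int \<times> int \<times> int" assume "i \<in> Poly_Mapping.keys f"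
  then have px: "0 \<le> px i" using f by (simp add: min_exp_def)
  obtain p q r where i: "i = (p, q, r)" by (cases i)
  \<comment> \<open>\<open>local_pair\<close> delivers the inner word composed with an associator,
    which the word \<open>bac\<close> does not contain at this place; \<open>ai\<close> removes
    it.\<close>
  obtain ai where ai: "ai \<in> Arr C" "Dom C ai = X1 \<boxtimes>\<^sub>o (X3 \<boxtimes>\<^sub>o I)" "Cod C ai = (X1 \<boxtimes>\<^sub>o X3) \<boxtimes>\<^sub>o I"
    "Assoc C X1 X3 I \<bullet> ai = Ident C (X1 \<boxtimes>\<^sub>o (X3 \<boxtimes>\<^sub>o I))"
    using Assoc_iso[OF objs(1,3) Unit_Obj] by (rule iso_inverse)
  let ?\<Phi> = "\<lambda>k. md (px k) \<alpha> (md (pz k) \<gamma> vac) \<bullet> Assoc C X1 X3 I"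
  let ?\<Psi> = "\<lambda>k. md (pz k) \<gamma> (md (px k) \<alpha> vac) \<bullet> Assoc C X3 X1 I \<bullet> (Braid C X1 X3 \<boxtimes> Ident C I)"
  let ?e = "Assoc C X2 X1 (X3 \<boxtimes>\<^sub>o I) \<bullet> (Braid C X1 X2 \<boxtimes> Ident C (X3 \<boxtimes>\<^sub>o I)) \<bullet> th"
  let ?h = "\<lambda>x. md q \<beta> (x \<bullet> ai) \<bullet> ?e"
  have aiH: "ai \<in> Hom C (X1 \<boxtimes>\<^sub>o (X3 \<boxtimes>\<^sub>o I)) ((X1 \<boxtimes>\<^sub>o X3) \<boxtimes>\<^sub>o I)" using ai by (intro HomI)
  have "?e \<in> Hom C B (X2 \<boxtimes>\<^sub>o (X1 \<boxtimes>\<^sub>o (X3 \<boxtimes>\<^sub>o I)))" by (intro HomI; simp add: typing)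
  then have h: "additive_op ((X1 \<boxtimes>\<^sub>o X3) \<boxtimes>\<^sub>o I) B ?h"
    by (intro additive_op_comp[OF additive_op_comp[OF additive_op_precomp[OF aiH] additive_op_md[OF b]] additive_op_precomp])
      (simp_all add: typing)
  have PsH: "?\<Psi> k \<in> Hom C ((X1 \<boxtimes>\<^sub>o X3) \<boxtimes>\<^sub>o I) V" for k by (intro HomI; simp add: typing)
  have "lin G bac ((xx - zz) ^ K * mon p q r) = lin G (\<lambda>k. ?h (?\<Psi> k)) ((xx - zz) ^ K * mon p q r)"
  proof (rule local_pair_transfer[OF K vec_Hom(4), where s = "(1, 0, 0)" and t = "(0, 0, 1)" and e = "\<lambda>i j. (i, q, j)" and h = ?h
        and \<Phi> = ?\<Phi> and \<Psi> = ?\<Psi> and i = p and j = r])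
    fix k assume "k \<in> Poly_Mapping.keys ((xx - zz) ^ K * mon p q r)"
    then have k: "py k = q" using keys_difference_power[of py "(1, 0, 0)" "(0, 0, 1)" k K "(p, q, r)"] by simp
    have "?\<Phi> k \<bullet> ai = md (px k) \<alpha> (md (pz k) \<gamma> vac)"
      using ai by (simp add: typing Comp_Ident_arr)
    then show "bac k = ?h (?\<Phi> k) \<and> ?h (?\<Psi> k) = ?h (?\<Psi> k)" by (simp add: bac_def k)
  next
    show "?h (?\<Psi> k) \<in> Hom C B V" for k by (rule additive_opD(3)[OF h PsH])
  qed (use h PsH in \<open>auto intro!: op_Homs HomI simp: typing\<close>)
  also have "\<dots> = \<zero>\<^bsub>G\<^esub>"
  proof (rule G.lin_eq_zero)
    show "?h (?\<Psi> k) \<in> carrier G" for k using additive_opD(3)[OF h PsH] by simp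
    fix k assume "k \<in> Poly_Mapping.keys ((xx - zz) ^ K * mon p q r)"
    then have "0 \<le> px k" using min_exp_diff_power[of i "(1, 0, 0)" "(0, 0, 1)" K] px i by (auto simp: min_exp_def)
    then have "?\<Psi> k = HZero C (X3 \<boxtimes>\<^sub>o (X1 \<boxtimes>\<^sub>o I)) V \<bullet> Assoc C X3 X1 I \<bullet> (Braid C X1 X3 \<boxtimes> Ident C I)"
      using md_additive(1)[OF g, of "X1 \<boxtimes>\<^sub>o I"] by (simp add: vec_zero typing)
    also have "\<dots> = HZero C ((X1 \<boxtimes>\<^sub>o X3) \<boxtimes>\<^sub>o I) V"
      by (rule precomp_additive(1)[OF _ V_Obj]) (intro HomI; simp add: typing)
    finally show "?h (?\<Psi> k) = \<zero>\<^bsub>G\<^esub>" using additive_opD(4)[OF h] by simp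
  qed
  finally show "lin G bac ((xx - zz) ^ K * sg i) = HZero C B V" unfolding i by simp
qed (rule op_carrier)

text \<open>The braiding of \<open>X3\<close> past \<open>X1 \<boxtimes>\<^sub>o X2\<close> inside
  \<open>cyc\<close> is the one that locality of \<gamma> and u produces.\<close>

private lemma loc_uc:
  assumes N: "local_pair N X3 (X1 \<boxtimes>\<^sub>o X2) \<gamma> (md l \<alpha> \<beta>)"
  shows "lin G (cu l) ((yy - zz) ^ N * f) = lin G (uc l) ((yy - zz) ^ N * f)"
proof (rule G.lin_mult_cong)
  fix i :: "int \<times> int \<times> int"
  obtain p q r where i: "i = (p, q, r)" by (cases i)
  let ?u = "md l \<alpha> \<beta>"
  let ?\<Phi> = "\<lambda>k. md (pz k) \<gamma> (md (py k) ?u vac) \<bullet> Assoc C X3 (X1 \<boxtimes>\<^sub>o X2) I"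
  let ?\<Psi> = "\<lambda>k. md (py k) ?u (md (pz k) \<gamma> vac) \<bullet> Assoc C (X1 \<boxtimes>\<^sub>o X2) X3 I \<bullet> (Braid C X3 (X1 \<boxtimes>\<^sub>o X2) \<boxtimes> Ident C I)"
  let ?h = "\<lambda>x. x \<bullet> (Assoc C X3 X1 X2 \<boxtimes> Ident C I)"
  have h: "additive_op ((X3 \<boxtimes>\<^sub>o (X1 \<boxtimes>\<^sub>o X2)) \<boxtimes>\<^sub>o I) B ?h"
    by (rule additive_op_precomp) (intro HomI; simp add: typing)
  show "lin G (cu l) ((yy - zz) ^ N * sg i) = lin G (uc l) ((yy - zz) ^ N * sg i)"
    unfolding i
  proof (rule local_pair_transfer[OF N vec_Hom(4), where s = "(0, 0, 1)" and t = "(0, 1, 0)" and e = "\<lambda>i j. (p, j, i)" and h = ?h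
        and \<Phi> = ?\<Phi> and \<Psi> = ?\<Psi> and i = r and j = q])
    show "cu l k = ?h (?\<Phi> k) \<and> uc l k = ?h (?\<Psi> k)" for k
      by (simp add: cu_def uc_def ta_def cyc_def[OF objs Unit_Obj] typing)
  qed (use h in \<open>auto intro!: op_Homs HomI simp: typing\<close>)
qed (rule op_carrier)+

private lemma cu_expand:
  assumes J: "- q \<le> int J"
  shows "cu l (0, q, r) = lin G cab (expand_xy J l * mon 0 q r)"
proof -
  let ?S = "(X1 \<boxtimes>\<^sub>o X2) \<boxtimes>\<^sub>o I"
  let ?\<Phi> = "\<lambda>(p, q, r). md p \<alpha> (md q \<beta> vac) \<bullet> Assoc C X1 X2 I"
  let ?h = "\<lambda>x. md r \<gamma> x \<bullet> ta"
  have "ta \<in> Hom C B (X3 \<boxtimes>\<^sub>o ?S)" using ta_arr by (intro HomI)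
  then have h: "additive_op ?S B ?h"
    by (intro additive_op_comp[OF additive_op_md[OF g] additive_op_precomp]) (simp_all add: typing)
  have "lin G cab (expand_xy J l * mon 0 q r) = ?h (lin (HomG C ?S V) ?\<Phi> (expand_xy J l * mon 0 q r))"
  proof (rule additive_op_transfer[OF h])
    show "?\<Phi> i \<in> Hom C ?S V" for i by (cases i) (auto intro!: HomI simp: typing)
    fix i assume "i \<in> Poly_Mapping.keys (expand_xy J l * mon 0 q r)"
    then have "pz i = r" by (rule keys_expand)
    then show "cab i = ?h (?\<Phi> i)" by (simp add: cab_def case_prod_beta)
  qed (rule op_Homs)
  also have "\<dots> = ?h (md q (md l \<alpha> \<beta>) vac)"
    using product_vacuum_expansion[OF a b J, of l r] by simp
  finally show ?thesis by (simp add: cu_def)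
qed

section \<open>Truncation, and the identity applied to the vacuum\<close>

private lemma zero_right:
  "md p \<alpha> (HZero C (X2 \<boxtimes>\<^sub>o (X3 \<boxtimes>\<^sub>o I)) V) = HZero C (X1 \<boxtimes>\<^sub>o (X2 \<boxtimes>\<^sub>o (X3 \<boxtimes>\<^sub>o I))) V"
  "md p \<beta> (HZero C (X1 \<boxtimes>\<^sub>o (X3 \<boxtimes>\<^sub>o I)) V) = HZero C (X2 \<boxtimes>\<^sub>o (X1 \<boxtimes>\<^sub>o (X3 \<boxtimes>\<^sub>o I))) V"
  "md p \<alpha> (HZero C (X3 \<boxtimes>\<^sub>o I) V) = HZero C (X1 \<boxtimes>\<^sub>o (X3 \<boxtimes>\<^sub>o I)) V"
  "md p \<beta> (HZero C (X3 \<boxtimes>\<^sub>o I) V) = HZero C (X2 \<boxtimes>\<^sub>o (X3 \<boxtimes>\<^sub>o I)) V"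
  "md p (md l \<alpha> \<beta>) (HZero C (X3 \<boxtimes>\<^sub>o I) V) = HZero C ((X1 \<boxtimes>\<^sub>o X2) \<boxtimes>\<^sub>o (X3 \<boxtimes>\<^sub>o I)) V"
  using md_additive(1)[OF a] md_additive(1)[OF b] md_additive(1)[OF md_Hom[OF a b]] by (simp_all add: typing)

private lemma zero_pre: "e \<in> Arr C \<Longrightarrow> Dom C e = S' \<Longrightarrow> Cod C e = S \<Longrightarrow> HZero C S V \<bullet> e = HZero C S' V"
  using precomp_additive(1)[of e S' S V] V_Obj by (simp add: Hom_def)

private lemma abc_zero: "md (py i) \<beta> (md (pz i) \<gamma> vac) = HZero C (X2 \<boxtimes>\<^sub>o (X3 \<boxtimes>\<^sub>o I)) V \<Longrightarrow> abc i = HZero C B V"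
  unfolding abc_def by (simp add: zero_right) (rule zero_pre; simp add: typing)

private lemma bac_zero: "md (px i) \<alpha> (md (pz i) \<gamma> vac) = HZero C (X1 \<boxtimes>\<^sub>o (X3 \<boxtimes>\<^sub>o I)) V \<Longrightarrow> bac i = HZero C B V"
  unfolding bac_def by (simp add: zero_right) (rule zero_pre; simp add: typing)

private lemma md_minus_one_right:
  assumes f: "f \<in> Hom C X V"
  shows "md n f (md (- 1) \<gamma> vac) = md n f \<gamma> \<bullet> (Ident C X \<boxtimes> RUnit C X3)"
  unfolding md_vac_minus_one[OF g] using HomD[OF f] by (subst md_comp_right) (simp_all add: typing)

private lemma truncation_bound:
  assumes "compact_object U C X1" "compact_object U C X2" "compact_object U C X3"
  shows "\<exists>Q\<ge>0. \<forall>n\<ge>Q. md n \<beta> \<gamma> = HZero C (X2 \<boxtimes>\<^sub>o X3) V \<and>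
    md n \<alpha> \<gamma> = HZero C (X1 \<boxtimes>\<^sub>o X3) V \<and> md n \<alpha> \<beta> = HZero C (X1 \<boxtimes>\<^sub>o X2) V"
proof -
  note t = vertex_algebra.truncation[OF va, folded md_def]
  obtain Q1 Q2 Q3 where "\<forall>n\<ge>Q1. md n \<beta> \<gamma> = HZero C (X2 \<boxtimes>\<^sub>o X3) V"
    "\<forall>n\<ge>Q2. md n \<alpha> \<gamma> = HZero C (X1 \<boxtimes>\<^sub>o X3) V" "\<forall>n\<ge>Q3. md n \<alpha> \<beta> = HZero C (X1 \<boxtimes>\<^sub>o X2) V"
    using t[OF assms(2,3) b g] t[OF assms(1,3) a g] t[OF assms(1,2) a b] by blast
  then show ?thesis by (intro exI[of _ "max 0 (max Q1 (max Q2 Q3))"]) auto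
qed

private lemma borcherds_base_object:
  assumes c: "compact_object U C X1" "compact_object U C X2" "compact_object U C X3"
  shows "\<forall>\<^sub>F J in sequentially.
    lin G (\<lambda>(p, q, r :: int). uc p (0, q, - 1)) (\<Sum>n<J. Poly_Mapping.single (int n + l, m + k - int n, 0) (int_choose m n))
    = lin G abc (expand_xy J l * mon m k (- 1)) \<ominus>\<^bsub>G\<^esub> lin G bac (expand_yx J l * mon m k (- 1))"
proof -
  obtain Q where Q: "0 \<le> Q" "\<And>n. Q \<le> n \<Longrightarrow> md n \<beta> \<gamma> = HZero C (X2 \<boxtimes>\<^sub>o X3) V"
    "\<And>n. Q \<le> n \<Longrightarrow> md n \<alpha> \<gamma> = HZero C (X1 \<boxtimes>\<^sub>o X3) V" "\<And>n. Q \<le> n \<Longrightarrow> md n \<alpha> \<beta> = HZero C (X1 \<boxtimes>\<^sub>o X2) V"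
    using truncation_bound[OF c] by blast
  \<comment> \<open>Locality persists for larger exponents, so the sum of the four bounds serves all
    pairs.\<close>
  obtain K1 K2 K3 K4 where "\<forall>K\<ge>K1. local_pair K X1 X2 \<alpha> \<beta>" "\<forall>K\<ge>K2. local_pair K X3 X2 \<gamma> \<beta>"
    "\<forall>K\<ge>K3. local_pair K X3 X1 \<gamma> \<alpha>" "\<forall>K\<ge>K4. local_pair K X1 X3 \<alpha> \<gamma>"
    using locality_modes[OF c(1,2) a b] locality_modes[OF c(3,2) g b] locality_modes[OF c(3,1) g a]
      locality_modes[OF c(1,3) a g] by blast
  then have K: "local_pair K X1 X2 \<alpha> \<beta>" "local_pair K X3 X2 \<gamma> \<beta>" "local_pair K X3 X1 \<gamma> \<alpha>" "local_pair K X1 X3 \<alpha> \<gamma>"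
    if "K = K1 + K2 + K3 + K4" for K
    using that by simp_all
  define K where "K = K1 + K2 + K3 + K4"
  note K = K[OF K_def]
  have trunc_abc: "abc (p, q, r) = \<zero>\<^bsub>G\<^esub>" if "Q \<le> q" "- 1 \<le> r" for p q r
  proof (cases "r = - 1")
    case True
    \<comment> \<open>At z-exponent -1 the innermost word is \<gamma> itself up to the unit
      constraint, and the truncation axiom applies; larger z-exponents give zero already on the
      vacuum.\<close>
    have "md q \<beta> (md (- 1) \<gamma> vac) = HZero C (X2 \<boxtimes>\<^sub>o (X3 \<boxtimes>\<^sub>o I)) V"
      unfolding md_minus_one_right[OF b] Q(2)[OF that(1)] by (rule zero_pre) (simp_all add: typing)
    then show ?thesis using abc_zero[of "(p, q, r)"] True by simp
  next
    case False
    then show ?thesis using abc_zero[of "(p, q, r)"] vec_zero(3)[of r] zero_right(4) that by simp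
  qed
  have trunc_bac: "bac (p, q, r) = \<zero>\<^bsub>G\<^esub>" if "Q \<le> p" "- 1 \<le> r" for p q r
  proof (cases "r = - 1")
    case True
    have "md p \<alpha> (md (- 1) \<gamma> vac) = HZero C (X1 \<boxtimes>\<^sub>o (X3 \<boxtimes>\<^sub>o I)) V"
      unfolding md_minus_one_right[OF a] Q(3)[OF that(1)] by (rule zero_pre) (simp_all add: typing)
    then show ?thesis using bac_zero[of "(p, q, r)"] True by simp
  next
    case False
    then show ?thesis using bac_zero[of "(p, q, r)"] vec_zero(3)[of r] zero_right(3) that by simp
  qed
  have loc: "lin G abc ((xx - yy) ^ K * f) = lin G bac ((xx - yy) ^ K * f)" for f
    by (rule loc_ab[OF K(1)])
  have "\<forall>\<^sub>F J in sequentially. uc l (0, k, - 1) =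
      lin G abc (expand_xy J l * mon 0 k (- 1)) \<ominus>\<^bsub>G\<^esub> lin G bac (expand_yx J l * mon 0 k (- 1))" for l k
  proof -
    \<comment> \<open>Here compactness of \<open>X1 \<boxtimes>\<^sub>o X2\<close> is needed. The
      exponent \<open>N\<close> may vary with \<open>l\<close>, since it disappears from the
      conclusion that enters the recursion.\<close>
    obtain N where N: "local_pair N X3 (X1 \<boxtimes>\<^sub>o X2) \<gamma> (md l \<alpha> \<beta>)"
      using locality_modes[OF c(3) compact_ten[OF c(1,2)] g md_Hom[OF a b]] by blast
    show ?thesis
    proof (rule G.goddard_uniqueness[where K = K and N = N and Q = Q and cab = cab and cu = "cu l"])
      fix f
      show "lin G abc ((xx - zz) ^ K * (yy - zz) ^ K * f) = lin G cab ((xx - zz) ^ K * (yy - zz) ^ K * f)"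
        using loc_acb[OF K(2), of "(xx - zz) ^ K * f"] loc_cab_acb[OF K(3), of "(yy - zz) ^ K * f"]
        by (simp only: mult_ac)
      show "lin G (uc l) ((yy - zz) ^ N * f) = lin G (cu l) ((yy - zz) ^ N * f)"
        by (rule loc_uc[OF N, symmetric])
      show "lin G cab ((xx - yy) ^ K * f) = \<zero>\<^bsub>G\<^esub>" if "min_exp px 0 f"
        using loc_cab[OF K(1) that] by simp
      show "lin G bac ((xx - zz) ^ K * f) = \<zero>\<^bsub>G\<^esub>" if "min_exp px 0 f"
        using loc_bac[OF K(4) that] by simp
    next
      fix p q r :: int
      show "abc (p, q, r) = \<zero>\<^bsub>G\<^esub>" if "0 \<le> r"
        using abc_zero[of "(p, q, r)"] vec_zero(3)[OF that] zero_right(4) by simp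
      show "bac (p, q, r) = \<zero>\<^bsub>G\<^esub>" if "0 \<le> r"
        using bac_zero[of "(p, q, r)"] vec_zero(3)[OF that] zero_right(3) by simp
      show "uc l (p, q, r) = \<zero>\<^bsub>G\<^esub>" if "0 \<le> r"
        unfolding uc_def using vec_zero(3)[OF that] by (simp add: zero_right) (rule zero_pre; simp add: typing)
      show "cab (p, q, r) = \<zero>\<^bsub>G\<^esub>" if "0 \<le> q"
      proof -
        have "md p \<alpha> (md q \<beta> vac) \<bullet> Assoc C X1 X2 I = HZero C ((X1 \<boxtimes>\<^sub>o X2) \<boxtimes>\<^sub>o I) V"
          unfolding vec_zero(2)[OF that] using md_additive(1)[OF a, of "X2 \<boxtimes>\<^sub>o I"]
          by (simp add: typing) (rule zero_pre; simp add: typing)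
        then have "cab (p, q, r) = HZero C (X3 \<boxtimes>\<^sub>o ((X1 \<boxtimes>\<^sub>o X2) \<boxtimes>\<^sub>o I)) V \<bullet> ta"
          using md_additive(1)[OF g, of "(X1 \<boxtimes>\<^sub>o X2) \<boxtimes>\<^sub>o I"] by (simp add: cab_def typing)
        then show ?thesis using zero_pre[OF ta_arr] by simp
      qed
    qed (use loc trunc_abc trunc_bac cu_expand op_carrier in blast)+
  qed
  then show ?thesis
  proof (rule G.borcherds_recursion[where K = K and Q = Q, OF op_carrier(1,2,5) loc trunc_abc trunc_bac, rotated -1])
    show "uc l (0, k, - 1) = \<zero>\<^bsub>G\<^esub>" if "Q \<le> l" for l k
    proof -
      have "md k (HZero C (X1 \<boxtimes>\<^sub>o X2) V) (md (- 1) \<gamma> vac) = HZero C ((X1 \<boxtimes>\<^sub>o X2) \<boxtimes>\<^sub>o (X3 \<boxtimes>\<^sub>o I)) V"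
        using vec_Hom(1) by (rule md_left_zero) (simp add: typing)
      then show ?thesis
        unfolding uc_def Q(4)[OF that] by simp (rule zero_pre; simp add: typing)
    qed
  qed
qed

section \<open>From the vacuum back to the third argument\<close>

private abbreviation (input) "S \<equiv> (X1 \<boxtimes>\<^sub>o X2) \<boxtimes>\<^sub>o X3"
private abbreviation (input) "GS \<equiv> HomG C ((X1 \<boxtimes>\<^sub>o X2) \<boxtimes>\<^sub>o X3) V"

private definition "iter n k = md k (md n \<alpha> \<beta>) \<gamma>"
private definition "left_nest i = md (px i) \<alpha> (md (py i) \<beta> \<gamma>) \<bullet> Assoc C X1 X2 X3"
private definition "right_nest i = md (py i) \<beta> (md (px i) \<alpha> \<gamma>) \<bullet> Assoc C X2 X1 X3 \<bullet> (Braid C X1 X2 \<boxtimes> Ident C X3)"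

private lemma nest_Hom: "iter n k \<in> Hom C S V" "left_nest i \<in> Hom C S V" "right_nest i \<in> Hom C S V"
  by (intro HomI; simp add: iter_def left_nest_def right_nest_def typing)+

interpretation GS: abelian_group "HomG C ((X1 \<boxtimes>\<^sub>o X2) \<boxtimes>\<^sub>o X3) V"
  by (rule HomG_ab[OF nest_Hom(2)])

text \<open>Puts the three factors into the order of the statement and removes the unit. A word with
  z-exponent -1 is the corresponding product of \<alpha>, \<beta>, \<gamma> followed by
  \<open>pr\<close>.\<close>

private definition "pr = (Ident C (X1 \<boxtimes>\<^sub>o X2) \<boxtimes> RUnit C X3) \<bullet> th"

private lemma pr_arr: "pr \<in> Arr C" "Dom C pr = B" "Cod C pr = S"
  by (simp_all add: pr_def typing)

text \<open>Both factors of \<open>pr\<close> have sections: \<open>cyc\<close> by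
  \<open>cyc_right_inverse\<close>, the unit constraint because it is invertible.\<close>

private lemma pr_cancel:
  assumes f: "f \<in> Hom C S V" and h: "h \<in> Hom C S V" and eq: "f \<bullet> pr = h \<bullet> pr"
  shows "f = h"
proof -
  obtain e where e: "e \<in> Arr C" "Dom C e = Cod C th" "Cod C e = Dom C th" "th \<bullet> e = Ident C (Cod C th)"
    using cyc_right_inverse[OF objs Unit_Obj] by blast
  obtain r where r: "r \<in> Arr C" "Dom C r = X3" "Cod C r = X3 \<boxtimes>\<^sub>o I" "RUnit C X3 \<bullet> r = Ident C X3"
    using RUnit_iso[OF objs(3)] by (rule iso_inverse)
  have "pr \<bullet> e \<bullet> (Ident C (X1 \<boxtimes>\<^sub>o X2) \<boxtimes> r)
    = (Ident C (X1 \<boxtimes>\<^sub>o X2) \<boxtimes> RUnit C X3) \<bullet> (th \<bullet> e) \<bullet> (Ident C (X1 \<boxtimes>\<^sub>o X2) \<boxtimes> r)"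
    using e(1-3) r(1-3) by (simp add: pr_def typing)
  also have "\<dots> = Ident C S"
    unfolding e(4) using r by (simp add: typing Ident_Comp_arr interchange TenA_Ident)
  finally show ?thesis
    using right_cancel[of f h pr "e \<bullet> (Ident C (X1 \<boxtimes>\<^sub>o X2) \<boxtimes> r)"] eq e(1-3) r(1-3) HomD[OF f] HomD[OF h]
    by (simp add: pr_arr typing)
qed

private lemma uc_pr: "uc n (0, k, - 1) = iter n k \<bullet> pr"
  unfolding uc_def iter_def pr_def by (simp add: md_minus_one_right[OF md_Hom[OF a b]]) (simp add: typing)

private lemma abc_pr:
  assumes "pz i = - 1"
  shows "abc i = left_nest i \<bullet> pr"
proof -
  have "abc i = md (px i) \<alpha> (md (py i) \<beta> \<gamma>) \<bullet> (Ident C X1 \<boxtimes> (Ident C X2 \<boxtimes> RUnit C X3)) \<bullet> Assoc C X1 X2 (X3 \<boxtimes>\<^sub>o I) \<bullet> th"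
    unfolding abc_def assms md_minus_one_right[OF b] by (subst md_comp_right) (simp_all add: typing)
  also have "(Ident C X1 \<boxtimes> (Ident C X2 \<boxtimes> RUnit C X3)) \<bullet> Assoc C X1 X2 (X3 \<boxtimes>\<^sub>o I) \<bullet> th
    = Assoc C X1 X2 X3 \<bullet> ((Ident C X1 \<boxtimes> Ident C X2) \<boxtimes> RUnit C X3) \<bullet> th"
    by (subst Assoc_nat_assoc) (simp_all add: typing)
  finally show ?thesis by (simp add: left_nest_def pr_def TenA_Ident typing)
qed

private lemma bac_pr:
  assumes "pz i = - 1"
  shows "bac i = right_nest i \<bullet> pr"
proof -
  have "bac i = md (py i) \<beta> (md (px i) \<alpha> \<gamma>) \<bullet> (Ident C X2 \<boxtimes> (Ident C X1 \<boxtimes> RUnit C X3)) \<bullet> Assoc C X2 X1 (X3 \<boxtimes>\<^sub>o I)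
      \<bullet> (Braid C X1 X2 \<boxtimes> Ident C (X3 \<boxtimes>\<^sub>o I)) \<bullet> th"
    unfolding bac_def assms md_minus_one_right[OF a] by (subst md_comp_right) (simp_all add: typing)
  also have "(Ident C X2 \<boxtimes> (Ident C X1 \<boxtimes> RUnit C X3)) \<bullet> Assoc C X2 X1 (X3 \<boxtimes>\<^sub>o I)
      \<bullet> (Braid C X1 X2 \<boxtimes> Ident C (X3 \<boxtimes>\<^sub>o I)) \<bullet> th
    = Assoc C X2 X1 X3 \<bullet> ((Ident C X2 \<boxtimes> Ident C X1) \<boxtimes> RUnit C X3) \<bullet> (Braid C X1 X2 \<boxtimes> Ident C (X3 \<boxtimes>\<^sub>o I)) \<bullet> th"
    by (subst Assoc_nat_assoc) (simp_all add: typing)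
  also have "((Ident C X2 \<boxtimes> Ident C X1) \<boxtimes> RUnit C X3) \<bullet> (Braid C X1 X2 \<boxtimes> Ident C (X3 \<boxtimes>\<^sub>o I)) \<bullet> th
    = (Braid C X1 X2 \<boxtimes> Ident C X3) \<bullet> pr"
    unfolding pr_def by (simp add: typing interchange_assoc TenA_Ident Ident_Comp_arr Comp_Ident_arr)
  finally show ?thesis by (simp add: right_nest_def pr_arr typing)
qed

text \<open>The expansions do not touch the z-exponent -1, by \<open>keys_expand\<close>. So both
  sides of \<open>borcherds_base_object\<close> factor through \<open>pr\<close>, which is then
  cancelled.\<close>

private lemma borcherds_expanded:
  assumes c: "compact_object U C X1" "compact_object U C X2" "compact_object U C X3"
  shows "\<forall>\<^sub>F J in sequentially.
    lin GS (\<lambda>(n, k, r :: int). iter n k) (\<Sum>n<J. Poly_Mapping.single (int n + l, m + k - int n, 0) (int_choose m n))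
    = lin GS left_nest (expand_xy J l * mon m k (- 1)) \<ominus>\<^bsub>GS\<^esub> lin GS right_nest (expand_yx J l * mon m k (- 1))"
  using borcherds_base_object[OF c, of l m k]
proof eventually_elim
  case (elim J)
  let ?P = "\<Sum>n<J. Poly_Mapping.single (int n + l, m + k - int n, 0 :: int) (int_choose m n)"
  have prH: "pr \<in> Hom C B S" using pr_arr by (intro HomI)
  note op = additive_op_precomp[OF prH]
  note GSc = nest_Hom(2,3)
  have iterH: "(case i of (n, k, r :: int) \<Rightarrow> iter n k) \<in> Hom C S V" for i
    using nest_Hom(1) by (cases i) simp
  have L: "lin GS left_nest P \<in> Hom C S V" "lin GS right_nest P \<in> Hom C S V"
      "lin GS (\<lambda>(n, k, r :: int). iter n k) P \<in> Hom C S V" for P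
    using GS.lin_closed[of left_nest P] GS.lin_closed[of right_nest P]
      GS.lin_closed[of "\<lambda>(n, k, r). iter n k" P] nest_Hom iterH by simp_all
  have "lin G (\<lambda>(p, q, r :: int). uc p (0, q, - 1)) ?P = lin GS (\<lambda>(n, k, r). iter n k) ?P \<bullet> pr"
  proof (rule additive_op_transfer[OF op iterH])
    show "(case i of (p, q, r :: int) \<Rightarrow> uc p (0, q, - 1)) \<in> Hom C B V" for i
      using op_Homs(5) by (cases i) simp
    show "(case i of (p, q, r :: int) \<Rightarrow> uc p (0, q, - 1)) = (case i of (n, k, r) \<Rightarrow> iter n k) \<bullet> pr" for i
      using uc_pr by (cases i) simp
  qed
  moreover have "lin G abc (expand_xy J l * mon m k (- 1)) = lin GS left_nest (expand_xy J l * mon m k (- 1)) \<bullet> pr"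
    by (rule additive_op_transfer[OF op GSc(1) op_Homs(1)]) (rule abc_pr[OF keys_expand(1)])
  moreover have "lin G bac (expand_yx J l * mon m k (- 1)) = lin GS right_nest (expand_yx J l * mon m k (- 1)) \<bullet> pr"
    by (rule additive_op_transfer[OF op GSc(2) op_Homs(2)]) (rule bac_pr[OF keys_expand(2)])
  ultimately have "lin GS (\<lambda>(n, k, r). iter n k) ?P \<bullet> pr
    = (lin GS left_nest (expand_xy J l * mon m k (- 1)) \<ominus>\<^bsub>GS\<^esub> lin GS right_nest (expand_yx J l * mon m k (- 1))) \<bullet> pr"
    using elim precomp_additive(3)[OF prH V_Obj L(1,2)] by simp
  then show ?case
    by (rule pr_cancel[OF L(3) GS.minus_closed[unfolded HomG_simps, OF L(1,2)]])
qed

private lemma borcherds_left_eq: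
  "borcherds_left C A S ((\<alpha> \<boxtimes> \<beta>) \<boxtimes> \<gamma>) m k l n = add_pow GS (int_choose m n) (iter (int n + l) (m + k - int n))"
proof -
  have "Mode A (m + k - int n) \<bullet> (Mode A (int n + l) \<boxtimes> Ident C V) \<bullet> ((\<alpha> \<boxtimes> \<beta>) \<boxtimes> \<gamma>) = iter (int n + l) (m + k - int n)"
    by (simp add: iter_def md_def typing Mode_arr interchange Ident_Comp_arr)
  then show ?thesis by (simp add: borcherds_left_def Let_def)
qed

private lemma borcherds_right_eq:
  "borcherds_right C A S ((\<alpha> \<boxtimes> \<beta>) \<boxtimes> \<gamma>) m k l j
    = add_pow GS (int_choose l j * (- 1) ^ j) (left_nest (l - int j + m, int j + k, - 1))
      \<ominus>\<^bsub>GS\<^esub> add_pow GS (int_choose l j * (if even (l - int j) then 1 else - 1)) (right_nest (int j + m, l - int j + k, - 1))"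
proof -
  let ?abc = "(\<alpha> \<boxtimes> \<beta>) \<boxtimes> \<gamma>" and ?W = "(V \<boxtimes>\<^sub>o V) \<boxtimes>\<^sub>o V"
  let ?P = "Mode A (m + l - int j) \<bullet> (Ident C V \<boxtimes> Mode A (k + int j)) \<bullet> Assoc C V V V"
  let ?Q = "Mode A (k + l - int j) \<bullet> (Ident C V \<boxtimes> Mode A (m + int j)) \<bullet> Assoc C V V V \<bullet> (Braid C V V \<boxtimes> Ident C V)"
  let ?s = "if even l then 1 else - 1 :: int" and ?c = "int_choose l j * (- 1) ^ j"
  let ?L = "left_nest (l - int j + m, int j + k, - 1)" and ?R = "right_nest (int j + m, l - int j + k, - 1)"
  note [simp] = typing Mode_arr Ident_Comp_arr Comp_Ident_arr
  interpret W: abelian_group "HomG C ?W V" by (rule HomG_group) simp_all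
  have abcH: "?abc \<in> Hom C S ?W" by (intro HomI) simp_all
  have PQ: "?P \<in> Hom C ?W V" "?Q \<in> Hom C ?W V" by (intro HomI; simp)+
  have sQ: "add_pow (HomG C ?W V) ?s ?Q \<in> Hom C ?W V" using W.int_scale_closed[of ?Q ?s] PQ(2) by simp
  have "?P \<bullet> ?abc = ?L"
    by (simp add: left_nest_def md_def Assoc_nat interchange interchange_assoc algebra_simps)
  moreover have "?Q \<bullet> ?abc = ?R"
  proof -
    have "?Q \<bullet> ?abc = Mode A (k + l - int j) \<bullet> (Ident C V \<boxtimes> Mode A (m + int j)) \<bullet> Assoc C V V V \<bullet> ((Braid C V V \<bullet> (\<alpha> \<boxtimes> \<beta>)) \<boxtimes> \<gamma>)"
      by (simp add: interchange)
    also have "Braid C V V \<bullet> (\<alpha> \<boxtimes> \<beta>) = (\<beta> \<boxtimes> \<alpha>) \<bullet> Braid C X1 X2" by (simp add: Braid_nat)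
    also have "((\<beta> \<boxtimes> \<alpha>) \<bullet> Braid C X1 X2) \<boxtimes> \<gamma> = ((\<beta> \<boxtimes> \<alpha>) \<boxtimes> \<gamma>) \<bullet> (Braid C X1 X2 \<boxtimes> Ident C X3)"
      by (simp add: interchange)
    also have "Mode A (k + l - int j) \<bullet> (Ident C V \<boxtimes> Mode A (m + int j)) \<bullet> Assoc C V V V \<bullet> \<dots> = ?R"
      by (simp add: right_nest_def md_def Assoc_nat_assoc interchange_assoc algebra_simps)
    finally show ?thesis .
  qed
  ultimately have e: "(?P \<ominus>\<^bsub>HomG C ?W V\<^esub> add_pow (HomG C ?W V) ?s ?Q) \<bullet> ?abc = ?L \<ominus>\<^bsub>GS\<^esub> add_pow GS ?s ?R"
    using precomp_additive(3)[OF abcH V_Obj PQ(1) sQ] precomp_additive(2)[OF abcH V_Obj PQ(2), of ?s] by simp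
  have H: "?L \<in> carrier GS" "?R \<in> carrier GS" using nest_Hom by simp_all
  have "add_pow GS ?c (?L \<ominus>\<^bsub>GS\<^esub> add_pow GS ?s ?R) = add_pow GS ?c ?L \<ominus>\<^bsub>GS\<^esub> add_pow GS ?c (add_pow GS ?s ?R)"
    by (rule GS.add_pow_diff[OF H(1) GS.int_scale_closed[OF H(2)]])
  also have "add_pow GS ?c (add_pow GS ?s ?R) = add_pow GS (?s * ?c) ?R"
    using GS.add.int_pow_pow[OF H(2)] by simp
  \<comment> \<open>(-1)^l (-1)^j has the parity of l - j, which is the sign in
    \<open>expand_yx\<close>.\<close>
  also have "?s * ?c = int_choose l j * (if even (l - int j) then 1 else - 1)"
    by (cases "even j") auto
  finally show ?thesis
    unfolding borcherds_right_def Let_def e .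
qed

lemma borcherds_identity:
  fixes m k l :: int
  assumes c: "compact_object U C X1" "compact_object U C X2" "compact_object U C X3"
  defines "L \<equiv> borcherds_left C A S ((\<alpha> \<boxtimes> \<beta>) \<boxtimes> \<gamma>) m k l"
    and "R \<equiv> borcherds_right C A S ((\<alpha> \<boxtimes> \<beta>) \<boxtimes> \<gamma>) m k l"
  shows "finite (support GS L) \<and> finite (support GS R) \<and> finsum GS L (support GS L) = finsum GS R (support GS R)"
proof -
  have H: "iter n k \<in> carrier GS" "left_nest i \<in> carrier GS" "right_nest i \<in> carrier GS" for n k i
    using nest_Hom by simp_all
  have iterH: "(case i of (n, k, r :: int) \<Rightarrow> iter n k) \<in> carrier GS" for i
    using H(1) by (cases i) simp
  obtain Q where "0 \<le> Q" and Q: "\<And>n. Q \<le> n \<Longrightarrow> md n \<beta> \<gamma> = HZero C (X2 \<boxtimes>\<^sub>o X3) V"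
    "\<And>n. Q \<le> n \<Longrightarrow> md n \<alpha> \<gamma> = HZero C (X1 \<boxtimes>\<^sub>o X3) V" "\<And>n. Q \<le> n \<Longrightarrow> md n \<alpha> \<beta> = HZero C (X1 \<boxtimes>\<^sub>o X2) V"
    using truncation_bound[OF c] by blast
  have iter0: "iter n k = \<zero>\<^bsub>GS\<^esub>" if "Q \<le> n" for n k
    unfolding iter_def Q(3)[OF that] using md_left_zero[OF g, of "X1 \<boxtimes>\<^sub>o X2"] by (simp add: typing)
  have left0: "left_nest (p, q, r) = \<zero>\<^bsub>GS\<^esub>" if "Q \<le> q" for p q r
    using Q(1)[OF that] md_additive(1)[OF a, of "X2 \<boxtimes>\<^sub>o X3"]
    by (simp add: left_nest_def typing) (rule zero_pre; simp add: typing)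
  have right0: "right_nest (p, q, r) = \<zero>\<^bsub>GS\<^esub>" if "Q \<le> p" for p q r
    using Q(2)[OF that] md_additive(1)[OF b, of "X1 \<boxtimes>\<^sub>o X3"]
    by (simp add: right_nest_def typing) (rule zero_pre; simp add: typing)
  \<comment> \<open>One \<open>J\<close> past which all summands vanish and for which the expanded
    identity holds: sums up to \<open>J\<close> are then the sums over the supports.\<close>
  obtain J where J: "nat (Q - l) + nat (Q - k) + nat (Q - m) \<le> J"
    and eq: "lin GS (\<lambda>(n, k, r :: int). iter n k) (\<Sum>n<J. Poly_Mapping.single (int n + l, m + k - int n, 0) (int_choose m n))
    = lin GS left_nest (expand_xy J l * mon m k (- 1)) \<ominus>\<^bsub>GS\<^esub> lin GS right_nest (expand_yx J l * mon m k (- 1))"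
    using eventually_happens'[OF sequentially_bot eventually_conj[OF
        eventually_ge_at_top[of "nat (Q - l) + nat (Q - k) + nat (Q - m)"] borcherds_expanded[OF c, of l m k]]]
    by blast
  have LH: "L n \<in> carrier GS" for n unfolding L_def borcherds_left_eq by (rule GS.int_scale_closed[OF H(1)])
  have RH: "R n \<in> carrier GS" for n unfolding R_def borcherds_right_eq
    by (intro GS.minus_closed GS.int_scale_closed H)
  have L0: "L n = \<zero>\<^bsub>GS\<^esub>" if "J \<le> n" for n
    unfolding L_def borcherds_left_eq using iter0[of "int n + l" "m + k - int n"] J that GS.add.int_pow_one by simp
  have R0: "R n = \<zero>\<^bsub>GS\<^esub>" if "J \<le> n" for n
  proof -
    have "left_nest (l - int n + m, int n + k, - 1) = \<zero>\<^bsub>GS\<^esub>" "right_nest (int n + m, l - int n + k, - 1) = \<zero>\<^bsub>GS\<^esub>"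
      using J that by (intro left0 right0; simp)+
    then show ?thesis
      unfolding R_def borcherds_right_eq using GS.add.int_pow_one GS.diff_zero[OF GS.zero_closed] by simp
  qed
  have sub: "support GS L \<subseteq> {..<J}" "support GS R \<subseteq> {..<J}"
    using L0 R0 by (auto simp: support_def not_less[symmetric])
  have "finsum GS L (support GS L) = finsum GS L {..<J}"
    by (rule GS.add.finprod_mono_neutral_cong_left) (use sub LH in \<open>auto simp: support_def\<close>)
  also have "\<dots> = lin GS (\<lambda>(n, k, r :: int). iter n k) (\<Sum>n<J. Poly_Mapping.single (int n + l, m + k - int n, 0) (int_choose m n))"
    unfolding L_def borcherds_left_eq by (subst GS.lin_sum[OF iterH]) (simp_all add: GS.lin_single[OF iterH])
  also have "\<dots> = lin GS left_nest (expand_xy J l * mon m k (- 1)) \<ominus>\<^bsub>GS\<^esub> lin GS right_nest (expand_yx J l * mon m k (- 1))"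
    by (rule eq)
  also have "\<dots> = finsum GS (\<lambda>j. add_pow GS (int_choose l j * (- 1) ^ j) (left_nest (l - int j + m, int j + k, - 1))) {..<J}
    \<ominus>\<^bsub>GS\<^esub> finsum GS (\<lambda>j. add_pow GS (int_choose l j * (if even (l - int j) then 1 else - 1))
      (right_nest (int j + m, l - int j + k, - 1))) {..<J}"
    unfolding expand_xy_def expand_yx_def sum_distrib_right mult_single add_Pair add_0 mult_1_right
      GS.lin_sum[OF H(2) finite_lessThan] GS.lin_sum[OF H(3) finite_lessThan] GS.lin_single[OF H(2)] GS.lin_single[OF H(3)] ..
  also have "\<dots> = finsum GS R {..<J}"
    unfolding R_def borcherds_right_eq
    by (rule GS.finsum_diff[symmetric]) (simp_all only: finite_lessThan GS.int_scale_closed H)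
  also have "\<dots> = finsum GS R (support GS R)"
    by (rule GS.add.finprod_mono_neutral_cong_left[symmetric]) (use sub RH in \<open>auto simp: support_def\<close>)
  finally show ?thesis using sub finite_subset by blast
qed

end

end

theorem theorem3p2:
  fixes U :: "'u itself"
    and C :: "('o, 'a, 'x) additive_smcat_scheme"
    and C0 :: "('p, 'b, 'y) additive_smcat_scheme"
    and A :: "('o, 'a, 'v) va_data_scheme"
    and m k l :: int
  assumes "ind_rigid_category U C C0"
    and "vertex_algebra U C A"
    and "compact_object U C X1" "compact_object U C X2" "compact_object U C X3"
    and "\<alpha> \<in> Hom C X1 (VObj A)" "\<beta> \<in> Hom C X2 (VObj A)" "\<gamma> \<in> Hom C X3 (VObj A)"
  defines "S \<equiv> (X1 \<boxtimes>\<^sub>o\<^bsub>C\<^esub> X2) \<boxtimes>\<^sub>o\<^bsub>C\<^esub> X3"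
    and "abc \<equiv> (\<alpha> \<boxtimes>\<^bsub>C\<^esub> \<beta>) \<boxtimes>\<^bsub>C\<^esub> \<gamma>"
  defines "G \<equiv> HomG C S (VObj A)"
    and "L \<equiv> borcherds_left C A S abc m k l"
    and "R \<equiv> borcherds_right C A S abc m k l"
  shows "finite (support G L) \<and> finite (support G R) \<and>
    finsum G L (support G L) = finsum G R (support G R)"
proof -
  note defs = G_def L_def R_def S_def abc_def
  interpret ind_rigid_category U C C0 by fact
  interpret compact_vertex_algebra C U A
    by (intro compact_vertex_algebra.intro compact_vertex_algebra_axioms.intro)
      (fact preadditive_symmetric_monoidal_axioms assms(2) compact_tensor Hom_torsion_free)+
  show ?thesis
    unfolding defs
    by (rule borcherds_identity) fact+
qed

end
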